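(* A class of point equivalent third order ODEs $x'''=F(t,x,x',x'')$ defines an Einstein-Weyl structure on its solution space if and only if $W_0=0$ and $$2V'(K_1)+V(K_1')=0.$$ Additionally $C=-\frac32\left(V'(K_1)-V(K_0)\right)$, and under the Wünschmann condition $W_0=0$ one has $2V'(K_1)+V(K_1')=2(V'(K_1)-V(K_0))=-\frac43C$.
   Context: On $J^2(\mathbb{R},\mathbb{R})$ with coordinates $t,x_0,x_1,x_2$, $\partial_i=\partial/\partial x_i$, let $X_F=\partial_t+x_1\partial_0+x_2\partial_1+F\partial_2$; $M_F=J^2(\mathbb{R},\mathbb{R})/X_F$ is the (local) solution space with projection $\pi$. Point transformations are transformations of the variables $(t,x)$. A prime on a function denotes its derivative along $X_F$. Let $g$ be a nowhere vanishing local solution of $X_F(g)=\frac g3\partial_2F$, $V=g\partial_2$, $V'=[X_F,V]$, $V''=[X_F,V']$, $V'''=[X_F,V'']$. The functions $K_0,K_1$ are defined by $V'''=-K_0V+K_1V'$; explicitly $K_0=\partial_0F-X_F(\partial_1F)+\frac13\partial_1F\partial_2F+\frac23X_F^2(\partial_2F)-\frac23X_F(\partial_2F)\partial_2F+\frac2{27}(\partial_2F)^3$, $K_1=\partial_1F-X_F(\partial_2F)+\frac13(\partial_2F)^2$. In the identities with $C$ the common factor $g$ is neglected, i.e. $V=\partial_2$, $V'=-\partial_1-\frac23\partial_2F\partial_2$. The Wünschmann and Cartan invariants are $W_0=\partial_0F-\frac12X_F(\partial_1F)+\frac13\partial_1F\partial_2F+\frac16X_F^2(\partial_2F)-\frac13X_F(\partial_2F)\partial_2F+\frac2{27}(\partial_2F)^3$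 $(=K_0+\frac12K_1')$ and $C=X_F^2(\partial_2^2F)-X_F(\partial_1\partial_2F)+\partial_0\partial_2F$. A three-dimensional paraconformal structure is a field of non-degenerate quadratic cones, i.e. a conformal class $[\mathbf g]$ of Lorentzian signature. A Weyl connection for $[\mathbf g]$ is a torsion-free connection $\nabla$ with $\nabla\mathbf g=\varphi\,\mathbf g$ for a one-form $\varphi$ (depending on $\mathbf g\in[\mathbf g]$). $([\mathbf g],\nabla)$ is an Einstein-Weyl structure if $Ric(\nabla)_{sym}=\frac13R_{\mathbf g}(\nabla)\mathbf g$, where $Ric(\nabla)_{sym}$ is the symmetric part of the Ricci tensor and $R_{\mathbf g}(\nabla)$ the scalar curvature with respect to $\mathbf g$. The class of the equation defines an Einstein-Weyl structure on $M_F$ if the lines $\mathbb{R}\pi_*\partial_2$ along each fibre of $\pi$ are null lines of a Lorentzian conformal class $[\mathbf g]$ on $M_F$ and there is a Weyl connection $\nabla$ for $[\mathbf g]$, with $([\mathbf g],\nabla)$ Einstein-Weyl, such that the projections to $M_F$ of the integral manifolds of $\mathcal{D}_2=\mathrm{span}\{\partial_2,\partial_1\}$ are totally geodesic with respect to $\nabla$. *)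

theory Defs
  imports "HOL-Analysis.Analysis"
begin

section \<open>Smooth maps and vector fields on open subsets of normed spaces\<close>

text \<open>
  The predicates below are meant for open \<open>S\<close>. On a finite-dimensional space, \<open>Ck_on k f S\<close> says
  that all iterated directional derivatives of \<open>f\<close> up to order \<open>k\<close> exist and are continuous.
\<close>

primrec Ck_on ::
  "nat \<Rightarrow> ('a::real_normed_vector \<Rightarrow> 'b::real_normed_vector) \<Rightarrow> 'a set \<Rightarrow> bool" where
  "Ck_on 0 f S \<longleftrightarrow> continuous_on S f"
| "Ck_on (Suc k) f S \<longleftrightarrow>
     (\<forall>x\<in>S. f differentiable (at x)) \<and>
     (\<forall>v. Ck_on k (\<lambda>x. frechet_derivative f (at x) v) S)"

definition smooth_on ::
  "'a set \<Rightarrow> ('a::real_normed_vector \<Rightarrow> 'b::real_normed_vector) \<Rightarrow> bool" where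
  "smooth_on S f \<longleftrightarrow> (\<forall>k. Ck_on k f S)"

definition deriv_along ::
  "('a \<Rightarrow> 'a) \<Rightarrow> ('a::real_normed_vector \<Rightarrow> 'b::real_normed_vector) \<Rightarrow> 'a \<Rightarrow> 'b" where
  "deriv_along X f p = frechet_derivative f (at p) (X p)"

definition lie_bracket ::
  "('a \<Rightarrow> 'a) \<Rightarrow> ('a \<Rightarrow> 'a) \<Rightarrow> 'a::real_normed_vector \<Rightarrow> 'a" where
  "lie_bracket X Y p = deriv_along X Y p - deriv_along Y X p"


section \<open>Third order ODEs\<close>

text \<open>A point of the jet space is \<open>(t, x0, x1, x2)\<close>.\<close>

type_synonym jet = "real \<times> real \<times> real \<times> real"

definition e0 :: jet where "e0 = (0, 1, 0, 0)"
definition e1 :: jet where "e1 = (0, 0, 1, 0)"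
definition e2 :: jet where "e2 = (0, 0, 0, 1)"

definition d0 :: "(jet \<Rightarrow> real) \<Rightarrow> jet \<Rightarrow> real" where "d0 = deriv_along (\<lambda>_. e0)"
definition d1 :: "(jet \<Rightarrow> real) \<Rightarrow> jet \<Rightarrow> real" where "d1 = deriv_along (\<lambda>_. e1)"
definition d2 :: "(jet \<Rightarrow> real) \<Rightarrow> jet \<Rightarrow> real" where "d2 = deriv_along (\<lambda>_. e2)"

definition total_field :: "(jet \<Rightarrow> real) \<Rightarrow> jet \<Rightarrow> jet" where
  "total_field F = (\<lambda>(t, x0, x1, x2). (1, x1, x2, F (t, x0, x1, x2)))"

definition XF :: "(jet \<Rightarrow> real) \<Rightarrow> (jet \<Rightarrow> real) \<Rightarrow> jet \<Rightarrow> real" where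
  "XF F = deriv_along (total_field F)"

text \<open>The equation \<open>x''' = F(t, x, x', x'')\<close> over an open set of 2-jets; the values of \<open>F\<close> outside
  \<open>U\<close> are irrelevant.\<close>

definition third_order_ode :: "jet set \<Rightarrow> (jet \<Rightarrow> real) \<Rightarrow> bool" where
  "third_order_ode U F \<longleftrightarrow> open U \<and> smooth_on U F"

definition W0 :: "(jet \<Rightarrow> real) \<Rightarrow> jet \<Rightarrow> real" where
  "W0 F p = d0 F p - 1/2 * XF F (d1 F) p + 1/3 * d1 F p * d2 F p + 1/6 * XF F (XF F (d2 F)) p
     - 1/3 * XF F (d2 F) p * d2 F p + 2/27 * (d2 F p)^3"

definition Cartan :: "(jet \<Rightarrow> real) \<Rightarrow> jet \<Rightarrow> real" where
  "Cartan F p = XF F (XF F (d2 (d2 F))) p - XF F (d1 (d2 F)) p + d0 (d2 F) p"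

definition K0 :: "(jet \<Rightarrow> real) \<Rightarrow> jet \<Rightarrow> real" where
  "K0 F p = d0 F p - XF F (d1 F) p + 1/3 * d1 F p * d2 F p + 2/3 * XF F (XF F (d2 F)) p
     - 2/3 * XF F (d2 F) p * d2 F p + 2/27 * (d2 F p)^3"

definition K1 :: "(jet \<Rightarrow> real) \<Rightarrow> jet \<Rightarrow> real" where
  "K1 F p = d1 F p - XF F (d2 F) p + 1/3 * (d2 F p)^2"

text \<open>
  For a nowhere vanishing \<open>g\<close> with \<open>X\<^sub>F(g) = g/3 \<partial>\<^sub>2F\<close> the field \<open>g \<partial>\<^sub>2\<close> and its bracket
  \<open>[X\<^sub>F, g \<partial>\<^sub>2]\<close> are \<open>g\<close> times the two fields below, and \<open>K0\<close>, \<open>K1\<close> are the coefficients in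
  \<open>V''' = - K0 V + K1 V'\<close> for \<open>V = g \<partial>\<^sub>2\<close>. The common factor \<open>g\<close> is dropped: every expression
  in which the fields are used is homogeneous of degree one in it.
\<close>

definition Vfield :: "jet \<Rightarrow> jet" where
  "Vfield p = e2"

definition V'field :: "(jet \<Rightarrow> real) \<Rightarrow> jet \<Rightarrow> jet" where
  "V'field F p = - e1 - (2/3 * d2 F p) *\<^sub>R e2"


section \<open>Point equivalence\<close>

definition point_transformation ::
  "(real \<times> real) set \<Rightarrow> (real \<times> real \<Rightarrow> real) \<Rightarrow> (real \<times> real \<Rightarrow> real) \<Rightarrow> bool" where
  "point_transformation W \<tau> \<xi> \<longleftrightarrow>
     open W \<and> smooth_on W \<tau> \<and> smooth_on W \<xi> \<and>
     inj_on (\<lambda>z. (\<tau> z, \<xi> z)) W \<and>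
     (\<forall>z\<in>W. bij (frechet_derivative (\<lambda>z. (\<tau> z, \<xi> z)) (at z)))"

definition base_point :: "jet \<Rightarrow> real \<times> real" where
  "base_point = (\<lambda>(t, x0, x1, x2). (t, x0))"

text \<open>
  Prolongation: \<open>\<tau>\<close>, \<open>\<xi>\<close> become the new \<open>t\<close>, \<open>x0\<close>, and each further new coordinate is the total
  derivative of the preceding one divided by the total derivative of \<open>\<tau>\<close>. The functions that are
  differentiated do not depend on \<open>x2\<close>, so the total derivative is \<open>X\<^sub>F\<close> with \<open>F = 0\<close>.
\<close>

definition total_deriv :: "(jet \<Rightarrow> real) \<Rightarrow> jet \<Rightarrow> real" where
  "total_deriv = XF (\<lambda>_. 0)"

definition new_x1 :: "(real \<times> real \<Rightarrow> real) \<Rightarrow> (real \<times> real \<Rightarrow> real) \<Rightarrow> jet \<Rightarrow> real" where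
  "new_x1 \<tau> \<xi> p = total_deriv (\<xi> \<circ> base_point) p / total_deriv (\<tau> \<circ> base_point) p"

definition new_x2 :: "(real \<times> real \<Rightarrow> real) \<Rightarrow> (real \<times> real \<Rightarrow> real) \<Rightarrow> jet \<Rightarrow> real" where
  "new_x2 \<tau> \<xi> p = total_deriv (new_x1 \<tau> \<xi>) p / total_deriv (\<tau> \<circ> base_point) p"

definition prolong :: "(real \<times> real \<Rightarrow> real) \<Rightarrow> (real \<times> real \<Rightarrow> real) \<Rightarrow> jet \<Rightarrow> jet" where
  "prolong \<tau> \<xi> p = (\<tau> (base_point p), \<xi> (base_point p), new_x1 \<tau> \<xi> p, new_x2 \<tau> \<xi> p)"

text \<open>The last conjunct says that the transformed third derivative along solutions of the first
  equation is given by the second equation.\<close>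

definition point_equivalent ::
  "jet set \<Rightarrow> (jet \<Rightarrow> real) \<Rightarrow> jet set \<Rightarrow> (jet \<Rightarrow> real) \<Rightarrow> bool" where
  "point_equivalent U F U' F' \<longleftrightarrow>
     (\<exists>W \<tau> \<xi>. point_transformation W \<tau> \<xi> \<and> base_point ` U \<subseteq> W \<and>
        (\<forall>p\<in>U. total_deriv (\<tau> \<circ> base_point) p \<noteq> 0) \<and>
        U' = prolong \<tau> \<xi> ` U \<and>
        (\<forall>p\<in>U. F' (prolong \<tau> \<xi> p) = XF F (new_x2 \<tau> \<xi>) p / total_deriv (\<tau> \<circ> base_point) p))"

definition point_class :: "jet set \<Rightarrow> (jet \<Rightarrow> real) \<Rightarrow> (jet set \<times> (jet \<Rightarrow> real)) set" where
  "point_class U F = {(U', F'). third_order_ode U' F' \<and> point_equivalent U F U' F'}"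


section \<open>The solution space\<close>

definition same_integral_curve ::
  "jet set \<Rightarrow> (jet \<Rightarrow> real) \<Rightarrow> jet \<Rightarrow> jet \<Rightarrow> bool" where
  "same_integral_curve U F p q \<longleftrightarrow>
     (\<exists>(\<gamma> :: real \<Rightarrow> jet) a b. \<gamma> a = p \<and> \<gamma> b = q \<and>
        (\<forall>s\<in>closed_segment a b. \<gamma> s \<in> U \<and>
           (\<gamma> has_vector_derivative total_field F (\<gamma> s)) (at s within closed_segment a b)))"

text \<open>
  The quotient of \<open>U\<close> by the integral curves of \<open>X\<^sub>F\<close>, realised as the open set \<open>\<pi> ` U\<close> of
  \<open>\<real>\<^sup>3\<close>: a submersion whose fibres are exactly the integral curves in \<open>U\<close>.
\<close>

definition local_solution_space ::
  "jet set \<Rightarrow> (jet \<Rightarrow> real) \<Rightarrow> (jet \<Rightarrow> real^3) \<Rightarrow> bool" where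
  "local_solution_space U F \<pi> \<longleftrightarrow>
     third_order_ode U F \<and> smooth_on U \<pi> \<and>
     (\<forall>p\<in>U. surj (frechet_derivative \<pi> (at p)) \<and>
            frechet_derivative \<pi> (at p) (total_field F p) = 0) \<and>
     (\<forall>p\<in>U. \<forall>q\<in>U. \<pi> p = \<pi> q \<longleftrightarrow> same_integral_curve U F p q)"


section \<open>Conformal structures and Einstein-Weyl structures on open subsets of 3-space\<close>

text \<open>Tensors are evaluated on constant (coordinate) vector fields, which determine them.\<close>

type_synonym metric = "real^3 \<Rightarrow> real^3^3"
type_synonym connection = "real^3 \<Rightarrow> real^3 \<Rightarrow> real^3 \<Rightarrow> real^3"

definition met :: "metric \<Rightarrow> real^3 \<Rightarrow> real^3 \<Rightarrow> real^3 \<Rightarrow> real" where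
  "met h y u v = u \<bullet> (h y *v v)"

definition lorentz_form :: "real^3^3" where
  "lorentz_form = (\<chi> i j. if i = j then (if i = 3 then -1 else 1) else 0)"

definition lorentzian_metric :: "(real^3) set \<Rightarrow> metric \<Rightarrow> bool" where
  "lorentzian_metric M h \<longleftrightarrow> smooth_on M h \<and>
     (\<forall>y\<in>M. transpose (h y) = h y \<and>
        (\<exists>P. invertible P \<and> transpose P ** h y ** P = lorentz_form))"

definition conformal_class :: "(real^3) set \<Rightarrow> metric \<Rightarrow> metric set" where
  "conformal_class M h =
     {h'. \<exists>f. smooth_on M f \<and> (\<forall>y\<in>M. f y > (0::real) \<and> h' y = f y *\<^sub>R h y)}"

definition lorentzian_conformal_structure :: "(real^3) set \<Rightarrow> metric set \<Rightarrow> bool" where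
  "lorentzian_conformal_structure M c \<longleftrightarrow>
     (\<exists>h. lorentzian_metric M h \<and> c = conformal_class M h)"

definition one_form_on :: "(real^3) set \<Rightarrow> (real^3 \<Rightarrow> real^3 \<Rightarrow> real) \<Rightarrow> bool" where
  "one_form_on M \<phi> \<longleftrightarrow> (\<forall>y\<in>M. linear (\<phi> y)) \<and> (\<forall>v. smooth_on M (\<lambda>y. \<phi> y v))"

text \<open>A connection is given by its Christoffel symbols.\<close>

definition connection_on :: "(real^3) set \<Rightarrow> connection \<Rightarrow> bool" where
  "connection_on M \<Gamma> \<longleftrightarrow> (\<forall>y\<in>M. bilinear (\<Gamma> y)) \<and> (\<forall>u v. smooth_on M (\<lambda>y. \<Gamma> y u v))"

definition cov ::
  "connection \<Rightarrow> (real^3 \<Rightarrow> real^3) \<Rightarrow> (real^3 \<Rightarrow> real^3) \<Rightarrow> real^3 \<Rightarrow> real^3" where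
  "cov \<Gamma> X Y y = deriv_along X Y y + \<Gamma> y (X y) (Y y)"

definition torsion ::
  "connection \<Rightarrow> (real^3 \<Rightarrow> real^3) \<Rightarrow> (real^3 \<Rightarrow> real^3) \<Rightarrow> real^3 \<Rightarrow> real^3" where
  "torsion \<Gamma> X Y y = cov \<Gamma> X Y y - cov \<Gamma> Y X y - lie_bracket X Y y"

definition curvature ::
  "connection \<Rightarrow> (real^3 \<Rightarrow> real^3) \<Rightarrow> (real^3 \<Rightarrow> real^3) \<Rightarrow> (real^3 \<Rightarrow> real^3) \<Rightarrow> real^3 \<Rightarrow> real^3"
  where
  "curvature \<Gamma> X Y Z y =
     cov \<Gamma> X (cov \<Gamma> Y Z) y - cov \<Gamma> Y (cov \<Gamma> X Z) y - cov \<Gamma> (lie_bracket X Y) Z y"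

definition cov_metric ::
  "connection \<Rightarrow> metric \<Rightarrow> (real^3 \<Rightarrow> real^3) \<Rightarrow> (real^3 \<Rightarrow> real^3) \<Rightarrow> (real^3 \<Rightarrow> real^3) \<Rightarrow>
   real^3 \<Rightarrow> real" where
  "cov_metric \<Gamma> h X Y Z y =
     deriv_along X (\<lambda>z. met h z (Y z) (Z z)) y
     - met h y (cov \<Gamma> X Y y) (Z y) - met h y (Y y) (cov \<Gamma> X Z y)"

text \<open>The Ricci tensor is the trace of \<open>u \<mapsto> R(u, v) w\<close>.\<close>

definition ricci :: "connection \<Rightarrow> real^3 \<Rightarrow> real^3 \<Rightarrow> real^3 \<Rightarrow> real" where
  "ricci \<Gamma> y v w = (\<Sum>b\<in>Basis. curvature \<Gamma> (\<lambda>_. b) (\<lambda>_. v) (\<lambda>_. w) y \<bullet> b)"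

definition ricci_sym :: "connection \<Rightarrow> real^3 \<Rightarrow> real^3 \<Rightarrow> real^3 \<Rightarrow> real" where
  "ricci_sym \<Gamma> y v w = (ricci \<Gamma> y v w + ricci \<Gamma> y w v) / 2"

definition scalar_curvature :: "metric \<Rightarrow> connection \<Rightarrow> real^3 \<Rightarrow> real" where
  "scalar_curvature h \<Gamma> y =
     (\<Sum>i\<in>UNIV. \<Sum>j\<in>UNIV. matrix_inv (h y) $ i $ j * ricci \<Gamma> y (axis i 1) (axis j 1))"

definition weyl_connection :: "(real^3) set \<Rightarrow> metric set \<Rightarrow> connection \<Rightarrow> bool" where
  "weyl_connection M c \<Gamma> \<longleftrightarrow> connection_on M \<Gamma> \<and>
     (\<forall>y\<in>M. \<forall>u v. torsion \<Gamma> (\<lambda>_. u) (\<lambda>_. v) y = 0) \<and>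
     (\<forall>h\<in>c. \<exists>\<phi>. one_form_on M \<phi> \<and>
        (\<forall>y\<in>M. \<forall>u v w. cov_metric \<Gamma> h (\<lambda>_. u) (\<lambda>_. v) (\<lambda>_. w) y = \<phi> y u * met h y v w))"

definition einstein_weyl :: "(real^3) set \<Rightarrow> metric set \<Rightarrow> connection \<Rightarrow> bool" where
  "einstein_weyl M c \<Gamma> \<longleftrightarrow>
     lorentzian_conformal_structure M c \<and> weyl_connection M c \<Gamma> \<and>
     (\<forall>h\<in>c. \<forall>y\<in>M. \<forall>v w.
        ricci_sym \<Gamma> y v w = 1/3 * scalar_curvature h \<Gamma> y * met h y v w)"

text \<open>
  An immersed surface \<open>\<sigma>\<close> is totally geodesic if the covariant derivative along \<open>\<sigma>\<close> of every
  tangent field \<open>s \<mapsto> D\<sigma>(s)(b s)\<close>, in every tangent direction \<open>D\<sigma>(s) a\<close>, is tangent to \<open>\<sigma>\<close>.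
\<close>

definition totally_geodesic ::
  "connection \<Rightarrow> (real \<times> real) set \<Rightarrow> (real \<times> real \<Rightarrow> real^3) \<Rightarrow> bool" where
  "totally_geodesic \<Gamma> N \<sigma> \<longleftrightarrow>
     (\<forall>b :: real \<times> real \<Rightarrow> real \<times> real. smooth_on N b \<longrightarrow> (\<forall>s\<in>N. \<forall>a.
        let T = frechet_derivative \<sigma> (at s);
            Y = (\<lambda>s. frechet_derivative \<sigma> (at s) (b s))
        in frechet_derivative Y (at s) a + \<Gamma> (\<sigma> s) (T a) (Y s) \<in> range T))"

text \<open>Parametrised integral manifolds of \<open>span {\<partial>\<^sub>2, \<partial>\<^sub>1}\<close> in \<open>U\<close>.\<close>

definition integral_manifold_D2 ::
  "jet set \<Rightarrow> (real \<times> real) set \<Rightarrow> (real \<times> real \<Rightarrow> jet) \<Rightarrow> bool" where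
  "integral_manifold_D2 U N \<iota> \<longleftrightarrow> open N \<and> smooth_on N \<iota> \<and> \<iota> ` N \<subseteq> U \<and>
     (\<forall>s\<in>N. range (frechet_derivative \<iota> (at s)) = span {e2, e1})"

definition defines_einstein_weyl ::
  "jet set \<Rightarrow> (jet \<Rightarrow> real^3) \<Rightarrow> bool" where
  "defines_einstein_weyl U \<pi> \<longleftrightarrow>
     (\<exists>c \<Gamma>. einstein_weyl (\<pi> ` U) c \<Gamma> \<and>
        (\<forall>h\<in>c. \<forall>p\<in>U. met h (\<pi> p) (frechet_derivative \<pi> (at p) e2)
                                  (frechet_derivative \<pi> (at p) e2) = 0) \<and>
        (\<forall>N \<iota>. integral_manifold_D2 U N \<iota> \<longrightarrow> totally_geodesic \<Gamma> N (\<pi> \<circ> \<iota>)))"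

end

(*
Write w_i for the projection of \<partial>_i to the solution space. Brackets with X_F give a linear
system for the frame w_0, w_1, w_2 along the fibres:
  X_F w_2 = - w_1 - F_2 w_2,   X_F w_1 = - w_0 - F_1 w_2,   X_F w_0 = - F_0 w_2.
A symmetric form B on the solution space for which w_2 is null is then determined by
q = B(w_1, w_1): differentiating B(w_2, w_2) = 0 along X_F gives all its frame components and
finally q W_0 = 0. Applied to a conformal metric this gives the Wuenschmann condition. Given a Weyl
connection with one-form \<phi>, the surfaces tangent to \<partial>_1, \<partial>_2 are totally geodesic iff
\<phi>(w_2) q = \<partial>_2 q; differentiating this three times along X_F leaves the equation C = 0.
Conversely, if W_0 = C = 0, the metric and the one-form written down in the frame are constant
along the fibres and descend. For a Weyl connection with these totally geodesic null surfaces the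
curvature operator R(w_1, w_2) preserves their tangent planes, hence Ric(w_2, w_2) = 0, and the
statement on null forms, applied to the symmetrised Ricci tensor, gives the Einstein-Weyl equation.
Point invariance is not computed: a prolonged point transformation turns a solution space of the new
equation into one of the old equation, and preserves all the conditions above.
*)
theory Submission
  imports Defs
begin

section \<open>Smooth maps\<close>

text \<open>All computation takes place upstairs, on the jets. The w_i are vector fields along the
  projection, not on the solution space, since they change along a fibre. A tensor pulled back from
  the solution space contributes no derivative of its own along X_F, so X_F applied to B(w_i, w_j)
  sees nothing but the linear system for the frame. The obstacle to the converse is descent: the
  solution space is given only as the image of a submersion, without a global section. Closed
  formulas on the jets avoid solving differential equations along the fibres. The equation X_F q =
  -2/3 F_2 q is solved by a power of the determinant of the frame, because X_F vol = -F_2 vol, and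
  the values of the one-form on the frame are those that the necessary conditions prescribe for this
  q. Point invariance needs a notion that is stable under composition with a prolongation. It is a
  submersion that kills X_F and on whose fibres all functions with X_F f = 0 are constant.\<close>

abbreviation FD :: "('a::real_normed_vector \<Rightarrow> 'b::real_normed_vector) \<Rightarrow> 'a \<Rightarrow> 'a \<Rightarrow> 'b" where
  "FD f x \<equiv> frechet_derivative f (at x)"

lemma FD_I: "(f has_derivative f') (at x) \<Longrightarrow> FD f x = f'"
  using frechet_derivative_at by metis

lemma FD_cong:
  assumes "open S" "x \<in> S" "\<And>y. y \<in> S \<Longrightarrow> f y = g y"
  shows "FD f x = FD g x"
proof -
  have "\<And>f'. (f has_derivative f') (at x) \<longleftrightarrow> (g has_derivative f') (at x)"
    using assms has_derivative_transform_within_open[of _ _ x UNIV S] by (metis (full_types))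
  then show ?thesis unfolding frechet_derivative_def by simp
qed

lemma differentiable_cong_open:
  assumes "open S" "x \<in> S" "\<And>y. y \<in> S \<Longrightarrow> f y = g y" "f differentiable (at x)"
  shows "g differentiable (at x)"
  using assms has_derivative_transform_within_open unfolding differentiable_def by blast

lemma Ck_on_cong:
  assumes "open S" "\<And>x. x \<in> S \<Longrightarrow> f x = g x"
  shows "Ck_on k f S \<longleftrightarrow> Ck_on k g S"
  using assms(2)
proof (induction k arbitrary: f g)
  case 0
  then show ?case by (simp cong: continuous_on_cong)
next
  case (Suc k)
  have "Ck_on k (\<lambda>x. FD f x v) S \<longleftrightarrow> Ck_on k (\<lambda>x. FD g x v) S" for v
    by (rule Suc.IH) (simp add: FD_cong[OF assms(1) _ Suc.prems])
  moreover have "f differentiable (at x) \<longleftrightarrow> g differentiable (at x)" if "x \<in> S" for x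
    using differentiable_cong_open[OF assms(1) that] Suc.prems by metis
  ultimately show ?case by simp
qed

text \<open>\<open>frechet_derivative\<close> is a choice operator; this rule lets smoothness proofs
  use an explicit derivative formula instead. Openness of \<open>S\<close> allows the two to be
  exchanged at all orders.\<close>

lemma Ck_on_Suc_I:
  assumes "open S" "\<And>x. x \<in> S \<Longrightarrow> (f has_derivative f' x) (at x)"
    and "\<And>v. Ck_on k (\<lambda>x. f' x v) S"
  shows "Ck_on (Suc k) f S"
proof -
  have "Ck_on k (\<lambda>x. FD f x v) S" for v
    by (subst Ck_on_cong[where g = "\<lambda>x. f' x v"]) (use assms FD_I[OF assms(2)] in auto)
  then show ?thesis using assms by (auto simp: differentiable_def)
qed

lemma Ck_on_Suc_D: "Ck_on (Suc k) f S \<Longrightarrow> Ck_on k f S"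
proof (induction k arbitrary: f)
  case 0
  then show ?case
    by (auto intro!: continuous_at_imp_continuous_on differentiable_imp_continuous_within)
next
  case (Suc k)
  have "Ck_on k (\<lambda>x. FD f x v) S" for v
    using Suc.prems by (intro Suc.IH) simp
  then show ?case using Suc.prems by simp
qed

lemma Ck_on_const: "open S \<Longrightarrow> Ck_on k (\<lambda>x. c) S"
proof (induction k arbitrary: c)
  case (Suc k)
  then show ?case by (intro Ck_on_Suc_I[where f' = "\<lambda>_ _. 0"]) simp_all
qed simp

lemma Ck_on_bounded_linear:
  assumes "open S" "bounded_linear T" "Ck_on k f S"
  shows "Ck_on k (\<lambda>x. T (f x)) S"
  using assms(3)
proof (induction k arbitrary: f)
  case 0
  then show ?case
    using bounded_linear.continuous_on[OF assms(2)] by simp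
next
  case (Suc k)
  show ?case
  proof (rule Ck_on_Suc_I[OF assms(1), where f' = "\<lambda>x v. T (FD f x v)"])
    show "((\<lambda>x. T (f x)) has_derivative (\<lambda>v. T (FD f x v))) (at x)" if "x \<in> S" for x
      using Suc.prems that
      by (intro bounded_linear.has_derivative[OF assms(2)]) (simp add: frechet_derivative_works)
    show "Ck_on k (\<lambda>x. T (FD f x v)) S" for v
      using Suc by simp
  qed
qed

lemma Ck_on_add:
  assumes "open S" "Ck_on k f S" "Ck_on k g S"
  shows "Ck_on k (\<lambda>x. f x + g x) S"
  using assms(2,3)
proof (induction k arbitrary: f g)
  case 0
  then show ?case by (simp add: continuous_on_add)
next
  case (Suc k)
  show ?case
  proof (rule Ck_on_Suc_I[OF assms(1), where f' = "\<lambda>x v. FD f x v + FD g x v"])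
    show "((\<lambda>x. f x + g x) has_derivative (\<lambda>v. FD f x v + FD g x v)) (at x)" if "x \<in> S" for x
      using Suc.prems that by (intro has_derivative_add) (simp_all add: frechet_derivative_works)
    show "Ck_on k (\<lambda>x. FD f x v + FD g x v) S" for v
      using Suc by simp
  qed
qed

text \<open>The Leibniz rule pairs one factor with the derivative of the other, so the induction
  also needs the undifferentiated factor at the lower order; \<open>Ck_on_Suc_D\<close> provides
  it.\<close>

lemma Ck_on_bilinear:
  assumes "open S" "bounded_bilinear bop" "Ck_on k f S" "Ck_on k g S"
  shows "Ck_on k (\<lambda>x. bop (f x) (g x)) S"
  using assms(3,4)
proof (induction k arbitrary: f g)
  case 0
  then show ?case
    using bounded_bilinear.continuous_on[OF assms(2)] by simp
next
  case (Suc k)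
  show ?case
  proof (rule Ck_on_Suc_I[OF assms(1), where f' = "\<lambda>x v. bop (f x) (FD g x v) + bop (FD f x v) (g x)"])
    show "((\<lambda>x. bop (f x) (g x)) has_derivative
        (\<lambda>v. bop (f x) (FD g x v) + bop (FD f x v) (g x))) (at x)" if "x \<in> S" for x
      using Suc.prems that
      by (intro bounded_bilinear.FDERIV[OF assms(2)]) (simp_all add: frechet_derivative_works)
    show "Ck_on k (\<lambda>x. bop (f x) (FD g x v) + bop (FD f x v) (g x)) S" for v
      using Suc.prems Ck_on_Suc_D[OF Suc.prems(1)] Ck_on_Suc_D[OF Suc.prems(2)]
      by (intro Ck_on_add[OF assms(1)] Suc.IH) simp_all
  qed
qed

lemma Ck_on_sum:
  assumes "open S" "\<And>i. i \<in> I \<Longrightarrow> Ck_on k (f i) S"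
  shows "Ck_on k (\<lambda>x. \<Sum>i\<in>I. f i x) S"
  using assms(2)
  by (induction I rule: infinite_finite_induct)
     (simp_all add: Ck_on_const[OF assms(1)] Ck_on_add[OF assms(1)])

lemma linear_basis_expansion:
  fixes T :: "'a::euclidean_space \<Rightarrow> 'b::real_vector"
  assumes "linear T"
  shows "T v = (\<Sum>b\<in>Basis. (v \<bullet> b) *\<^sub>R T b)"
proof -
  have "T v = T (\<Sum>b\<in>Basis. (v \<bullet> b) *\<^sub>R b)" by (simp add: euclidean_representation)
  also have "\<dots> = (\<Sum>b\<in>Basis. (v \<bullet> b) *\<^sub>R T b)"
    using assms by (simp add: linear_sum linear_cmul)
  finally show ?thesis .
qed

text \<open>The chain rule differentiates \<open>g\<close> in the moving direction
  \<open>FD f x v\<close>, whereas \<open>Ck_on\<close> speaks about fixed directions. Expanding the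
  direction in a basis turns the derivative into a sum of products, which is why the intermediate
  space is Euclidean.\<close>

lemma Ck_on_compose:
  fixes f :: "'a::real_normed_vector \<Rightarrow> 'b::euclidean_space"
    and g :: "'b \<Rightarrow> 'c::real_normed_vector"
  assumes "open S" "open T" "f ` S \<subseteq> T" "Ck_on k f S" "Ck_on k g T"
  shows "Ck_on k (\<lambda>x. g (f x)) S"
  using assms(4,5)
proof (induction k arbitrary: g)
  case 0
  then show ?case using continuous_on_compose2[OF _ _ assms(3)] by simp
next
  case (Suc k)
  have dg: "g differentiable (at (f x))" if "x \<in> S" for x
    using Suc.prems(2) subsetD[OF assms(3) imageI[OF that]] by simp
  then have g: "linear (FD g (f x))" if "x \<in> S" for x
    using that linear_frechet_derivative by blast
  show ?case
  proof (rule Ck_on_Suc_I[OF assms(1), where f' = "\<lambda>x v. FD g (f x) (FD f x v)"])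
    show "((\<lambda>x. g (f x)) has_derivative (\<lambda>v. FD g (f x) (FD f x v))) (at x)" if "x \<in> S" for x
      using Suc.prems(1) that dg[OF that]
      by (intro has_derivative_compose[of f "FD f x" x UNIV g "FD g (f x)"])
         (simp_all add: frechet_derivative_works)
    show "Ck_on k (\<lambda>x. FD g (f x) (FD f x v)) S" for v
    proof (subst Ck_on_cong[OF assms(1)])
      show "FD g (f x) (FD f x v) = (\<Sum>b\<in>Basis. (FD f x v \<bullet> b) *\<^sub>R FD g (f x) b)"
        if "x \<in> S" for x
        using linear_basis_expansion[OF g[OF that]] .
      have 1: "Ck_on k (\<lambda>x. FD f x v \<bullet> b) S" for b
        using Suc.prems by (intro Ck_on_bounded_linear[OF assms(1) bounded_linear_inner_left]) simp
      have 2: "Ck_on k (\<lambda>x. FD g (f x) b) S" for b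
        using Suc.prems Ck_on_Suc_D[OF Suc.prems(1)] by (intro Suc.IH) simp_all
      show "Ck_on k (\<lambda>x. \<Sum>b\<in>Basis. (FD f x v \<bullet> b) *\<^sub>R FD g (f x) b) S"
        by (intro Ck_on_sum[OF assms(1)] Ck_on_bilinear[OF assms(1) bounded_bilinear_scaleR] 1 2)
    qed
  qed
qed

lemma Ck_on_subset: "Ck_on k f S \<Longrightarrow> T \<subseteq> S \<Longrightarrow> Ck_on k f T"
  by (induction k arbitrary: f) (auto intro: continuous_on_subset)

lemma smooth_on_cong:
  "open S \<Longrightarrow> (\<And>x. x \<in> S \<Longrightarrow> f x = g x) \<Longrightarrow> smooth_on S f \<longleftrightarrow> smooth_on S g"
  unfolding smooth_on_def using Ck_on_cong by blast

lemma smooth_on_differentiable: "smooth_on S f \<Longrightarrow> x \<in> S \<Longrightarrow> f differentiable (at x)"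
  unfolding smooth_on_def by (metis Ck_on.simps(2))

lemma smooth_on_has_derivative: "smooth_on S f \<Longrightarrow> x \<in> S \<Longrightarrow> (f has_derivative FD f x) (at x)"
  using smooth_on_differentiable frechet_derivative_works by blast

lemma smooth_on_linear_FD: "smooth_on S f \<Longrightarrow> x \<in> S \<Longrightarrow> linear (FD f x)"
  using smooth_on_differentiable linear_frechet_derivative by blast

lemma smooth_on_continuous_on: "smooth_on S f \<Longrightarrow> continuous_on S f"
  unfolding smooth_on_def by (metis Ck_on.simps(1))

lemma smooth_on_FD_const: "smooth_on S f \<Longrightarrow> smooth_on S (\<lambda>x. FD f x v)"
  unfolding smooth_on_def by (metis Ck_on.simps(2))

lemma smooth_on_const: "open S \<Longrightarrow> smooth_on S (\<lambda>x. c)"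
  unfolding smooth_on_def by (blast intro: Ck_on_const)

lemma smooth_on_ident: "open S \<Longrightarrow> smooth_on S (\<lambda>x. x)"
proof -
  assume S: "open S"
  have "Ck_on k (\<lambda>x. x) S" for k
    by (cases k) (auto simp del: Ck_on.simps(2) intro!: Ck_on_Suc_I[OF S] has_derivative_ident Ck_on_const[OF S] simp: continuous_on_id)
  then show ?thesis by (simp add: smooth_on_def)
qed

lemma smooth_on_bounded_linear:
  "open S \<Longrightarrow> bounded_linear T \<Longrightarrow> smooth_on S f \<Longrightarrow> smooth_on S (\<lambda>x. T (f x))"
  unfolding smooth_on_def by (blast intro: Ck_on_bounded_linear)

lemma smooth_on_bilinear:
  "open S \<Longrightarrow> bounded_bilinear bop \<Longrightarrow> smooth_on S f \<Longrightarrow> smooth_on S g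
    \<Longrightarrow> smooth_on S (\<lambda>x. bop (f x) (g x))"
  unfolding smooth_on_def by (blast intro: Ck_on_bilinear)

lemma smooth_on_add:
  "open S \<Longrightarrow> smooth_on S f \<Longrightarrow> smooth_on S g \<Longrightarrow> smooth_on S (\<lambda>x. f x + g x)"
  unfolding smooth_on_def by (blast intro: Ck_on_add)

lemma smooth_on_sum:
  "open S \<Longrightarrow> (\<And>i. i \<in> I \<Longrightarrow> smooth_on S (f i)) \<Longrightarrow> smooth_on S (\<lambda>x. \<Sum>i\<in>I. f i x)"
  unfolding smooth_on_def by (blast intro: Ck_on_sum)

lemma smooth_on_compose:
  fixes f :: "'a::real_normed_vector \<Rightarrow> 'b::euclidean_space"
  shows "open S \<Longrightarrow> open T \<Longrightarrow> f ` S \<subseteq> T \<Longrightarrow> smooth_on S f \<Longrightarrow> smooth_on T g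
    \<Longrightarrow> smooth_on S (\<lambda>x. g (f x))"
  unfolding smooth_on_def by (blast intro: Ck_on_compose)

lemma smooth_on_minus: "open S \<Longrightarrow> smooth_on S f \<Longrightarrow> smooth_on S (\<lambda>x. - f x)"
  by (rule smooth_on_bounded_linear[OF _ bounded_linear_minus[OF bounded_linear_ident]])

lemma smooth_on_diff:
  "open S \<Longrightarrow> smooth_on S f \<Longrightarrow> smooth_on S g \<Longrightarrow> smooth_on S (\<lambda>x. f x - g x)"
  using smooth_on_add[of S f "\<lambda>x. - g x"] smooth_on_minus[of S g] by simp

lemma smooth_on_mult:
  fixes f g :: "_ \<Rightarrow> 'b::real_normed_algebra"
  shows "open S \<Longrightarrow> smooth_on S f \<Longrightarrow> smooth_on S g \<Longrightarrow> smooth_on S (\<lambda>x. f x * g x)"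
  by (rule smooth_on_bilinear[OF _ bounded_bilinear_mult])

lemma smooth_on_scaleR:
  "open S \<Longrightarrow> smooth_on S f \<Longrightarrow> smooth_on S g \<Longrightarrow> smooth_on S (\<lambda>x. f x *\<^sub>R g x)"
  by (rule smooth_on_bilinear[OF _ bounded_bilinear_scaleR])

lemma smooth_on_inner:
  "open S \<Longrightarrow> smooth_on S f \<Longrightarrow> smooth_on S g \<Longrightarrow> smooth_on S (\<lambda>x. f x \<bullet> g x)"
  by (rule smooth_on_bilinear[OF _ bounded_bilinear_inner])

lemma smooth_on_power:
  fixes f :: "_ \<Rightarrow> real"
  shows "open S \<Longrightarrow> smooth_on S f \<Longrightarrow> smooth_on S (\<lambda>x. f x ^ n)"
  by (induction n) (simp_all add: smooth_on_const smooth_on_mult)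

lemma smooth_on_Pair:
  assumes "open S" "smooth_on S f" "smooth_on S g"
  shows "smooth_on S (\<lambda>x. (f x, g x))"
proof -
  have 1: "bounded_linear (\<lambda>a. (a, 0))" "bounded_linear (\<lambda>b. (0, b))"
    by (intro bounded_linear_intros)+
  have "smooth_on S (\<lambda>x. (f x, 0) + (0, g x))"
    by (intro smooth_on_add assms smooth_on_bounded_linear[OF assms(1) 1(1)]
        smooth_on_bounded_linear[OF assms(1) 1(2)])
  then show ?thesis by simp
qed

lemma smooth_on_fst: "open S \<Longrightarrow> smooth_on S f \<Longrightarrow> smooth_on S (\<lambda>x. fst (f x))"
  by (rule smooth_on_bounded_linear[OF _ bounded_linear_fst])

lemma smooth_on_snd: "open S \<Longrightarrow> smooth_on S f \<Longrightarrow> smooth_on S (\<lambda>x. snd (f x))"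
  by (rule smooth_on_bounded_linear[OF _ bounded_linear_snd])

lemma smooth_on_vec_nth: "open S \<Longrightarrow> smooth_on S f \<Longrightarrow> smooth_on S (\<lambda>x. f x $ i)"
  by (rule smooth_on_bounded_linear[OF _ bounded_linear_vec_nth])

lemma smooth_on_vec_lambda:
  fixes f :: "'i::finite \<Rightarrow> 'a::real_normed_vector \<Rightarrow> 'b::real_normed_vector"
  assumes "open S" "\<And>i. smooth_on S (f i)"
  shows "smooth_on S (\<lambda>x. \<chi> i. f i x)"
proof -
  have bl: "bounded_linear (axis i :: 'b \<Rightarrow> 'b ^ 'i)" for i
  proof (rule bounded_linear_intro[where K = 1])
    have "(\<Sum>j\<in>UNIV. (norm (axis i x $ j))\<^sup>2) = (\<Sum>j\<in>UNIV. if j = i then (norm x)\<^sup>2 else 0)" for x :: 'b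
      by (intro sum.cong) (auto simp: axis_def)
    then show "norm (axis i x :: 'b ^ 'i) \<le> norm x * 1" for x
      by (simp add: norm_vec_def L2_set_def)
  qed (auto simp: axis_def vec_eq_iff)
  have "(\<chi> i. f i x) = (\<Sum>i\<in>UNIV. axis i (f i x))" for x
    by (simp add: vec_eq_iff axis_def sum.delta')
  then show ?thesis
    using smooth_on_sum[OF assms(1), of UNIV "\<lambda>i x. axis i (f i x)"]
      smooth_on_bounded_linear[OF assms(1) bl assms(2)] by simp
qed

lemma smooth_on_FD:
  fixes f :: "'a::euclidean_space \<Rightarrow> 'b::real_normed_vector"
  assumes "open S" "smooth_on S f" "smooth_on S w"
  shows "smooth_on S (\<lambda>x. FD f x (w x))"
proof (subst smooth_on_cong[OF assms(1)])
  show "FD f x (w x) = (\<Sum>b\<in>Basis. (w x \<bullet> b) *\<^sub>R FD f x b)" if "x \<in> S" for x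
    using linear_basis_expansion[OF smooth_on_linear_FD[OF assms(2) that]] .
  show "smooth_on S (\<lambda>x. \<Sum>b\<in>Basis. (w x \<bullet> b) *\<^sub>R FD f x b)"
    by (intro smooth_on_sum smooth_on_scaleR smooth_on_inner smooth_on_const smooth_on_FD_const assms)
qed

text \<open>The derivative of \<open>inverse\<close> is a polynomial in \<open>inverse\<close>
  itself, so the induction closes without any new function.\<close>

lemma Ck_on_inverse: "Ck_on k inverse (- {0::real})"
proof (induction k)
  case 0
  then show ?case by (auto intro!: continuous_intros)
next
  case (Suc k)
  have S: "open (- {0::real})" by (simp add: open_Compl)
  show ?case
  proof (rule Ck_on_Suc_I[OF S])
    show "(inverse has_derivative (\<lambda>h. - (inverse x * h * inverse x))) (at x)" if "x \<in> - {0::real}" for x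
      using that by (simp add: has_derivative_inverse')
    show "Ck_on k (\<lambda>x. - (inverse x * v * inverse x)) (- {0::real})" for v
    proof -
      have "bounded_linear (\<lambda>y::real. - (y * v))"
        by (intro bounded_linear_minus bounded_linear_mult_left)
      from Ck_on_bounded_linear[OF S this Ck_on_bilinear[OF S bounded_bilinear_mult Suc Suc]]
      show ?thesis by (simp add: mult_ac)
    qed
  qed
qed

lemma smooth_on_inverse:
  fixes f :: "'a::real_normed_vector \<Rightarrow> real"
  assumes "open S" "smooth_on S f" "\<And>x. x \<in> S \<Longrightarrow> f x \<noteq> 0"
  shows "smooth_on S (\<lambda>x. inverse (f x))"
  by (rule smooth_on_compose[where T = "- {0}"])
     (use assms Ck_on_inverse in \<open>auto simp: smooth_on_def open_Compl\<close>)

lemma smooth_on_divide: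
  fixes f g :: "'a::real_normed_vector \<Rightarrow> real"
  shows "open S \<Longrightarrow> smooth_on S f \<Longrightarrow> smooth_on S g \<Longrightarrow> (\<And>x. x \<in> S \<Longrightarrow> g x \<noteq> 0)
    \<Longrightarrow> smooth_on S (\<lambda>x. f x / g x)"
  unfolding divide_inverse by (intro smooth_on_mult smooth_on_inverse)

lemma smooth_on_exp:
  fixes f :: "'a::real_normed_vector \<Rightarrow> real"
  assumes "open S" "smooth_on S f"
  shows "smooth_on S (\<lambda>x. exp (f x))"
proof -
  have "Ck_on k exp (UNIV::real set)" for k
  proof (induction k)
    case (Suc k)
    show ?case
    proof (rule Ck_on_Suc_I)
      show "(exp has_derivative (\<lambda>h. h * exp x)) (at x)" for x :: real
        using DERIV_exp[of x] by (simp add: has_field_derivative_def mult_commute_abs)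
      show "Ck_on k (\<lambda>x. v * exp x) (UNIV::real set)" for v
        by (rule Ck_on_bounded_linear[OF open_UNIV bounded_linear_mult_right Suc])
    qed simp
  qed (auto intro!: continuous_intros)
  then have "smooth_on UNIV (exp :: real \<Rightarrow> real)" by (simp add: smooth_on_def)
  from smooth_on_compose[OF assms(1) open_UNIV _ assms(2) this] show ?thesis by simp
qed

lemma smooth_on_ln:
  fixes f :: "'a::real_normed_vector \<Rightarrow> real"
  assumes "open S" "smooth_on S f" "\<And>x. x \<in> S \<Longrightarrow> f x > 0"
  shows "smooth_on S (\<lambda>x. ln (f x))"
proof -
  have "Ck_on k ln {0::real<..}" for k
  proof (cases k)
    case (Suc k)
    show ?thesis unfolding Suc
    proof (rule Ck_on_Suc_I)
      show "(ln has_derivative (\<lambda>h. h * inverse x)) (at x)" if "x \<in> {0<..}" for x :: real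
        using DERIV_ln[of x] that by (simp add: has_field_derivative_def mult_commute_abs)
      show "Ck_on k (\<lambda>x. v * inverse x) {0::real<..}" for v
        by (rule Ck_on_bounded_linear[OF _ bounded_linear_mult_right Ck_on_subset[OF Ck_on_inverse]])
           auto
    qed simp
  qed (auto intro!: continuous_intros)
  then have "smooth_on {0<..} (ln :: real \<Rightarrow> real)" by (simp add: smooth_on_def)
  from smooth_on_compose[OF assms(1) open_greaterThan _ assms(2) this] show ?thesis
    using assms(3) by auto
qed

lemmas smooth_on_intros =
  smooth_on_const smooth_on_ident smooth_on_add smooth_on_diff smooth_on_minus smooth_on_mult
  smooth_on_scaleR smooth_on_inner smooth_on_power smooth_on_Pair smooth_on_fst smooth_on_snd
  smooth_on_FD smooth_on_sum smooth_on_exp smooth_on_vec_nth smooth_on_vec_lambda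

section \<open>Differentiation rules and symmetry of second derivatives\<close>

lemma differentiable_FD: "f differentiable (at x) \<Longrightarrow> (f has_derivative FD f x) (at x)"
  using frechet_derivative_works by blast

lemma has_real_derivative_line:
  fixes f :: "'a::real_normed_vector \<Rightarrow> real"
  assumes "f differentiable (at (y + a *\<^sub>R u))"
  shows "((\<lambda>a. f (y + a *\<^sub>R u)) has_real_derivative FD f (y + a *\<^sub>R u) u) (at a)"
proof -
  have "((\<lambda>a. y + a *\<^sub>R u) has_derivative (\<lambda>h. h *\<^sub>R u)) (at a)"
    by (auto intro!: derivative_eq_intros)
  from has_derivative_compose[OF this differentiable_FD[OF assms]]
  show ?thesis
    using linear_cmul[OF linear_frechet_derivative[OF assms]]
    by (simp add: has_field_derivative_def mult_commute_abs)
qed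

text \<open>Two applications of the mean value theorem to the second difference of \<open>f\<close>.\<close>

lemma second_difference_mean_value:
  fixes f :: "'a::real_normed_vector \<Rightarrow> real"
  assumes S: "open S" "smooth_on S f" and r: "ball x r \<subseteq> S"
    and s: "s > 0" "s * (norm u + norm v) < r"
  shows "\<exists>y. dist x y \<le> s * (norm u + norm v) \<and>
     f (x + s *\<^sub>R u + s *\<^sub>R v) - f (x + s *\<^sub>R u) - f (x + s *\<^sub>R v) + f x
       = s\<^sup>2 * FD (\<lambda>z. FD f z u) y v"
proof -
  have dist: "dist x (x + a *\<^sub>R u + b *\<^sub>R v) \<le> s * (norm u + norm v)"
    if "0 \<le> a" "a \<le> s" "0 \<le> b" "b \<le> s" for a b
  proof -
    have "dist x (x + a *\<^sub>R u + b *\<^sub>R v) = norm (a *\<^sub>R u + b *\<^sub>R v)"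
      by (simp add: dist_norm norm_minus_commute algebra_simps)
    also have "\<dots> \<le> a * norm u + b * norm v"
      using norm_triangle_ineq[of "a *\<^sub>R u" "b *\<^sub>R v"] that by simp
    also have "\<dots> \<le> s * norm u + s * norm v"
      using that by (intro add_mono mult_right_mono) auto
    finally show ?thesis by (simp add: algebra_simps)
  qed
  then have inS: "x + a *\<^sub>R u + b *\<^sub>R v \<in> S" if "0 \<le> a" "a \<le> s" "0 \<le> b" "b \<le> s" for a b
    using that r s(2) by (smt (verit, best) mem_ball subsetD)
  have diff: "f differentiable (at y)" "(\<lambda>z. FD f z u) differentiable (at y)" if "y \<in> S" for y
    using smooth_on_differentiable[OF S(2) that]
      smooth_on_differentiable[OF smooth_on_FD_const[OF S(2)] that] by auto
  have "\<exists>a>0. a < s \<and> (f ((x + s *\<^sub>R v) + s *\<^sub>R u) - f (x + s *\<^sub>R u))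
        - (f ((x + s *\<^sub>R v) + 0 *\<^sub>R u) - f (x + 0 *\<^sub>R u))
      = (s - 0) * (FD f ((x + s *\<^sub>R v) + a *\<^sub>R u) u - FD f (x + a *\<^sub>R u) u)"
  proof (rule MVT2[OF s(1)])
    fix a assume a: "0 \<le> a" "a \<le> s"
    have "(x + s *\<^sub>R v) + a *\<^sub>R u \<in> S" "x + a *\<^sub>R u \<in> S"
      using inS[OF a, of s] inS[OF a, of 0] s(1) by (simp_all add: add_ac)
    then show "((\<lambda>a. f ((x + s *\<^sub>R v) + a *\<^sub>R u) - f (x + a *\<^sub>R u)) has_real_derivative
        (FD f ((x + s *\<^sub>R v) + a *\<^sub>R u) u - FD f (x + a *\<^sub>R u) u)) (at a)"
      by (intro DERIV_diff has_real_derivative_line diff)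
  qed
  then obtain a where a: "0 < a" "a < s" and eq1:
    "f (x + s *\<^sub>R u + s *\<^sub>R v) - f (x + s *\<^sub>R u) - f (x + s *\<^sub>R v) + f x
      = s * (FD f (x + a *\<^sub>R u + s *\<^sub>R v) u - FD f (x + a *\<^sub>R u) u)"
    by (auto simp: add_ac)
  have "\<exists>b>0. b < s \<and> FD f ((x + a *\<^sub>R u) + s *\<^sub>R v) u - FD f ((x + a *\<^sub>R u) + 0 *\<^sub>R v) u
      = (s - 0) * FD (\<lambda>z. FD f z u) ((x + a *\<^sub>R u) + b *\<^sub>R v) v"
  proof (rule MVT2[OF s(1)])
    fix b assume "0 \<le> b" "b \<le> s"
    then show "((\<lambda>b. FD f ((x + a *\<^sub>R u) + b *\<^sub>R v) u) has_real_derivative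
        FD (\<lambda>z. FD f z u) ((x + a *\<^sub>R u) + b *\<^sub>R v) v) (at b)"
      using a by (intro has_real_derivative_line diff inS) auto
  qed
  then obtain b where b: "0 < b" "b < s" and eq2:
    "FD f (x + a *\<^sub>R u + s *\<^sub>R v) u - FD f (x + a *\<^sub>R u) u
      = s * FD (\<lambda>z. FD f z u) (x + a *\<^sub>R u + b *\<^sub>R v) v"
    by auto
  show ?thesis
    using dist[of a b] a b eq1 eq2 by (intro exI[of _ "x + a *\<^sub>R u + b *\<^sub>R v"]) (simp add: power2_eq_square)
qed

text \<open>The second difference of \<open>f\<close> is symmetric in the two directions. By the
  mean value theorem it is s^2 times either mixed derivative at some point near \<open>x\<close>, so
  by continuity the two cannot differ at \<open>x\<close>.\<close>

lemma FD_FD_commute_real: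
  fixes f :: "'a::real_normed_vector \<Rightarrow> real"
  assumes S: "open S" "smooth_on S f" and x: "x \<in> S"
  shows "FD (\<lambda>y. FD f y u) x v = FD (\<lambda>y. FD f y v) x u"
proof (rule ccontr)
  let ?g = "FD (\<lambda>y. FD f y u)" and ?h = "FD (\<lambda>y. FD f y v)"
  assume neq: "?g x v \<noteq> ?h x u"
  define e where "e = dist (?g x v) (?h x u) / 2"
  have e: "e > 0" using neq by (simp add: e_def)
  obtain r where r: "r > 0" "ball x r \<subseteq> S" using S(1) x openE by blast
  have "continuous_on S (\<lambda>y. ?g y v)" "continuous_on S (\<lambda>y. ?h y u)"
    using S(2) by (auto intro!: smooth_on_continuous_on smooth_on_FD_const)
  then obtain d1 d2 where d: "d1 > 0" "d2 > 0"
    "\<And>y. y \<in> S \<Longrightarrow> dist y x < d1 \<Longrightarrow> dist (?g y v) (?g x v) < e"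
    "\<And>y. y \<in> S \<Longrightarrow> dist y x < d2 \<Longrightarrow> dist (?h y u) (?h x u) < e"
    using e x unfolding continuous_on_iff by metis
  \<comment> \<open>The summand 1 keeps the divisor positive when both directions vanish.\<close>
  define k where "k = norm u + norm v + 1"
  have k: "k > 0" "norm u + norm v < k" by (auto simp: k_def add_nonneg_pos)
  define s where "s = Min {d1, d2, r} / k"
  have s: "s > 0" using d r k by (simp add: s_def)
  have less: "s * (norm u + norm v) < Min {d1, d2, r}"
  proof -
    have "s * (norm u + norm v) < s * k" using s k by simp
    also have "\<dots> = Min {d1, d2, r}" using k by (simp add: s_def)
    finally show ?thesis .
  qed
  then have lr: "s * (norm u + norm v) < r" "s * (norm v + norm u) < r"
    and l1: "s * (norm u + norm v) < d1" and l2: "s * (norm v + norm u) < d2"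
    by (auto simp: add.commute)
  obtain y1 where y1: "dist x y1 \<le> s * (norm u + norm v)"
    "f (x + s *\<^sub>R u + s *\<^sub>R v) - f (x + s *\<^sub>R u) - f (x + s *\<^sub>R v) + f x = s\<^sup>2 * ?g y1 v"
    using second_difference_mean_value[OF S r(2) s lr(1)] by auto
  obtain y2 where y2: "dist x y2 \<le> s * (norm v + norm u)"
    "f (x + s *\<^sub>R v + s *\<^sub>R u) - f (x + s *\<^sub>R v) - f (x + s *\<^sub>R u) + f x = s\<^sup>2 * ?h y2 u"
    using second_difference_mean_value[OF S r(2) s lr(2)] by auto
  have "s\<^sup>2 * ?g y1 v = s\<^sup>2 * ?h y2 u"
    unfolding y1(2)[symmetric] y2(2)[symmetric] by (simp add: add_ac)
  then have eq: "?g y1 v = ?h y2 u" using s by simp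
  have "y1 \<in> S" "y2 \<in> S" using y1(1) y2(1) lr r(2) by (auto simp: subset_iff)
  then have "dist (?g y1 v) (?g x v) < e" "dist (?h y2 u) (?h x u) < e"
    using d(3)[of y1] d(4)[of y2] y1(1) y2(1) l1 l2 by (auto simp: dist_commute)
  then have "dist (?g x v) (?h x u) < 2 * e"
    unfolding eq using dist_triangle[of "?g x v" "?h x u" "?h y2 u"] by (simp add: dist_commute)
  then show False by (simp add: e_def)
qed

lemma FD_bounded_linear:
  assumes "bounded_linear T" "f differentiable (at x)"
  shows "FD (\<lambda>x. T (f x)) x v = T (FD f x v)"
  by (simp add: FD_I[OF bounded_linear.has_derivative[OF assms(1) differentiable_FD[OF assms(2)]]])

lemma FD_FD_commute:
  fixes f :: "'a::real_normed_vector \<Rightarrow> 'b::euclidean_space"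
  assumes S: "open S" "smooth_on S f" and x: "x \<in> S"
  shows "FD (\<lambda>y. FD f y u) x v = FD (\<lambda>y. FD f y v) x u"
proof (rule euclidean_eqI)
  fix b :: 'b
  have *: "FD (\<lambda>y. FD f y u) x v \<bullet> b = FD (\<lambda>y. FD (\<lambda>y. f y \<bullet> b) y u) x v" for u v
  proof -
    have "FD (\<lambda>y. FD (\<lambda>y. f y \<bullet> b) y u) x = FD (\<lambda>y. FD f y u \<bullet> b) x"
      using FD_bounded_linear[OF bounded_linear_inner_left smooth_on_differentiable[OF S(2)]]
      by (intro FD_cong[OF S(1) x]) auto
    then show ?thesis
      using FD_bounded_linear[OF bounded_linear_inner_left
          smooth_on_differentiable[OF smooth_on_FD_const[OF S(2)] x]] by metis
  qed
  show "FD (\<lambda>y. FD f y u) x v \<bullet> b = FD (\<lambda>y. FD f y v) x u \<bullet> b"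
    unfolding * by (rule FD_FD_commute_real[OF S(1) _ x])
      (intro smooth_on_intros S)
qed

lemma FD_add:
  "f differentiable (at x) \<Longrightarrow> g differentiable (at x) \<Longrightarrow>
    FD (\<lambda>x. f x + g x) x v = FD f x v + FD g x v"
  by (simp add: FD_I[OF has_derivative_add[OF differentiable_FD differentiable_FD]])

lemma FD_diff:
  "f differentiable (at x) \<Longrightarrow> g differentiable (at x) \<Longrightarrow>
    FD (\<lambda>x. f x - g x) x v = FD f x v - FD g x v"
  by (simp add: FD_I[OF has_derivative_diff[OF differentiable_FD differentiable_FD]])

lemma FD_bilinear:
  "bounded_bilinear bop \<Longrightarrow> f differentiable (at x) \<Longrightarrow> g differentiable (at x) \<Longrightarrow>
    FD (\<lambda>x. bop (f x) (g x)) x v = bop (f x) (FD g x v) + bop (FD f x v) (g x)"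
  by (simp add: FD_I[OF bounded_bilinear.FDERIV[OF _ differentiable_FD differentiable_FD]])

lemma FD_mult:
  fixes f g :: "_ \<Rightarrow> 'b::real_normed_algebra"
  shows "f differentiable (at x) \<Longrightarrow> g differentiable (at x) \<Longrightarrow>
    FD (\<lambda>x. f x * g x) x v = f x * FD g x v + FD f x v * g x"
  by (rule FD_bilinear[OF bounded_bilinear_mult])

lemma FD_scaleR:
  "f differentiable (at x) \<Longrightarrow> g differentiable (at x) \<Longrightarrow>
    FD (\<lambda>x. f x *\<^sub>R g x) x v = f x *\<^sub>R FD g x v + FD f x v *\<^sub>R g x"
  by (rule FD_bilinear[OF bounded_bilinear_scaleR])

lemma FD_inner:
  "f differentiable (at x) \<Longrightarrow> g differentiable (at x) \<Longrightarrow>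
    FD (\<lambda>x. f x \<bullet> g x) x v = f x \<bullet> FD g x v + FD f x v \<bullet> g x"
  by (rule FD_bilinear[OF bounded_bilinear_inner])

lemma FD_sum:
  "finite I \<Longrightarrow> (\<And>i. i \<in> I \<Longrightarrow> f i differentiable (at x)) \<Longrightarrow>
    FD (\<lambda>x. \<Sum>i\<in>I. f i x) x v = (\<Sum>i\<in>I. FD (f i) x v)"
  by (induction I rule: finite_induct) (simp_all add: FD_add)

lemma FD_compose:
  "f differentiable (at x) \<Longrightarrow> g differentiable (at (f x)) \<Longrightarrow>
    FD (\<lambda>x. g (f x)) x v = FD g (f x) (FD f x v)"
  using frechet_derivative_compose[of f x g] by (simp add: o_def)

lemma FD_real_compose:
  assumes "f differentiable (at x)" "(g has_real_derivative g') (at (f x))"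
  shows "FD (\<lambda>x. g (f x)) x v = g' * FD f x v"
  using FD_I[OF has_derivative_compose[OF differentiable_FD[OF assms(1)]
        assms(2)[unfolded has_field_derivative_def]]] by simp

text \<open>Product rule for the derivative in a moving direction. Symmetry of second derivatives
  moves the field \<open>w\<close> to the outer slot, so that brackets with a vector field can be
  read off.\<close>

lemma FD_field:
  fixes f :: "'a::euclidean_space \<Rightarrow> 'b::euclidean_space"
  assumes S: "open S" "smooth_on S f" and x: "x \<in> S" and w: "w differentiable (at x)"
  shows "FD (\<lambda>x. FD f x (w x)) x v = FD (\<lambda>y. FD f y v) x (w x) + FD f x (FD w x v)"
proof -
  have "FD f y (w y) = (\<Sum>b\<in>Basis. (w y \<bullet> b) *\<^sub>R FD f y b)" if "y \<in> S" for y
    by (rule linear_basis_expansion[OF smooth_on_linear_FD[OF S(2) that]])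
  then have "FD (\<lambda>x. FD f x (w x)) x v = FD (\<lambda>x. \<Sum>b\<in>Basis. (w x \<bullet> b) *\<^sub>R FD f x b) x v"
    by (subst FD_cong[OF S(1) x]) auto
  also have "\<dots> = (\<Sum>b\<in>Basis. FD (\<lambda>x. (w x \<bullet> b) *\<^sub>R FD f x b) x v)"
    using w smooth_on_differentiable[OF smooth_on_FD_const[OF S(2)] x]
    by (intro FD_sum) auto
  also have "\<dots> = (\<Sum>b\<in>Basis. (w x \<bullet> b) *\<^sub>R FD (\<lambda>y. FD f y b) x v + (FD w x v \<bullet> b) *\<^sub>R FD f x b)"
    using w smooth_on_differentiable[OF smooth_on_FD_const[OF S(2)] x]
    by (intro sum.cong refl) (simp add: FD_scaleR FD_inner)
  also have "\<dots> = (\<Sum>b\<in>Basis. (w x \<bullet> b) *\<^sub>R FD (\<lambda>y. FD f y v) x b)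
      + (\<Sum>b\<in>Basis. (FD w x v \<bullet> b) *\<^sub>R FD f x b)"
    using FD_FD_commute[OF S x, of _ v] by (simp add: sum.distrib)
  also have "\<dots> = FD (\<lambda>y. FD f y v) x (w x) + FD f x (FD w x v)"
    by (simp flip: linear_basis_expansion[OF smooth_on_linear_FD[OF S(2) x]]
      linear_basis_expansion[OF smooth_on_linear_FD[OF smooth_on_FD_const[OF S(2)] x]])
  finally show ?thesis .
qed

section \<open>Derivatives along the total field\<close>

lemma deriv_along_cong:
  "open S \<Longrightarrow> x \<in> S \<Longrightarrow> (\<And>y. y \<in> S \<Longrightarrow> f y = g y) \<Longrightarrow> deriv_along Y f x = deriv_along Y g x"
  unfolding deriv_along_def by (metis FD_cong)

lemma smooth_on_deriv_along:
  fixes f :: "'a::euclidean_space \<Rightarrow> 'b::real_normed_vector"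
  shows "open S \<Longrightarrow> smooth_on S Y \<Longrightarrow> smooth_on S f \<Longrightarrow> smooth_on S (deriv_along Y f)"
  unfolding deriv_along_def[abs_def] by (intro smooth_on_FD)

locale ode =
  fixes U :: "jet set" and F :: "jet \<Rightarrow> real"
  assumes ode: "third_order_ode U F"
begin

abbreviation sm :: "(jet \<Rightarrow> 'b::real_normed_vector) \<Rightarrow> bool" where
  "sm \<equiv> smooth_on U"

lemma open_U: "open U" and sm_F: "sm F"
  using ode by (auto simp: third_order_ode_def)

lemma sm_divide_const: "sm f \<Longrightarrow> sm (\<lambda>x. f x / (c::real))"
  using smooth_on_mult[OF open_U, of f "\<lambda>_. inverse c"]
  by (simp add: divide_inverse smooth_on_const[OF open_U])

lemmas sm_intros = sm_divide_const
  smooth_on_add[OF open_U] smooth_on_diff[OF open_U] smooth_on_minus[OF open_U]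
  smooth_on_mult[OF open_U] smooth_on_scaleR[OF open_U] smooth_on_inner[OF open_U]
  smooth_on_power[OF open_U] smooth_on_exp[OF open_U] smooth_on_const[OF open_U]
  smooth_on_ident[OF open_U] sm_F

lemma total_field_alt:
  "total_field F p = (1, fst (snd (snd p)), snd (snd (snd p)), F p)"
  by (auto simp: total_field_def split: prod.splits)

lemma sm_total_field: "sm (total_field F)"
  unfolding total_field_alt[abs_def]
  by (intro smooth_on_Pair smooth_on_fst smooth_on_snd smooth_on_const smooth_on_ident open_U sm_F)

lemma FD_total_field:
  assumes "p \<in> U"
  shows "FD (total_field F) p v = (0, fst (snd (snd v)), snd (snd (snd v)), FD F p v)"
  unfolding total_field_alt[abs_def]
  by (subst FD_I[where f' = "\<lambda>v. (0, fst (snd (snd v)), snd (snd (snd v)), FD F p v)"])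
     (auto intro!: derivative_eq_intros differentiable_FD smooth_on_differentiable[OF sm_F assms])

lemma FD_total_field_basis:
  assumes "p \<in> U"
  shows "FD (total_field F) p e0 = d0 F p *\<^sub>R e2"
    and "FD (total_field F) p e1 = e0 + d1 F p *\<^sub>R e2"
    and "FD (total_field F) p e2 = e1 + d2 F p *\<^sub>R e2"
  by (simp_all add: FD_total_field[OF assms] d0_def d1_def d2_def deriv_along_def)
     (simp_all add: e0_def e1_def e2_def)

lemma sm_XF: "sm f \<Longrightarrow> sm (XF F f)"
  unfolding XF_def by (intro smooth_on_deriv_along open_U sm_total_field)

lemma sm_d: "sm f \<Longrightarrow> sm (d0 f)" "sm f \<Longrightarrow> sm (d1 f)" "sm f \<Longrightarrow> sm (d2 f)"
  unfolding d0_def d1_def d2_def by (intro smooth_on_deriv_along smooth_on_const open_U; assumption)+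

lemmas sm_all = sm_intros sm_XF sm_d

lemma FD_d: "FD f p e0 = d0 f p" "FD f p e1 = d1 f p" "FD f p e2 = d2 f p"
  "FD f p (total_field F p) = XF F f p"
  by (simp_all add: d0_def d1_def d2_def XF_def deriv_along_def)

context
  fixes p assumes p: "p \<in> U"
begin

lemma der_const: "deriv_along Y (\<lambda>x. c) p = 0"
  by (simp add: deriv_along_def)

lemma der_add: "sm f \<Longrightarrow> sm g \<Longrightarrow>
    deriv_along Y (\<lambda>x. f x + g x) p = deriv_along Y f p + deriv_along Y g p"
  by (simp add: deriv_along_def FD_add smooth_on_differentiable[OF _ p])

lemma der_diff: "sm f \<Longrightarrow> sm g \<Longrightarrow>
    deriv_along Y (\<lambda>x. f x - g x) p = deriv_along Y f p - deriv_along Y g p"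
  by (simp add: deriv_along_def FD_diff smooth_on_differentiable[OF _ p])

lemma der_minus: "sm f \<Longrightarrow> deriv_along Y (\<lambda>x. - f x) p = - deriv_along Y f p"
  using der_diff[of "\<lambda>_. 0" f Y] by (simp add: der_const sm_intros)

lemma der_mult:
  fixes f g :: "jet \<Rightarrow> real"
  shows "sm f \<Longrightarrow> sm g \<Longrightarrow>
    deriv_along Y (\<lambda>x. f x * g x) p = f p * deriv_along Y g p + deriv_along Y f p * g p"
  by (simp add: deriv_along_def FD_mult smooth_on_differentiable[OF _ p])

lemma der_power2:
  fixes f :: "jet \<Rightarrow> real"
  shows "sm f \<Longrightarrow> deriv_along Y (\<lambda>x. (f x)\<^sup>2) p = 2 * f p * deriv_along Y f p"
  unfolding power2_eq_square by (simp add: der_mult)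

lemma der_power3:
  fixes f :: "jet \<Rightarrow> real"
  shows "sm f \<Longrightarrow> deriv_along Y (\<lambda>x. f x ^ 3) p = 3 * (f p)\<^sup>2 * deriv_along Y f p"
  unfolding power3_eq_cube power2_eq_square by (simp add: der_mult sm_intros algebra_simps)

lemma der_divide_const:
  "sm f \<Longrightarrow> deriv_along Y (\<lambda>x. f x / (c::real)) p = deriv_along Y f p / c"
  using der_mult[of f "\<lambda>_. inverse c" Y] by (simp add: divide_inverse sm_intros der_const)

lemmas der_rules = der_divide_const
  der_const[where c = "c :: real" for c] der_add[where f = "f :: jet \<Rightarrow> real" for f]
  der_diff[where f = "f :: jet \<Rightarrow> real" for f] der_minus[where f = "f :: jet \<Rightarrow> real" for f] der_mult der_power2 der_power3

lemma deriv_along_total_commute: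
  fixes f :: "jet \<Rightarrow> 'b::euclidean_space"
  assumes "sm f"
  shows "deriv_along (\<lambda>_. v) (deriv_along (total_field F) f) p
     = deriv_along (total_field F) (deriv_along (\<lambda>_. v) f) p + FD f p (FD (total_field F) p v)"
  using FD_field[OF open_U assms p smooth_on_differentiable[OF sm_total_field p]]
  by (simp add: deriv_along_def[abs_def])

lemma FD_lincomb:
  assumes "sm f"
  shows "FD f p (u + v) = FD f p u + FD f p v" "FD f p (u - v) = FD f p u - FD f p v"
    "FD f p (c *\<^sub>R u) = c *\<^sub>R FD f p u" "FD f p (- u) = - FD f p u" "FD f p 0 = 0"
  using smooth_on_linear_FD[OF assms p]
  by (auto simp: linear_add linear_diff linear_cmul linear_neg linear_0)

text \<open>These are the brackets [\<partial>_0, X_F] = F_0 \<partial>_2, [\<partial>_1, X_F] =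
  \<partial>_0 + F_1 \<partial>_2 and [\<partial>_2, X_F] = \<partial>_1 + F_2 \<partial>_2. As
  rewrite rules they move each \<partial>_i inside past X_F, after which identities between
  invariants are polynomial.\<close>

lemma d_XF:
  assumes "sm f"
  shows "d0 (XF F f) p = XF F (d0 f) p + d0 F p * d2 f p"
    and "d1 (XF F f) p = XF F (d1 f) p + d0 f p + d1 F p * d2 f p"
    and "d2 (XF F f) p = XF F (d2 f) p + d1 f p + d2 F p * d2 f p"
  using deriv_along_total_commute[OF assms, of e0] deriv_along_total_commute[OF assms, of e1]
    deriv_along_total_commute[OF assms, of e2]
  by (simp_all add: FD_total_field_basis[OF p] FD_lincomb[OF assms] FD_d flip: d0_def d1_def d2_def XF_def)

lemma d_d:
  assumes "sm f"
  shows "d2 (d1 f) p = d1 (d2 f) p" "d2 (d0 f) p = d0 (d2 f) p" "d1 (d0 f) p = d0 (d1 f) p"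
  using FD_FD_commute[OF open_U assms p]
  by (simp_all add: d0_def d1_def d2_def deriv_along_def[abs_def])

end

lemmas XF_rules = der_rules[where Y = "total_field F", folded XF_def]
lemmas d0_rules = der_rules[where Y = "\<lambda>_. e0", folded d0_def]
lemmas d1_rules = der_rules[where Y = "\<lambda>_. e1", folded d1_def]
lemmas d2_rules = der_rules[where Y = "\<lambda>_. e2", folded d2_def]

lemma XF_cong: "p \<in> U \<Longrightarrow> (\<And>q. q \<in> U \<Longrightarrow> f q = g q) \<Longrightarrow> XF F f p = XF F g p"
  unfolding XF_def using deriv_along_cong[OF open_U] by blast

text \<open>The X_F-derivative of the third bracket relation, required when \<partial>_2 passes both
  X_F in the term X_F^2(\<partial>_2 F) of \<open>K0\<close>.\<close>

lemma XF_d2_XF: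
  assumes "sm f" "p \<in> U"
  shows "XF F (d2 (XF F f)) p = XF F (XF F (d2 f)) p + XF F (d1 f) p
     + XF F (d2 F) p * d2 f p + d2 F p * XF F (d2 f) p"
proof -
  have "XF F (d2 (XF F f)) p = XF F (\<lambda>p. XF F (d2 f) p + d1 f p + d2 F p * d2 f p) p"
    by (rule XF_cong[OF assms(2)]) (simp add: d_XF(3)[OF _ assms(1)])
  then show ?thesis
    by (simp add: XF_rules[OF assms(2)] sm_all assms(1))
qed

lemma XF_d2_d1: "p \<in> U \<Longrightarrow> sm f \<Longrightarrow> XF F (d2 (d1 f)) p = XF F (d1 (d2 f)) p"
  by (rule XF_cong) (simp_all add: d_d)

section \<open>The invariants in terms of K_0 and K_1\<close>

lemma K1_alt: "K1 F = (\<lambda>p. d1 F p - XF F (d2 F) p + 1/3 * (d2 F p)^2)"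
  by (simp add: K1_def fun_eq_iff)

lemma K0_alt: "K0 F = (\<lambda>p. d0 F p - XF F (d1 F) p + 1/3 * (d1 F p * d2 F p) + 2/3 * XF F (XF F (d2 F)) p
     - 2/3 * (XF F (d2 F) p * d2 F p) + 2/27 * (d2 F p)^3)"
  by (simp add: K0_def fun_eq_iff)

lemma sm_K: "sm (K1 F)" "sm (K0 F)"
  unfolding K1_alt K0_alt by (simp_all add: sm_all)

text \<open>Once the partial derivatives have been moved inside past X_F, both sides are polynomials
  in the same iterated derivatives of \<open>F\<close>. The term X_F^2(\<partial>_2^2 F) enters the
  right side only through \<partial>_2 \<open>K0\<close>, with factor 2/3, which explains the
  constant 3/2.\<close>

lemma Cartan_eq_K:
  assumes p: "p \<in> U"
  shows "Cartan F p = - 3/2 * (deriv_along (V'field F) (K1 F) p - deriv_along Vfield (K0 F) p)"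
proof -
  have eq1: "deriv_along (V'field F) (K1 F) p = - d1 (K1 F) p - 2/3 * d2 F p * d2 (K1 F) p"
    by (simp add: deriv_along_def[of "V'field F"] V'field_def FD_lincomb[OF p sm_K(1)] FD_d(1-3))
  have eq2: "deriv_along Vfield (K0 F) p = d2 (K0 F) p"
    by (simp add: deriv_along_def Vfield_def d2_def)
  have eq3: "d1 (K1 F) p = d1 (d1 F) p - d1 (XF F (d2 F)) p + 2/3 * d2 F p * d1 (d2 F) p"
    unfolding K1_alt by (simp add: d1_rules[OF p] sm_all)
  have eq4: "d2 (K1 F) p = d2 (d1 F) p - d2 (XF F (d2 F)) p + 2/3 * d2 F p * d2 (d2 F) p"
    unfolding K1_alt by (simp add: d2_rules[OF p] sm_all)
  have eq5: "d2 (K0 F) p = d2 (d0 F) p - d2 (XF F (d1 F)) p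
      + 1/3 * (d1 F p * d2 (d2 F) p + d2 (d1 F) p * d2 F p)
      + 2/3 * d2 (XF F (XF F (d2 F))) p
      - 2/3 * (XF F (d2 F) p * d2 (d2 F) p + d2 (XF F (d2 F)) p * d2 F p)
      + 2/9 * (d2 F p)\<^sup>2 * d2 (d2 F) p"
    unfolding K0_alt by (simp add: d2_rules[OF p] sm_all)
  show ?thesis
    unfolding Cartan_def eq1 eq2 eq3 eq4 eq5
    by (simp add: d_XF[OF p] d_d[OF p] XF_d2_XF[OF _ p] XF_d2_d1[OF p] sm_all)
       (simp add: field_simps power2_eq_square)
qed

lemma W0_eq_K:
  assumes p: "p \<in> U"
  shows "W0 F p = K0 F p + 1/2 * XF F (K1 F) p"
  unfolding K1_alt by (simp add: XF_rules[OF p] sm_all K0_def W0_def algebra_simps)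

text \<open>If W_0 = 0 on all of the open set, then K_1' = -2 K_0 as functions, so
  \<open>Vfield\<close> may be applied to both sides.\<close>

lemma Wunschmann_K:
  assumes W0: "\<And>p. p \<in> U \<Longrightarrow> W0 F p = 0" and p: "p \<in> U"
  shows "2 * deriv_along (V'field F) (K1 F) p + deriv_along Vfield (XF F (K1 F)) p
     = 2 * (deriv_along (V'field F) (K1 F) p - deriv_along Vfield (K0 F) p)"
proof -
  have "deriv_along Vfield (XF F (K1 F)) p = deriv_along Vfield (\<lambda>p. -2 * K0 F p) p"
    by (rule deriv_along_cong[OF open_U p]) (use W0 W0_eq_K in force)
  also have "\<dots> = -2 * deriv_along Vfield (K0 F) p"
    by (simp add: der_rules[OF p] sm_all sm_K)
  finally show ?thesis by simp
qed

end

section \<open>Charts of the solution space\<close>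

lemma bilinear_basis_expansion:
  fixes B :: "'a::euclidean_space \<Rightarrow> 'b::euclidean_space \<Rightarrow> 'c::real_vector"
  assumes "bilinear B"
  shows "B u v = (\<Sum>i\<in>Basis. \<Sum>j\<in>Basis. ((u \<bullet> i) * (v \<bullet> j)) *\<^sub>R B i j)"
proof -
  have l: "linear (\<lambda>u. B u v)" "linear (B i)" for i v
    using assms by (auto simp: bilinear_def)
  have "B u v = (\<Sum>i\<in>Basis. (u \<bullet> i) *\<^sub>R (\<Sum>j\<in>Basis. (v \<bullet> j) *\<^sub>R B i j))"
    using linear_basis_expansion[OF l(1), of u v] linear_basis_expansion[OF l(2), of _ v] by simp
  then show ?thesis by (simp add: scaleR_sum_right)
qed

text \<open>Differentiation of a tensor field on \<open>M\<close> whose base point and arguments all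
  move. Smoothness of the tensor is given for fixed arguments, so both arguments are expanded in
  bases.\<close>

lemma
  fixes B :: "'m::euclidean_space \<Rightarrow> 'b::euclidean_space \<Rightarrow> 'c::euclidean_space \<Rightarrow> 'd::real_normed_vector"
    and f :: "'a::real_normed_vector \<Rightarrow> 'm"
  assumes S: "open S" "f ` S \<subseteq> M" "open M" and B: "\<And>y. y \<in> M \<Longrightarrow> bilinear (B y)"
    and sB: "\<And>u v. smooth_on M (\<lambda>y. B y u v)"
  shows smooth_on_bilinear_field:
      "smooth_on S f \<Longrightarrow> smooth_on S a \<Longrightarrow> smooth_on S b \<Longrightarrow> smooth_on S (\<lambda>x. B (f x) (a x) (b x))"
    and FD_bilinear_field:
      "x \<in> S \<Longrightarrow> f differentiable (at x) \<Longrightarrow> a differentiable (at x) \<Longrightarrow> b differentiable (at x) \<Longrightarrow>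
       FD (\<lambda>x. B (f x) (a x) (b x)) x v = FD (\<lambda>y. B y (a x) (b x)) (f x) (FD f x v)
         + B (f x) (FD a x v) (b x) + B (f x) (a x) (FD b x v)"
proof -
  have exp: "B (f x) u v = (\<Sum>i\<in>Basis. \<Sum>j\<in>Basis. ((u \<bullet> i) * (v \<bullet> j)) *\<^sub>R B (f x) i j)"
    if "x \<in> S" for x u v
    using that S by (intro bilinear_basis_expansion B) auto
  show "smooth_on S (\<lambda>x. B (f x) (a x) (b x))"
    if "smooth_on S f" "smooth_on S a" "smooth_on S b"
  proof (subst smooth_on_cong[OF S(1) exp])
    show "smooth_on S (\<lambda>x. \<Sum>i\<in>Basis. \<Sum>j\<in>Basis. ((a x \<bullet> i) * (b x \<bullet> j)) *\<^sub>R B (f x) i j)"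
      by (intro smooth_on_intros that S smooth_on_compose[OF S(1,3,2) that(1) sB])
  qed
  assume x: "x \<in> S" and d: "f differentiable (at x)" "a differentiable (at x)" "b differentiable (at x)"
  have fx: "f x \<in> M" using x S by auto
  have dB: "(\<lambda>y. B y u v) differentiable (at (f x))" for u v
    by (rule smooth_on_differentiable[OF sB fx])
  have dBf: "(\<lambda>x. B (f x) u v) differentiable (at x)" for u v
    using differentiable_compose[OF dB d(1)] .
  have c: "FD (\<lambda>x. B (f x) u w) x v = FD (\<lambda>y. B y u w) (f x) (FD f x v)" for u w
    by (rule FD_compose[OF d(1) dB])
  have "FD (\<lambda>x. B (f x) (a x) (b x)) x v
      = FD (\<lambda>x. \<Sum>i\<in>Basis. \<Sum>j\<in>Basis. ((a x \<bullet> i) * (b x \<bullet> j)) *\<^sub>R B (f x) i j) x v"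
    by (subst FD_cong[OF S(1) x exp]) auto
  also have "\<dots> = (\<Sum>i\<in>Basis. \<Sum>j\<in>Basis.
      ((a x \<bullet> i) * (b x \<bullet> j)) *\<^sub>R FD (\<lambda>y. B y i j) (f x) (FD f x v)
      + ((FD a x v \<bullet> i) * (b x \<bullet> j)) *\<^sub>R B (f x) i j
      + ((a x \<bullet> i) * (FD b x v \<bullet> j)) *\<^sub>R B (f x) i j)"
    using d dBf c by (simp add: FD_sum FD_scaleR FD_mult FD_inner scaleR_add_left algebra_simps)
  also have "\<dots> = (\<Sum>i\<in>Basis. \<Sum>j\<in>Basis.
      ((a x \<bullet> i) * (b x \<bullet> j)) *\<^sub>R FD (\<lambda>y. B y i j) (f x) (FD f x v))
      + B (f x) (FD a x v) (b x) + B (f x) (a x) (FD b x v)"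
    by (simp add: sum.distrib exp[OF x, of "FD a x v"] exp[OF x, of "a x" "FD b x v"])
  also have "(\<Sum>i\<in>Basis. \<Sum>j\<in>Basis. ((a x \<bullet> i) * (b x \<bullet> j)) *\<^sub>R FD (\<lambda>y. B y i j) (f x) (FD f x v))
      = FD (\<lambda>y. B y (a x) (b x)) (f x) (FD f x v)"
  proof -
    have "FD (\<lambda>y. B y (a x) (b x)) (f x) (FD f x v)
      = FD (\<lambda>y. \<Sum>i\<in>Basis. \<Sum>j\<in>Basis. ((a x \<bullet> i) * (b x \<bullet> j)) *\<^sub>R B y i j) (f x) (FD f x v)"
      by (subst FD_cong[OF S(3) fx bilinear_basis_expansion[OF B]]) auto
    then show ?thesis by (simp add: FD_sum FD_scaleR dB)
  qed
  finally show "FD (\<lambda>x. B (f x) (a x) (b x)) x v = FD (\<lambda>y. B y (a x) (b x)) (f x) (FD f x v)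
         + B (f x) (FD a x v) (b x) + B (f x) (a x) (FD b x v)" .
qed

lemma
  fixes L :: "'m::euclidean_space \<Rightarrow> 'b::euclidean_space \<Rightarrow> 'd::real_normed_vector"
    and f :: "'a::real_normed_vector \<Rightarrow> 'm"
  assumes S: "open S" "f ` S \<subseteq> M" "open M" and L: "\<And>y. y \<in> M \<Longrightarrow> linear (L y)"
    and sL: "\<And>u. smooth_on M (\<lambda>y. L y u)"
  shows smooth_on_linear_field:
      "smooth_on S f \<Longrightarrow> smooth_on S a \<Longrightarrow> smooth_on S (\<lambda>x. L (f x) (a x))"
    and FD_linear_field:
      "x \<in> S \<Longrightarrow> f differentiable (at x) \<Longrightarrow> a differentiable (at x) \<Longrightarrow>
       FD (\<lambda>x. L (f x) (a x)) x v
         = FD (\<lambda>y. L y (a x)) (f x) (FD f x v) + L (f x) (FD a x v)"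
proof -
  \<comment> \<open>A linear field is a bilinear one whose second argument is a scalar, kept equal
    to 1.\<close>
  let ?B = "\<lambda>y u (c::real). c *\<^sub>R L y u"
  have B: "bilinear (?B y)" if "y \<in> M" for y
    using L[OF that] by (auto simp: bilinear_def linear_iff algebra_simps)
  have sB: "smooth_on M (\<lambda>y. ?B y u c)" for u c
    by (intro smooth_on_intros S sL)
  show "smooth_on S f \<Longrightarrow> smooth_on S a \<Longrightarrow> smooth_on S (\<lambda>x. L (f x) (a x))"
    using smooth_on_bilinear_field[OF S B sB, of a "\<lambda>_. 1"] by (simp add: smooth_on_const[OF S(1)])
  show "x \<in> S \<Longrightarrow> f differentiable (at x) \<Longrightarrow> a differentiable (at x) \<Longrightarrow>
       FD (\<lambda>x. L (f x) (a x)) x v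
         = FD (\<lambda>y. L y (a x)) (f x) (FD f x v) + L (f x) (FD a x v)"
    using FD_bilinear_field[OF S B sB, of x a "\<lambda>_. 1" v] by simp
qed

text \<open>The infinitesimal half of a solution space: the jets have one dimension more than the
  target, so the kernel of the differential is exactly the line of X_F. Global statements about
  fibres come later, where functions must descend.\<close>

locale chart = ode U F for U F +
  fixes \<psi> :: "jet \<Rightarrow> real^3"
  assumes sm_\<psi>: "smooth_on U \<psi>"
    and surj_\<psi>: "p \<in> U \<Longrightarrow> surj (FD \<psi> p)"
    and kernel_\<psi>: "p \<in> U \<Longrightarrow> FD \<psi> p (total_field F p) = 0"
begin

text \<open>The images of the coordinate fields are vector fields along \<open>\<psi>\<close>; they
  vary along the fibres and do not define fields on the image.\<close>

definition w0 :: "jet \<Rightarrow> real^3" where "w0 p = FD \<psi> p e0"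
definition w1 :: "jet \<Rightarrow> real^3" where "w1 p = FD \<psi> p e1"
definition w2 :: "jet \<Rightarrow> real^3" where "w2 p = FD \<psi> p e2"

lemma sm_w: "sm w0" "sm w1" "sm w2"
  unfolding w0_def[abs_def] w1_def[abs_def] w2_def[abs_def]
  by (intro smooth_on_FD_const sm_\<psi>)+

text \<open>Differentiate the identity \<open>FD \<psi> q (total_field F q) = 0\<close> in the
  direction \<open>v\<close> and exchange the two derivatives of \<open>\<psi>\<close>.\<close>

lemma XF_FD_\<psi>:
  assumes p: "p \<in> U"
  shows "FD (\<lambda>q. FD \<psi> q v) p (total_field F p) = - FD \<psi> p (FD (total_field F) p v)"
proof -
  have "FD (\<lambda>q. FD \<psi> q (total_field F q)) p v = FD (\<lambda>q. 0) p v"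
    by (subst FD_cong[OF open_U p kernel_\<psi>]) auto
  then show ?thesis
    using FD_field[OF open_U sm_\<psi> p smooth_on_differentiable[OF sm_total_field p], of v]
    by (simp add: eq_neg_iff_add_eq_0)
qed

lemma X_w:
  assumes p: "p \<in> U"
  shows "FD w0 p (total_field F p) = - (d0 F p *\<^sub>R w2 p)"
    and "FD w1 p (total_field F p) = - w0 p - d1 F p *\<^sub>R w2 p"
    and "FD w2 p (total_field F p) = - w1 p - d2 F p *\<^sub>R w2 p"
  unfolding w0_def[abs_def] w1_def[abs_def] w2_def[abs_def] XF_FD_\<psi>[OF p]
  by (simp_all add: FD_total_field_basis[OF p] FD_lincomb[OF p sm_\<psi>])

definition volume :: "jet \<Rightarrow> real" where "volume p = w0 p \<bullet> cross3 (w1 p) (w2 p)"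

text \<open>Every jet direction is a multiple of X_F plus a combination of \<open>e0\<close>,
  \<open>e1\<close>, \<open>e2\<close>, because X_F has t-component 1; the differential is
  surjective and kills X_F.\<close>

lemma \<psi>_span:
  assumes p: "p \<in> U"
  obtains a b c where "u = a *\<^sub>R w0 p + b *\<^sub>R w1 p + c *\<^sub>R w2 p"
proof -
  obtain v where v: "u = FD \<psi> p v" using surj_\<psi>[OF p] by (metis surj_def)
  obtain t a b c where vv: "v = (t, a, b, c)" by (cases v) auto
  obtain s x0 x1 x2 where pp: "p = (s, x0, x1, x2)" by (cases p) auto
  have "v = t *\<^sub>R total_field F p + (a - t * x1) *\<^sub>R e0 + (b - t * x2) *\<^sub>R e1 + (c - t * F p) *\<^sub>R e2"
    by (simp add: vv pp total_field_def e0_def e1_def e2_def)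
  then have "u = (a - t * x1) *\<^sub>R w0 p + (b - t * x2) *\<^sub>R w1 p + (c - t * F p) *\<^sub>R w2 p"
    unfolding v w0_def w1_def w2_def by (simp add: FD_lincomb[OF p sm_\<psi>] kernel_\<psi>[OF p])
  then show ?thesis using that by blast
qed

text \<open>If the triple product vanishes, each cross product of two frame vectors is orthogonal to
  the whole frame and hence zero. Then all cross products in R^3 would vanish.\<close>

lemma volume_nonzero:
  assumes p: "p \<in> U"
  shows "volume p \<noteq> 0"
proof
  assume 0: "volume p = 0"
  have cyc: "w1 p \<bullet> cross3 (w2 p) (w0 p) = volume p" "w2 p \<bullet> cross3 (w0 p) (w1 p) = volume p"
    unfolding volume_def by (simp_all add: cross3_simps)
  have orth: "z = 0" if "w0 p \<bullet> z = 0" "w1 p \<bullet> z = 0" "w2 p \<bullet> z = 0" for z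
  proof -
    obtain a b c where z: "z = a *\<^sub>R w0 p + b *\<^sub>R w1 p + c *\<^sub>R w2 p" by (rule \<psi>_span[OF p])
    have "(a *\<^sub>R w0 p + b *\<^sub>R w1 p + c *\<^sub>R w2 p) \<bullet> z = 0"
      using that by (simp add: inner_add_left)
    then show ?thesis by (simp flip: z)
  qed
  have z: "cross3 (w1 p) (w2 p) = 0" "cross3 (w2 p) (w0 p) = 0" "cross3 (w0 p) (w1 p) = 0"
    using 0 cyc by (auto intro!: orth simp: dot_cross_self volume_def)
  then have z': "cross3 (w2 p) (w1 p) = 0" "cross3 (w0 p) (w2 p) = 0" "cross3 (w1 p) (w0 p) = 0"
    using cross_skew[of "w2 p" "w1 p"] cross_skew[of "w0 p" "w2 p"] cross_skew[of "w1 p" "w0 p"]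
    by simp_all
  obtain a b c where 1: "axis 1 1 = a *\<^sub>R w0 p + b *\<^sub>R w1 p + c *\<^sub>R w2 p" by (rule \<psi>_span[OF p])
  obtain a' b' c' where 2: "axis 2 1 = a' *\<^sub>R w0 p + b' *\<^sub>R w1 p + c' *\<^sub>R w2 p" by (rule \<psi>_span[OF p])
  have "cross3 (axis 1 1) (axis 2 1) = 0"
    unfolding 1 2 by (simp add: cross_add_left cross_add_right cross_mult_left cross_mult_right z z')
  then show False by (simp add: cross_basis axis_eq_0_iff)
qed

text \<open>The dual coframe, written by Cramer's rule so that its smooth dependence on the jet is
  visible.\<close>

definition \<theta>0 :: "jet \<Rightarrow> real^3 \<Rightarrow> real" where "\<theta>0 p u = u \<bullet> cross3 (w1 p) (w2 p) / volume p"
definition \<theta>1 :: "jet \<Rightarrow> real^3 \<Rightarrow> real" where "\<theta>1 p u = u \<bullet> cross3 (w2 p) (w0 p) / volume p"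
definition \<theta>2 :: "jet \<Rightarrow> real^3 \<Rightarrow> real" where "\<theta>2 p u = u \<bullet> cross3 (w0 p) (w1 p) / volume p"

lemma \<theta>_w:
  assumes p: "p \<in> U"
  shows "\<theta>0 p (w0 p) = 1" "\<theta>0 p (w1 p) = 0" "\<theta>0 p (w2 p) = 0"
    "\<theta>1 p (w0 p) = 0" "\<theta>1 p (w1 p) = 1" "\<theta>1 p (w2 p) = 0"
    "\<theta>2 p (w0 p) = 0" "\<theta>2 p (w1 p) = 0" "\<theta>2 p (w2 p) = 1"
proof -
  have "w1 p \<bullet> cross3 (w2 p) (w0 p) = volume p" "w2 p \<bullet> cross3 (w0 p) (w1 p) = volume p"
    unfolding volume_def by (simp_all add: cross3_simps)
  then show "\<theta>0 p (w0 p) = 1" "\<theta>0 p (w1 p) = 0" "\<theta>0 p (w2 p) = 0"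
    "\<theta>1 p (w0 p) = 0" "\<theta>1 p (w1 p) = 1" "\<theta>1 p (w2 p) = 0"
    "\<theta>2 p (w0 p) = 0" "\<theta>2 p (w1 p) = 0" "\<theta>2 p (w2 p) = 1"
    using volume_nonzero[OF p]
    by (simp_all add: \<theta>0_def \<theta>1_def \<theta>2_def dot_cross_self) (simp add: volume_def)
qed

lemma linear_\<theta>: "linear (\<theta>0 p)" "linear (\<theta>1 p)" "linear (\<theta>2 p)"
  by (auto simp: \<theta>0_def \<theta>1_def \<theta>2_def linear_iff inner_add_left add_divide_distrib)

lemma frame_expansion:
  assumes p: "p \<in> U"
  shows "u = \<theta>0 p u *\<^sub>R w0 p + \<theta>1 p u *\<^sub>R w1 p + \<theta>2 p u *\<^sub>R w2 p"
proof -
  obtain a b c where u: "u = a *\<^sub>R w0 p + b *\<^sub>R w1 p + c *\<^sub>R w2 p" by (rule \<psi>_span[OF p])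
  show ?thesis
    unfolding u by (simp add: linear_add[OF linear_\<theta>(1)] linear_add[OF linear_\<theta>(2)]
        linear_add[OF linear_\<theta>(3)] linear_cmul[OF linear_\<theta>(1)] linear_cmul[OF linear_\<theta>(2)]
        linear_cmul[OF linear_\<theta>(3)] \<theta>_w[OF p])
qed

abbreviation M :: "(real^3) set" where "M \<equiv> \<psi> ` U"

end

lemma bounded_bilinear_cross3: "bounded_bilinear cross3"
  by (simp add: bilinear_cross flip: bilinear_conv_bounded_bilinear)

section \<open>Local sections and descent of functions\<close>

context chart begin

lemma FD_\<psi>_frame:
  assumes "p \<in> U"
  shows "FD \<psi> p (a *\<^sub>R e0 + b *\<^sub>R e1 + c *\<^sub>R e2) = a *\<^sub>R w0 p + b *\<^sub>R w1 p + c *\<^sub>R w2 p"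
  by (simp add: FD_lincomb[OF assms sm_\<psi>] w0_def w1_def w2_def)

text \<open>The affine slice through \<open>p\<close> spanned by \<open>e0\<close>,
  \<open>e1\<close>, \<open>e2\<close> is transversal to X_F, so the restriction of
  \<open>\<psi>\<close> to it has invertible derivative at \<open>p\<close> and the inverse function
  theorem applies.\<close>

lemma local_section:
  assumes p: "p \<in> U"
  obtains V s where "open V" "\<psi> p \<in> V" "s (\<psi> p) = p"
    "\<And>y. y \<in> V \<Longrightarrow> s y \<in> U" "\<And>y. y \<in> V \<Longrightarrow> \<psi> (s y) = y" "\<And>y. y \<in> V \<Longrightarrow> s differentiable (at y)"
proof -
  define \<rho> :: "real^3 \<Rightarrow> jet" where "\<rho> h = (h $ 1) *\<^sub>R e0 + (h $ 2) *\<^sub>R e1 + (h $ 3) *\<^sub>R e2" for h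
  have \<rho>: "linear \<rho>" by (auto simp: \<rho>_def linear_iff algebra_simps)
  then have bl\<rho>: "bounded_linear \<rho>" by (simp add: linear_conv_bounded_linear)
  define S where "S = (\<lambda>a. p + \<rho> a) -` U"
  have cont: "continuous_on UNIV (\<lambda>a. p + \<rho> a)"
    by (intro continuous_intros linear_continuous_on bl\<rho>)
  have S: "open S" unfolding S_def by (rule open_vimage[OF open_U cont])
  have 0: "0 \<in> S" using p linear_0[OF \<rho>] by (simp add: S_def)
  define f' where "f' a = Blinfun (\<lambda>h. FD \<psi> (p + \<rho> a) (\<rho> h))" for a
  have f': "blinfun_apply (f' a) = (\<lambda>h. FD \<psi> (p + \<rho> a) (\<rho> h))" if "a \<in> S" for a
  proof -
    have "linear (\<lambda>h. FD \<psi> (p + \<rho> a) (\<rho> h))"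
      using linear_compose[OF \<rho> smooth_on_linear_FD[OF sm_\<psi>, of "p + \<rho> a"]] that
      by (simp add: S_def o_def)
    then show ?thesis
      unfolding f'_def by (simp add: linear_conv_bounded_linear bounded_linear_Blinfun_apply)
  qed
  have der: "((\<lambda>a. \<psi> (p + \<rho> a)) has_derivative blinfun_apply (f' a)) (at a)" if "a \<in> S" for a
    unfolding f'[OF that]
  proof (rule has_derivative_compose[where f = "\<lambda>a. p + \<rho> a" and g = \<psi>])
    show "((\<lambda>a. p + \<rho> a) has_derivative \<rho>) (at a)"
      by (auto intro!: derivative_eq_intros bounded_linear_imp_has_derivative bl\<rho>)
    show "(\<psi> has_derivative FD \<psi> (p + \<rho> a)) (at (p + \<rho> a))"
      using that by (auto simp: S_def intro: smooth_on_has_derivative[OF sm_\<psi>])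
  qed
  have contf: "continuous_on S f'"
  proof (rule continuous_on_blinfun_componentwise)
    fix i :: "real^3"
    have "continuous_on S (\<lambda>a. FD \<psi> (p + \<rho> a) (\<rho> i))"
      using continuous_on_compose2[OF smooth_on_continuous_on[OF smooth_on_FD_const[OF sm_\<psi>]]
          continuous_on_subset[OF cont subset_UNIV], of S] by (auto simp: S_def)
    then show "continuous_on S (\<lambda>a. blinfun_apply (f' a) i)"
      by (subst continuous_on_cong[OF refl]) (auto simp: f')
  qed
  \<comment> \<open>The coframe at \<open>p\<close> inverts the derivative of the restriction at the
    origin.\<close>
  define \<iota> :: "real^3 \<Rightarrow> real^3" where "\<iota> u = vector [\<theta>0 p u, \<theta>1 p u, \<theta>2 p u]" for u
  have "linear \<iota>"
    unfolding \<iota>_def by (auto simp: linear_iff vec_eq_iff forall_3 linear_add[OF linear_\<theta>(1)] linear_add[OF linear_\<theta>(2)]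
        linear_add[OF linear_\<theta>(3)] linear_cmul[OF linear_\<theta>(1)] linear_cmul[OF linear_\<theta>(2)]
        linear_cmul[OF linear_\<theta>(3)])
  then have \<iota>: "blinfun_apply (Blinfun \<iota>) = \<iota>"
    by (simp add: linear_conv_bounded_linear bounded_linear_Blinfun_apply)
  have "Blinfun \<iota> o\<^sub>L f' 0 = id_blinfun"
  proof (rule blinfun_eqI)
    fix h
    have "\<iota> (FD \<psi> p (\<rho> h)) = h"
      unfolding \<rho>_def \<iota>_def FD_\<psi>_frame[OF p]
      by (simp add: vec_eq_iff forall_3 linear_add[OF linear_\<theta>(1)] linear_add[OF linear_\<theta>(2)]
        linear_add[OF linear_\<theta>(3)] linear_cmul[OF linear_\<theta>(1)] linear_cmul[OF linear_\<theta>(2)]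
        linear_cmul[OF linear_\<theta>(3)] \<theta>_w[OF p])
    then show "blinfun_apply (Blinfun \<iota> o\<^sub>L f' 0) h = blinfun_apply id_blinfun h"
      using linear_0[OF \<rho>] by (simp add: \<iota> f'[OF 0])
  qed
  from inverse_function_theorem[OF S der contf 0 this]
  obtain U' V g g' where ift: "open V" "0 \<in> U'" "U' \<subseteq> S"
    "\<psi> (p + \<rho> 0) \<in> V" "homeomorphism U' V (\<lambda>a. \<psi> (p + \<rho> a)) g"
    "\<And>y. y \<in> V \<Longrightarrow> (g has_derivative (g' y)) (at y)" by metis
  have g: "g y \<in> U'" "\<psi> (p + \<rho> (g y)) = y" if "y \<in> V" for y
    using ift(5) that unfolding homeomorphism_def by auto
  show ?thesis
  proof (rule that[of V "\<lambda>y. p + \<rho> (g y)"])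
    show "p + \<rho> (g (\<psi> p)) = p"
      using ift(5,2) linear_0[OF \<rho>] unfolding homeomorphism_def by force
    show "(\<lambda>y. p + \<rho> (g y)) differentiable (at y)" if "y \<in> V" for y
      using bounded_linear.has_derivative[OF bl\<rho> ift(6)[OF that]]
      by (auto simp: differentiable_def intro!: has_derivative_add has_derivative_const)
  qed (use ift g linear_0[OF \<rho>] in \<open>auto simp: S_def\<close>)
qed

lemma open_M: "open M"
proof (rule open_subopen[THEN iffD2], safe)
  fix p assume "p \<in> U"
  then obtain V s where "open V" "\<psi> p \<in> V" "\<And>y. y \<in> V \<Longrightarrow> s y \<in> U" "\<And>y. y \<in> V \<Longrightarrow> \<psi> (s y) = y"
    by (rule local_section) blast
  then show "\<exists>T. open T \<and> \<psi> p \<in> T \<and> T \<subseteq> M"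
    by (intro exI[of _ V]) (auto simp: subset_iff image_iff, metis)
qed

lemma differentiable_descend:
  fixes g :: "real^3 \<Rightarrow> 'b::real_normed_vector"
  assumes "sm (\<lambda>p. g (\<psi> p))" and p: "p \<in> U"
  shows "g differentiable (at (\<psi> p))"
proof -
  obtain V s where V: "open V" "\<psi> p \<in> V" "s (\<psi> p) = p" "\<And>y. y \<in> V \<Longrightarrow> \<psi> (s y) = y"
    "\<And>y. y \<in> V \<Longrightarrow> s differentiable (at y)"
    by (rule local_section[OF p]) blast
  have "(\<lambda>y. g (\<psi> (s y))) differentiable (at (\<psi> p))"
    using V by (intro differentiable_compose[where f = "\<lambda>p. g (\<psi> p)" and g = s]
        smooth_on_differentiable[OF assms(1)]) (simp_all add: p)
  then show ?thesis
    using differentiable_cong_open[OF V(1,2), of "\<lambda>y. g (\<psi> (s y))" g] V(4) by auto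
qed

lemma sm_cross: "sm f \<Longrightarrow> sm g \<Longrightarrow> sm (\<lambda>p. cross3 (f p) (g p))"
  by (rule smooth_on_bilinear[OF open_U bounded_bilinear_cross3])

lemma sm_volume: "sm volume"
  unfolding volume_def[abs_def] by (intro sm_intros sm_cross sm_w)

lemma sm_\<theta>: "sm (\<lambda>p. \<theta>0 p v)" "sm (\<lambda>p. \<theta>1 p v)" "sm (\<lambda>p. \<theta>2 p v)"
  unfolding \<theta>0_def \<theta>1_def \<theta>2_def
  by (intro smooth_on_divide sm_intros sm_cross sm_w sm_volume open_U volume_nonzero; assumption)+

text \<open>The local sections are known to be differentiable, no more, so composing with them gives
  a single derivative. Higher orders come from induction: the pulled back derivative of
  \<open>g\<close> in the direction \<open>v\<close> is the derivative of the pulled back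
  \<open>g\<close> along a smooth lift of \<open>v\<close>, hence again a smooth function on the
  jets.\<close>

lemma smooth_on_descend:
  fixes g :: "real^3 \<Rightarrow> 'b::real_normed_vector"
  assumes "sm (\<lambda>p. g (\<psi> p))"
  shows "smooth_on M g"
proof -
  have "Ck_on k g M" for k
    using assms
  proof (induction k arbitrary: g)
    case 0
    then show ?case
      by (auto intro!: continuous_at_imp_continuous_on differentiable_imp_continuous_within
          differentiable_descend)
  next
    case (Suc k)
    have dg: "g differentiable (at (\<psi> p))" if "p \<in> U" for p
      by (rule differentiable_descend[OF Suc.prems that])
    have "sm (\<lambda>p. FD g (\<psi> p) v)" for v
    proof (subst smooth_on_cong[OF open_U])
      let ?v = "\<lambda>p. \<theta>0 p v *\<^sub>R e0 + \<theta>1 p v *\<^sub>R e1 + \<theta>2 p v *\<^sub>R e2"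
      show "FD g (\<psi> p) v = FD (\<lambda>p. g (\<psi> p)) p (?v p)" if p: "p \<in> U" for p
        unfolding FD_compose[OF smooth_on_differentiable[OF sm_\<psi> p] dg[OF p]] FD_\<psi>_frame[OF p]
        using frame_expansion[OF p, of v] by simp
      show "sm (\<lambda>p. FD (\<lambda>p. g (\<psi> p)) p (?v p))"
        by (intro smooth_on_FD sm_intros sm_\<theta> Suc.prems open_U)
    qed
    then have "Ck_on k (\<lambda>y. FD g y v) M" for v
      by (rule Suc.IH)
    then show ?case using dg by auto
  qed
  then show ?thesis by (simp add: smooth_on_def)
qed

end

text \<open>Connectedness of the fibres is recorded as constancy of first integrals. In this form it
  passes to compositions with a change of jet coordinates, under which the integral curves are
  reparametrised.\<close>

locale fibred_chart = chart +
  assumes fibres: "smooth_on U f \<Longrightarrow> (\<And>p. p \<in> U \<Longrightarrow> XF F f p = 0) \<Longrightarrow> p \<in> U \<Longrightarrow> q \<in> U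
    \<Longrightarrow> \<psi> p = \<psi> q \<Longrightarrow> f p = f q"
begin

lemma descend:
  fixes f :: "jet \<Rightarrow> real"
  assumes "sm f" "\<And>p. p \<in> U \<Longrightarrow> XF F f p = 0"
  obtains g where "smooth_on M g" "\<And>p. p \<in> U \<Longrightarrow> g (\<psi> p) = f p"
proof -
  define g where "g y = f (SOME p. p \<in> U \<and> \<psi> p = y)" for y
  have g: "g (\<psi> p) = f p" if "p \<in> U" for p
  proof -
    have "(SOME q. q \<in> U \<and> \<psi> q = \<psi> p) \<in> U \<and> \<psi> (SOME q. q \<in> U \<and> \<psi> q = \<psi> p) = \<psi> p"
      by (rule someI[of _ p]) (simp add: that)
    then show ?thesis unfolding g_def using fibres[OF assms _ that] by metis
  qed
  have "sm (\<lambda>p. g (\<psi> p))"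
    by (subst smooth_on_cong[OF open_U g]) (simp_all add: assms(1))
  from that[OF smooth_on_descend[OF this] g] show ?thesis .
qed

end

section \<open>Null forms and Weyl connections\<close>

context chart begin

text \<open>The ratio B(w_0, w_0) / B(w_1, w_1) that the frame system forces on a form for which w_2
  is null.\<close>

definition gram00 :: "jet \<Rightarrow> real" where
  "gram00 p = d1 F p - 1/3 * XF F (d2 F) p + 2/9 * (d2 F p)\<^sup>2"

lemma sm_gram00: "sm gram00"
  unfolding gram00_def[abs_def] by (intro sm_all)

text \<open>The shape in which W_0 appears below: the defect in the equation that B(w_0, w_0) must
  satisfy along X_F.\<close>

lemma two_W0_eq: "p \<in> U \<Longrightarrow>
    2 * W0 F p = 2 * d0 F p - XF F gram00 p + 2/3 * d2 F p * gram00 p"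
  unfolding gram00_def[abs_def] W0_def
  by (simp add: XF_rules sm_all field_simps power2_eq_square power3_eq_cube)

context
  fixes B :: "real^3 \<Rightarrow> real^3 \<Rightarrow> real^3 \<Rightarrow> real"
  assumes bilinear_B: "\<forall>y\<in>M. bilinear (B y)"
    and sB: "\<And>u v. smooth_on M (\<lambda>y. B y u v)"
begin

lemmas bil = bspec[OF bilinear_B]

lemma sm_B: "sm a \<Longrightarrow> sm b \<Longrightarrow> sm (\<lambda>p. B (\<psi> p) (a p) (b p))"
  by (rule smooth_on_bilinear_field[OF open_U subset_refl open_M bil sB sm_\<psi>])

lemma FD_B:
  assumes p: "p \<in> U" and "sm a" "sm b"
  shows "FD (\<lambda>p. B (\<psi> p) (a p) (b p)) p v = FD (\<lambda>y. B y (a p) (b p)) (\<psi> p) (FD \<psi> p v)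
     + B (\<psi> p) (FD a p v) (b p) + B (\<psi> p) (a p) (FD b p v)"
  by (intro FD_bilinear_field[OF open_U subset_refl open_M bil sB p]
      smooth_on_differentiable[OF _ p] assms sm_\<psi>)

text \<open>The base point \<open>\<psi> p\<close> does not move along X_F to first order, so only
  the two arguments are differentiated.\<close>

lemma XF_B:
  assumes p: "p \<in> U" and s: "sm a" "sm b"
  shows "XF F (\<lambda>p. B (\<psi> p) (a p) (b p)) p
     = B (\<psi> p) (FD a p (total_field F p)) (b p) + B (\<psi> p) (a p) (FD b p (total_field F p))"
proof -
  have "(\<lambda>y. B y (a p) (b p)) differentiable (at (\<psi> p))"
    by (rule smooth_on_differentiable[OF sB]) (use p in auto)
  then show ?thesis
    by (simp add: XF_def deriv_along_def FD_B[OF p s] kernel_\<psi>[OF p]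
        linear_0[OF linear_frechet_derivative])
qed

lemma B_lincomb:
  assumes "p \<in> U"
  shows "B (\<psi> p) (u + v) w = B (\<psi> p) u w + B (\<psi> p) v w" "B (\<psi> p) (u - v) w = B (\<psi> p) u w - B (\<psi> p) v w"
    "B (\<psi> p) (c *\<^sub>R u) w = c * B (\<psi> p) u w" "B (\<psi> p) (- u) w = - B (\<psi> p) u w" "B (\<psi> p) 0 w = 0"
    "B (\<psi> p) w (u + v) = B (\<psi> p) w u + B (\<psi> p) w v" "B (\<psi> p) w (u - v) = B (\<psi> p) w u - B (\<psi> p) w v"
    "B (\<psi> p) w (c *\<^sub>R u) = c * B (\<psi> p) w u" "B (\<psi> p) w (- u) = - B (\<psi> p) w u" "B (\<psi> p) w 0 = 0"
proof -
  have "bilinear (B (\<psi> p))" using assms by (intro bil) auto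
  note b = bilinear_ladd[OF this] bilinear_lsub[OF this] bilinear_lmul[OF this] bilinear_lneg[OF this]
    bilinear_lzero[OF this] bilinear_radd[OF this] bilinear_rsub[OF this] bilinear_rmul[OF this]
    bilinear_rneg[OF this] bilinear_rzero[OF this]
  show "B (\<psi> p) (u + v) w = B (\<psi> p) u w + B (\<psi> p) v w" "B (\<psi> p) (u - v) w = B (\<psi> p) u w - B (\<psi> p) v w"
    "B (\<psi> p) (c *\<^sub>R u) w = c * B (\<psi> p) u w" "B (\<psi> p) (- u) w = - B (\<psi> p) u w" "B (\<psi> p) 0 w = 0"
    "B (\<psi> p) w (u + v) = B (\<psi> p) w u + B (\<psi> p) w v" "B (\<psi> p) w (u - v) = B (\<psi> p) w u - B (\<psi> p) w v"
    "B (\<psi> p) w (c *\<^sub>R u) = c * B (\<psi> p) w u" "B (\<psi> p) w (- u) = - B (\<psi> p) w u" "B (\<psi> p) w 0 = 0"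
    by (simp_all add: b)
qed

text \<open>Each identity is the derivative along \<open>X\<^sub>F\<close> of the preceding one; the last one closes the
  system and forces the Wuenschmann condition.\<close>

lemma null_form:
  assumes symmetric: "\<forall>y\<in>M. \<forall>u v. B y u v = B y v u"
    and null_w2: "\<forall>p\<in>U. B (\<psi> p) (w2 p) (w2 p) = 0"
    and p: "p \<in> U"
  shows "B (\<psi> p) (w1 p) (w2 p) = 0"
    and "B (\<psi> p) (w0 p) (w2 p) = - B (\<psi> p) (w1 p) (w1 p)"
    and "B (\<psi> p) (w0 p) (w1 p) = 1/3 * d2 F p * B (\<psi> p) (w1 p) (w1 p)"
    and "B (\<psi> p) (w0 p) (w0 p) = gram00 p * B (\<psi> p) (w1 p) (w1 p)"
    and "XF F (\<lambda>p. B (\<psi> p) (w1 p) (w1 p)) p = - 2/3 * d2 F p * B (\<psi> p) (w1 p) (w1 p)"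
    and "B (\<psi> p) (w1 p) (w1 p) * W0 F p = 0"
proof -
  let ?b = "\<lambda>u v p. B (\<psi> p) (u p) (v p)"
  let ?q = "?b w1 w1"
  have sym': "B (\<psi> p) u v = B (\<psi> p) v u" if "p \<in> U" for p u v
    using that symmetric by blast
  note null = bspec[OF null_w2]
  note X = XF_B X_w B_lincomb sm_w sm_B
  have X22: "XF F (?b w2 w2) p = 0" if "p \<in> U" for p
    using XF_cong[OF that null] XF_rules(2)[OF that] by simp
  have b12: "?b w1 w2 p = 0" if "p \<in> U" for p
    using X22[OF that] that null[OF that] by (simp add: X sym'[of _ "w2 p" "w1 p"])
  have X12: "XF F (?b w1 w2) p = 0" if "p \<in> U" for p
    using XF_cong[OF that b12] XF_rules(2)[OF that] by simp
  have b02: "?b w0 w2 p = - ?q p" if "p \<in> U" for p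
    using X12[OF that] that null[OF that] b12[OF that] by (simp add: X)
  have Xq: "XF F ?q p = - 2 * ?b w0 w1 p" if "p \<in> U" for p
    using that b12[OF that] by (simp add: X sym'[of _ "w1 p" "w0 p"] sym'[of _ "w2 p" "w1 p"])
  have X02: "XF F (?b w0 w2) p = - XF F ?q p" if "p \<in> U" for p
    using XF_cong[OF that b02] XF_rules(5)[OF that] by (simp add: sm_w sm_B)
  \<comment> \<open>The derivative of B(w_0, w_2) is F_2 q - B(w_0, w_1) by the frame system and 2
    B(w_0, w_1) by the preceding identities; this is the origin of 1/3.\<close>
  have b01: "?b w0 w1 p = 1/3 * d2 F p * ?q p" if "p \<in> U" for p
    using X02[OF that] that null[OF that] b02[OF that] Xq[OF that] by (simp add: X)
  have Xq': "XF F ?q p = - 2/3 * d2 F p * ?q p" if "p \<in> U" for p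
    using Xq[OF that] b01[OF that] by simp
  have X01: "XF F (?b w0 w1) p = 1/3 * (XF F (d2 F) p * ?q p + d2 F p * XF F ?q p)" if "p \<in> U" for p
    using XF_cong[OF that b01] by (simp add: XF_rules[OF that] sm_all sm_w sm_B)
  have b00: "?b w0 w0 p = gram00 p * ?q p" if "p \<in> U" for p
    using X01[OF that] that b02[OF that] b12[OF that] Xq'[OF that]
    by (simp add: X sym'[of _ "w2 p" "w1 p"] gram00_def field_simps power2_eq_square)
  have "XF F (?b w0 w0) p = XF F gram00 p * ?q p + gram00 p * XF F ?q p"
    using XF_cong[OF p b00] by (simp add: XF_rules[OF p] sm_gram00 sm_all sm_w sm_B)
  then have "2 * d0 F p * ?q p = XF F gram00 p * ?q p + gram00 p * XF F ?q p"
    using p b02[OF p] by (simp add: X sym'[of _ "w2 p" "w0 p"])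
  then have "2 * W0 F p * ?q p = 0"
    unfolding two_W0_eq[OF p] Xq'[OF p] by (simp add: field_simps)
  then show "?q p * W0 F p = 0" by auto
  show "?b w1 w2 p = 0" "?b w0 w2 p = - ?q p" "?b w0 w1 p = 1/3 * d2 F p * ?q p"
    "?b w0 w0 p = gram00 p * ?q p" "XF F ?q p = - 2/3 * d2 F p * ?q p"
    using b12 b02 b01 b00 Xq' p by auto
qed

end

end

section \<open>Metrics, connections and curvature in coordinates\<close>

lemma bilinear_met: "bilinear (met h y)"
  by (auto simp: met_def bilinear_def linear_iff inner_add_left matrix_vector_right_distrib
      inner_add_right matrix_vector_mult_scaleR)

lemma smooth_on_met:
  assumes "open S" "smooth_on S h"
  shows "smooth_on S (\<lambda>y. met h y u v)"
proof -
  have "linear (\<lambda>A :: real^3^3. u \<bullet> (A *v v))"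
    by (auto simp: linear_iff inner_add_right matrix_vector_mult_add_rdistrib scaleR_matrix_vector_assoc[symmetric])
  then show ?thesis
    unfolding met_def using smooth_on_bounded_linear[OF assms(1) _ assms(2)]
    by (simp add: linear_conv_bounded_linear)
qed

lemma met_sym: "transpose (h y) = h y \<Longrightarrow> met h y u v = met h y v u"
  unfolding met_def by (metis dot_lmul_matrix inner_commute transpose_matrix_vector)

lemma cov_const: "cov \<Gamma> (\<lambda>_. u) (\<lambda>_. v) y = \<Gamma> y u v"
  by (simp add: cov_def deriv_along_def)

lemma torsion_const: "torsion \<Gamma> (\<lambda>_. u) (\<lambda>_. v) y = \<Gamma> y u v - \<Gamma> y v u"
  by (simp add: torsion_def cov_const lie_bracket_def deriv_along_def)

lemma cov_metric_const:
  "cov_metric \<Gamma> h (\<lambda>_. u) (\<lambda>_. v) (\<lambda>_. w) y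
     = FD (\<lambda>z. met h z v w) y u - met h y (\<Gamma> y u v) w - met h y v (\<Gamma> y u w)"
  by (simp add: cov_metric_def cov_const deriv_along_def)

locale smooth_connection =
  fixes M :: "(real^3) set" and \<Gamma> :: connection
  assumes open_base: "open M" and con: "connection_on M \<Gamma>"
begin

lemma bil_\<Gamma>: "y \<in> M \<Longrightarrow> bilinear (\<Gamma> y)" and sm_\<Gamma>: "smooth_on M (\<lambda>y. \<Gamma> y u v)"
  using con by (auto simp: connection_on_def)

lemma \<Gamma>_lin:
  assumes "y \<in> M"
  shows "\<Gamma> y (u + v) w = \<Gamma> y u w + \<Gamma> y v w" "\<Gamma> y (c *\<^sub>R u) w = c *\<^sub>R \<Gamma> y u w" "\<Gamma> y 0 w = 0"
    "\<Gamma> y w (u + v) = \<Gamma> y w u + \<Gamma> y w v" "\<Gamma> y w (c *\<^sub>R u) = c *\<^sub>R \<Gamma> y w u"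
    "\<Gamma> y w (u - v) = \<Gamma> y w u - \<Gamma> y w v"
  using bilinear_ladd[OF bil_\<Gamma>[OF assms]] bilinear_lmul[OF bil_\<Gamma>[OF assms]]
    bilinear_lzero[OF bil_\<Gamma>[OF assms]] bilinear_radd[OF bil_\<Gamma>[OF assms]]
    bilinear_rmul[OF bil_\<Gamma>[OF assms]] bilinear_rsub[OF bil_\<Gamma>[OF assms]] by auto

definition curv :: "real^3 \<Rightarrow> real^3 \<Rightarrow> real^3 \<Rightarrow> real^3 \<Rightarrow> real^3" where
  "curv y a b c = FD (\<lambda>z. \<Gamma> z b c) y a + \<Gamma> y a (\<Gamma> y b c) - FD (\<lambda>z. \<Gamma> z a c) y b - \<Gamma> y b (\<Gamma> y a c)"

lemma curvature_const:
  assumes "y \<in> M"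
  shows "curvature \<Gamma> (\<lambda>_. a) (\<lambda>_. b) (\<lambda>_. c) y = curv y a b c"
proof -
  have "lie_bracket (\<lambda>_. a) (\<lambda>_. b) = (\<lambda>_. 0)"
    by (simp add: fun_eq_iff lie_bracket_def deriv_along_def)
  then have "curvature \<Gamma> (\<lambda>_. a) (\<lambda>_. b) (\<lambda>_. c) y
    = cov \<Gamma> (\<lambda>_. a) (\<lambda>z. \<Gamma> z b c) y - cov \<Gamma> (\<lambda>_. b) (\<lambda>z. \<Gamma> z a c) y - cov \<Gamma> (\<lambda>_. 0) (\<lambda>_. c) y"
    unfolding curvature_def by (simp add: cov_const[abs_def])
  then show ?thesis
    by (simp add: cov_const \<Gamma>_lin[OF assms]) (simp add: cov_def deriv_along_def curv_def)
qed

lemma FD_\<Gamma>_lin: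
  assumes y: "y \<in> M"
  shows "FD (\<lambda>z. \<Gamma> z (u + v) w) y a = FD (\<lambda>z. \<Gamma> z u w) y a + FD (\<lambda>z. \<Gamma> z v w) y a"
    "FD (\<lambda>z. \<Gamma> z (k *\<^sub>R u) w) y a = k *\<^sub>R FD (\<lambda>z. \<Gamma> z u w) y a"
    "FD (\<lambda>z. \<Gamma> z w (u + v)) y a = FD (\<lambda>z. \<Gamma> z w u) y a + FD (\<lambda>z. \<Gamma> z w v) y a"
    "FD (\<lambda>z. \<Gamma> z w (k *\<^sub>R u)) y a = k *\<^sub>R FD (\<lambda>z. \<Gamma> z w u) y a"
proof -
  note d = smooth_on_differentiable[OF sm_\<Gamma> y]
  show "FD (\<lambda>z. \<Gamma> z (u + v) w) y a = FD (\<lambda>z. \<Gamma> z u w) y a + FD (\<lambda>z. \<Gamma> z v w) y a"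
    by (subst FD_cong[OF open_base y \<Gamma>_lin(1)]) (simp_all add: FD_add d)
  show "FD (\<lambda>z. \<Gamma> z (k *\<^sub>R u) w) y a = k *\<^sub>R FD (\<lambda>z. \<Gamma> z u w) y a"
    by (subst FD_cong[OF open_base y \<Gamma>_lin(2)]) (simp_all add: FD_scaleR d)
  show "FD (\<lambda>z. \<Gamma> z w (u + v)) y a = FD (\<lambda>z. \<Gamma> z w u) y a + FD (\<lambda>z. \<Gamma> z w v) y a"
    by (subst FD_cong[OF open_base y \<Gamma>_lin(4)]) (simp_all add: FD_add d)
  show "FD (\<lambda>z. \<Gamma> z w (k *\<^sub>R u)) y a = k *\<^sub>R FD (\<lambda>z. \<Gamma> z w u) y a"
    by (subst FD_cong[OF open_base y \<Gamma>_lin(5)]) (simp_all add: FD_scaleR d)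
qed

lemma linear_curv:
  assumes y: "y \<in> M"
  shows "linear (\<lambda>a. curv y a b c)" "linear (\<lambda>b. curv y a b c)" "linear (\<lambda>c. curv y a b c)"
proof -
  have l: "linear (FD (\<lambda>z. \<Gamma> z u v) y)" for u v
    by (rule smooth_on_linear_FD[OF sm_\<Gamma> y])
  show "linear (\<lambda>a. curv y a b c)" "linear (\<lambda>b. curv y a b c)" "linear (\<lambda>c. curv y a b c)"
    by (auto simp: linear_iff curv_def \<Gamma>_lin[OF y] FD_\<Gamma>_lin[OF y] linear_add[OF l] linear_cmul[OF l]
        algebra_simps)
qed

lemma curv_self: "curv y a a c = 0"
  by (simp add: curv_def)

lemma smooth_on_curv: "smooth_on M (\<lambda>y. curv y a b c)"
  unfolding curv_def
  by (intro smooth_on_add smooth_on_diff smooth_on_FD_const sm_\<Gamma> open_base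
      smooth_on_bilinear_field[OF open_base _ open_base bil_\<Gamma> sm_\<Gamma>, where f = "\<lambda>y. y"]
      smooth_on_ident smooth_on_const) auto

lemma ricci_eq: "y \<in> M \<Longrightarrow> ricci \<Gamma> y v w = (\<Sum>b\<in>Basis. curv y b v w \<bullet> b)"
  by (simp add: ricci_def curvature_const)

lemma bilinear_ricci_sym: "y \<in> M \<Longrightarrow> bilinear (ricci_sym \<Gamma> y)"
  unfolding ricci_sym_def[abs_def] bilinear_def
  by (auto simp: ricci_eq linear_iff linear_add[OF linear_curv(2)] linear_cmul[OF linear_curv(2)]
      linear_add[OF linear_curv(3)] linear_cmul[OF linear_curv(3)] inner_add_left sum.distrib
      sum_distrib_left[symmetric] field_simps)

lemma smooth_on_ricci_sym: "smooth_on M (\<lambda>y. ricci_sym \<Gamma> y v w)"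
proof -
  have "smooth_on M (\<lambda>y. (\<Sum>b\<in>Basis. curv y b v w \<bullet> b) * (1/2) + (\<Sum>b\<in>Basis. curv y b w v \<bullet> b) * (1/2))"
    by (intro smooth_on_intros open_base smooth_on_curv)
  then show ?thesis
    by (subst smooth_on_cong[OF open_base]) (auto simp: ricci_sym_def ricci_eq field_simps)
qed

lemma ricci_sym_commute: "ricci_sym \<Gamma> y v w = ricci_sym \<Gamma> y w v"
  by (simp add: ricci_sym_def)

end

text \<open>Total geodesy as a condition at one jet. The distribution is spanned by constant fields
  and its leaves lie in affine planes, so constant \<open>a\<close> and \<open>b\<close> are enough
  as test fields.\<close>

definition D2_geodesic :: "(jet \<Rightarrow> real^3) \<Rightarrow> connection \<Rightarrow> jet \<Rightarrow> bool" where
  "D2_geodesic \<psi> \<Gamma> p \<longleftrightarrow> (\<forall>a\<in>span {e2, e1}. \<forall>b\<in>span {e2, e1}.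
     FD (\<lambda>q. FD \<psi> q b) p a + \<Gamma> (\<psi> p) (FD \<psi> p a) (FD \<psi> p b) \<in> FD \<psi> p ` span {e2, e1})"

text \<open>The common setting of both directions: data extracted from a given Einstein-Weyl
  structure, or data constructed from \<open>F\<close>. The Einstein-Weyl equation is not part of
  it. The assumption \<open>weyl\<close> says that the covariant derivative of \<open>h\<close> is
  \<open>\<phi>\<close> times \<open>h\<close>, solved for the partial derivatives of
  \<open>h\<close>.\<close>

locale weyl_chart = chart +
  fixes h :: metric and \<Gamma> :: connection and \<phi> :: "real^3 \<Rightarrow> real^3 \<Rightarrow> real"
  assumes con_\<Gamma>: "connection_on (\<psi> ` U) \<Gamma>"
    and \<Gamma>_sym: "y \<in> \<psi> ` U \<Longrightarrow> \<Gamma> y u v = \<Gamma> y v u"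
    and h_smooth: "smooth_on (\<psi> ` U) h"
    and h_sym: "y \<in> \<psi> ` U \<Longrightarrow> transpose (h y) = h y"
    and h_nondegenerate: "y \<in> \<psi> ` U \<Longrightarrow> (\<And>v. met h y u v = 0) \<Longrightarrow> u = 0"
    and \<phi>_form: "one_form_on (\<psi> ` U) \<phi>"
    and weyl: "y \<in> \<psi> ` U \<Longrightarrow> FD (\<lambda>z. met h z v w) y u
        = met h y (\<Gamma> y u v) w + met h y v (\<Gamma> y u w) + \<phi> y u * met h y v w"
    and null: "p \<in> U \<Longrightarrow> met h (\<psi> p) (w2 p) (w2 p) = 0"
begin

sublocale smooth_connection M \<Gamma>
  by unfold_locales (rule open_M con_\<Gamma>)+

abbreviation H :: "(jet \<Rightarrow> real^3) \<Rightarrow> (jet \<Rightarrow> real^3) \<Rightarrow> jet \<Rightarrow> real" where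
  "H a b p \<equiv> met h (\<psi> p) (a p) (b p)"

lemma met_symmetric: "\<forall>y\<in>M. \<forall>u v. met h y u v = met h y v u"
  using met_sym[of h] h_sym by blast

lemma met_commute: "p \<in> U \<Longrightarrow> met h (\<psi> p) u v = met h (\<psi> p) v u"
  using met_symmetric by blast

lemma bilinear_met_M: "\<forall>y\<in>M. bilinear (met h y)"
  by (simp add: bilinear_met)

lemma null_w2: "\<forall>p\<in>U. met h (\<psi> p) (w2 p) (w2 p) = 0"
  using null by blast

lemmas met_M = bilinear_met_M smooth_on_met[OF open_M h_smooth]

lemma \<psi>_in_M: "p \<in> U \<Longrightarrow> \<psi> p \<in> M" by simp

lemma null_form_H:
  assumes "p \<in> U"
  shows "met h (\<psi> p) (w1 p) (w2 p) = 0"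
    and "met h (\<psi> p) (w0 p) (w2 p) = - met h (\<psi> p) (w1 p) (w1 p)"
    and "met h (\<psi> p) (w0 p) (w1 p) = 1/3 * d2 F p * met h (\<psi> p) (w1 p) (w1 p)"
    and "met h (\<psi> p) (w0 p) (w0 p) = gram00 p * met h (\<psi> p) (w1 p) (w1 p)"
    and "XF F (\<lambda>p. met h (\<psi> p) (w1 p) (w1 p)) p = - 2/3 * d2 F p * met h (\<psi> p) (w1 p) (w1 p)"
    and "met h (\<psi> p) (w1 p) (w1 p) * W0 F p = 0"
  by (rule null_form[of "met h", OF met_M met_symmetric null_w2 assms])+

definition q :: "jet \<Rightarrow> real" where "q p = H w1 w1 p"

lemma sm_H: "sm a \<Longrightarrow> sm b \<Longrightarrow> sm (H a b)"
  by (rule sm_B[of "met h", OF met_M])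

lemmas H_lin = B_lincomb[of "met h", OF met_M]

lemma sm_q: "sm q" unfolding q_def[abs_def] by (intro sm_H sm_w)

lemma H_frame:
  assumes p: "p \<in> U"
  shows "met h (\<psi> p) (w2 p) (w2 p) = 0" "met h (\<psi> p) (w1 p) (w2 p) = 0" "met h (\<psi> p) (w2 p) (w1 p) = 0"
    "met h (\<psi> p) (w0 p) (w2 p) = - q p" "met h (\<psi> p) (w2 p) (w0 p) = - q p"
    "met h (\<psi> p) (w1 p) (w1 p) = q p"
  using null_form_H(1,2)[OF p] null[OF p] met_commute[OF p, of "w2 p" "w1 p"]
    met_commute[OF p, of "w2 p" "w0 p"]
  by (simp_all add: q_def)

text \<open>Otherwise w_2 would be orthogonal to the whole frame, against non-degeneracy.\<close>

lemma q_nonzero: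
  assumes p: "p \<in> U"
  shows "q p \<noteq> 0"
proof
  assume q: "q p = 0"
  have "met h (\<psi> p) (w2 p) v = 0" for v
    by (subst frame_expansion[OF p, of v]) (simp add: H_lin[OF p] H_frame[OF p] q)
  then have "w2 p = 0" using h_nondegenerate[OF \<psi>_in_M[OF p]] by blast
  then show False using \<theta>_w(9)[OF p] linear_0[OF linear_\<theta>(3)] by simp
qed

lemma W0_zero: "p \<in> U \<Longrightarrow> W0 F p = 0"
  using null_form_H(6)[of p] q_nonzero[of p] by (simp add: q_def)

text \<open>In the null frame w_2 pairs with w_0 alone, and its orthogonal complement is spanned by
  w_1 modulo w_2; so the first two coframe elements can be read off from the metric.\<close>

lemma \<theta>_from_H:
  assumes p: "p \<in> U"
  shows "met h (\<psi> p) z (w2 p) = - q p * \<theta>0 p z"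
    and "met h (\<psi> p) z (w2 p) = 0 \<Longrightarrow> met h (\<psi> p) z (w1 p) = q p * \<theta>1 p z"
proof -
  show *: "met h (\<psi> p) z (w2 p) = - q p * \<theta>0 p z" for z
    by (subst frame_expansion[OF p, of z]) (simp add: H_lin[OF p] H_frame[OF p])
  assume "met h (\<psi> p) z (w2 p) = 0"
  then have "\<theta>0 p z = 0" using *[of z] q_nonzero[OF p] by simp
  then show "met h (\<psi> p) z (w1 p) = q p * \<theta>1 p z"
    by (subst frame_expansion[OF p, of z]) (simp add: H_lin[OF p] H_frame[OF p])
qed

text \<open>The connection pulled back along \<open>\<psi>\<close>, acting on vector fields along
  \<open>\<psi>\<close> in a fixed jet direction \<open>v\<close>. It avoids extending the w_i to
  fields on the solution space.\<close>

definition nab :: "jet \<Rightarrow> (jet \<Rightarrow> real^3) \<Rightarrow> jet \<Rightarrow> real^3" where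
  "nab v w p = FD w p v + \<Gamma> (\<psi> p) (FD \<psi> p v) (w p)"

lemma sm_nab:
  assumes "sm w"
  shows "sm (nab v w)"
  unfolding nab_def[abs_def]
  by (intro sm_intros smooth_on_FD_const assms
      smooth_on_bilinear_field[OF open_U subset_refl open_M bil_\<Gamma> sm_\<Gamma> sm_\<psi>] sm_\<psi>)

lemma nab_commute:
  assumes p: "p \<in> U"
  shows "nab u (\<lambda>q. FD \<psi> q v) p = nab v (\<lambda>q. FD \<psi> q u) p"
  unfolding nab_def using \<Gamma>_sym[OF \<psi>_in_M[OF p]] FD_FD_commute[OF open_U sm_\<psi> p] by metis

text \<open>Constant jet directions commute, so the commutator of the pulled back derivatives has no
  bracket term.\<close>

lemma nab_curv:
  assumes p: "p \<in> U" and w: "sm w"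
  shows "nab u (nab v w) p - nab v (nab u w) p = curv (\<psi> p) (FD \<psi> p u) (FD \<psi> p v) (w p)"
proof -
  have d: "\<psi> differentiable (at p)" "w differentiable (at p)"
    "(\<lambda>q. FD \<psi> q v) differentiable (at p)" "(\<lambda>q. FD w q v) differentiable (at p)" for v
    using smooth_on_differentiable[OF sm_\<psi> p] smooth_on_differentiable[OF w p]
      smooth_on_differentiable[OF smooth_on_FD_const[OF sm_\<psi>] p]
      smooth_on_differentiable[OF smooth_on_FD_const[OF w] p] by blast+
  have "sm (\<lambda>q. \<Gamma> (\<psi> q) (FD \<psi> q v) (w q))" for v
    by (rule smooth_on_bilinear_field[OF open_U subset_refl open_M bil_\<Gamma> sm_\<Gamma> sm_\<psi>
          smooth_on_FD_const[OF sm_\<psi>] w])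
  note d = d smooth_on_differentiable[OF this p]
  have *: "nab u (nab v w) p = FD (\<lambda>q. FD w q v) p u
     + (FD (\<lambda>y. \<Gamma> y (FD \<psi> p v) (w p)) (\<psi> p) (FD \<psi> p u)
        + \<Gamma> (\<psi> p) (FD (\<lambda>q. FD \<psi> q v) p u) (w p) + \<Gamma> (\<psi> p) (FD \<psi> p v) (FD w p u))
     + (\<Gamma> (\<psi> p) (FD \<psi> p u) (FD w p v) + \<Gamma> (\<psi> p) (FD \<psi> p u) (\<Gamma> (\<psi> p) (FD \<psi> p v) (w p)))" for u v
  proof -
    have "nab v w = (\<lambda>q. FD w q v + \<Gamma> (\<psi> q) (FD \<psi> q v) (w q))" for v
      by (simp add: fun_eq_iff nab_def)
    then have "FD (nab v w) p u = FD (\<lambda>q. FD w q v) p u + FD (\<lambda>q. \<Gamma> (\<psi> q) (FD \<psi> q v) (w q)) p u"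
      using FD_add[OF d(4,5)] by simp
    also have "FD (\<lambda>q. \<Gamma> (\<psi> q) (FD \<psi> q v) (w q)) p u
      = FD (\<lambda>y. \<Gamma> y (FD \<psi> p v) (w p)) (\<psi> p) (FD \<psi> p u)
        + \<Gamma> (\<psi> p) (FD (\<lambda>q. FD \<psi> q v) p u) (w p) + \<Gamma> (\<psi> p) (FD \<psi> p v) (FD w p u)"
      by (rule FD_bilinear_field[OF open_U subset_refl open_M bil_\<Gamma> sm_\<Gamma> p d(1,3,2)])
    finally have D: "FD (nab v w) p u = FD (\<lambda>q. FD w q v) p u
      + (FD (\<lambda>y. \<Gamma> y (FD \<psi> p v) (w p)) (\<psi> p) (FD \<psi> p u)
        + \<Gamma> (\<psi> p) (FD (\<lambda>q. FD \<psi> q v) p u) (w p) + \<Gamma> (\<psi> p) (FD \<psi> p v) (FD w p u))" .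
    show ?thesis
      unfolding nab_def[of u "nab v w" p] D unfolding nab_def
      by (simp add: \<Gamma>_lin[OF \<psi>_in_M[OF p]])
  qed
  show ?thesis
    unfolding * curv_def FD_FD_commute[OF open_U sm_\<psi> p, of u v] FD_FD_commute[OF open_U w p, of u v]
    by (simp add: algebra_simps)
qed

lemma FD_H:
  assumes p: "p \<in> U" and s: "sm a" "sm b"
  shows "FD (H a b) p v = H (nab v a) b p + H a (nab v b) p + \<phi> (\<psi> p) (FD \<psi> p v) * H a b p"
  unfolding FD_B[of "met h", OF met_M p s] weyl[OF \<psi>_in_M[OF p]] nab_def
  by (simp add: H_lin[OF p])

lemma FD_H_orthogonal:
  assumes p: "p \<in> U" and s: "sm a" "sm b" and 0: "\<And>p. p \<in> U \<Longrightarrow> H a b p = 0"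
  shows "H (nab v a) b p + H a (nab v b) p = 0"
proof -
  have "FD (H a b) p v = 0"
    by (subst FD_cong[OF open_U p, where g = "\<lambda>_. 0"]) (simp_all add: 0)
  then show ?thesis using FD_H[OF p s] 0[OF p] by simp
qed

text \<open>For a Weyl connection the curvature is skew only up to the exterior derivative of
  \<open>\<phi>\<close> times \<open>H a b\<close>. For fields that stay orthogonal this term is
  absent.\<close>

lemma curv_skew:
  assumes p: "p \<in> U" and s: "sm a" "sm b" and 0: "\<And>p. p \<in> U \<Longrightarrow> H a b p = 0"
  shows "met h (\<psi> p) (curv (\<psi> p) (FD \<psi> p u) (FD \<psi> p v) (a p)) (b p)
     + met h (\<psi> p) (a p) (curv (\<psi> p) (FD \<psi> p u) (FD \<psi> p v) (b p)) = 0"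
proof -
  have "H (nab u (nab v a)) b p + H (nab v a) (nab u b) p
     + H (nab u a) (nab v b) p + H a (nab u (nab v b)) p = 0" for u v
  proof -
    have "FD (\<lambda>p. H (nab v a) b p + H a (nab v b) p) p u = 0"
      by (subst FD_cong[OF open_U p, where g = "\<lambda>_. 0"]) (simp_all add: FD_H_orthogonal[OF _ s 0])
    moreover have z: "\<phi> (\<psi> p) (FD \<psi> p u) * H (nab v a) b p + \<phi> (\<psi> p) (FD \<psi> p u) * H a (nab v b) p = 0"
      using FD_H_orthogonal[OF p s 0, of v] by (simp flip: distrib_left)
    ultimately have "FD (H (nab v a) b) p u + FD (H a (nab v b)) p u = 0"
      by (simp add: FD_add smooth_on_differentiable[OF sm_H p] s sm_nab)
    then show ?thesis
      unfolding FD_H[OF p sm_nab[OF s(1)] s(2)] FD_H[OF p s(1) sm_nab[OF s(2)]]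
      using z by linarith
  qed
  from this[of u v] this[of v u] show ?thesis
    by (simp add: H_lin[OF p] flip: nab_curv[OF p s(1)] nab_curv[OF p s(2)])
qed

text \<open>Derivatives of the Gram entries H(w_2, w_2) = H(w_1, w_2) = 0 and H(w_1, w_1) =
  \<open>q\<close>, with torsion-freeness exchanging the mixed derivatives. Of the normal components
  only that of \<open>nab e1 w1\<close> does not vanish automatically; it is governed by
  \<partial>_2 \<open>q\<close> - \<open>\<phi>\<close>(w_2) \<open>q\<close>.\<close>

lemma nab_w:
  assumes p: "p \<in> U"
  shows "nab e2 w1 p = nab e1 w2 p"
    and "H (nab e1 w2) w2 p = 0" "H (nab e2 w2) w2 p = 0"
    and "H (nab e1 w1) w2 p = - H (nab e1 w2) w1 p"
    and "H (nab e2 w2) w1 p = 0"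
    and "2 * H (nab e1 w2) w1 p = d2 q p - \<phi> (\<psi> p) (w2 p) * q p"
proof -
  show sym: "nab e2 w1 p = nab e1 w2 p"
    unfolding w1_def[abs_def] w2_def[abs_def] by (rule nab_commute[OF p])
  show n12: "H (nab e1 w2) w2 p = 0" and "H (nab e2 w2) w2 p = 0"
    using FD_H_orthogonal[OF p sm_w(3) sm_w(3) null, of e1] FD_H_orthogonal[OF p sm_w(3) sm_w(3) null, of e2]
    by (simp_all add: met_commute[OF p, of "w2 p"])
  show "H (nab e1 w1) w2 p = - H (nab e1 w2) w1 p"
    using FD_H_orthogonal[OF p sm_w(2) sm_w(3) H_frame(2), of e1]
    by (simp add: met_commute[OF p, of "w1 p"])
  show "H (nab e2 w2) w1 p = 0"
    using FD_H_orthogonal[OF p sm_w(2) sm_w(3) H_frame(2), of e2] n12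
    by (simp add: met_commute[OF p, of "w1 p"] sym)
  show "2 * H (nab e1 w2) w1 p = d2 q p - \<phi> (\<psi> p) (w2 p) * q p"
    using FD_H[OF p sm_w(2) sm_w(2), of e2]
    by (simp add: met_commute[OF p, of "w1 p"] sym FD_d w2_def flip: q_def)
qed

text \<open>The plane spanned by w_1 and w_2 is the orthogonal complement of its own null direction
  w_2, so tangency is one scalar equation.\<close>

lemma image_D2:
  assumes p: "p \<in> U"
  shows "z \<in> FD \<psi> p ` span {e2, e1} \<longleftrightarrow> met h (\<psi> p) z (w2 p) = 0"
proof -
  have "FD \<psi> p ` span {e2, e1} = span {w2 p, w1 p}"
    using linear_span_image[OF smooth_on_linear_FD[OF sm_\<psi> p], of "{e2, e1}"]
    by (simp add: w1_def w2_def)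
  also have "z \<in> \<dots> \<longleftrightarrow> met h (\<psi> p) z (w2 p) = 0"
  proof
    assume "z \<in> span {w2 p, w1 p}"
    then obtain a b where "z = a *\<^sub>R w2 p + b *\<^sub>R w1 p"
      by (auto simp: span_insert span_singleton algebra_simps)
    then show "met h (\<psi> p) z (w2 p) = 0" by (simp add: H_lin[OF p] H_frame[OF p])
  next
    assume "met h (\<psi> p) z (w2 p) = 0"
    then have "\<theta>0 p z = 0" using \<theta>_from_H(1)[OF p, of z] q_nonzero[OF p] by simp
    then have "z = \<theta>1 p z *\<^sub>R w1 p + \<theta>2 p z *\<^sub>R w2 p"
      using frame_expansion[OF p, of z] by simp
    then show "z \<in> span {w2 p, w1 p}"
      by (subst \<open>z = _\<close>) (intro span_add span_scale span_base; simp)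
  qed
  finally show ?thesis .
qed

text \<open>The product of \<open>N\<close> with w_2 is a symmetric bilinear form on the plane, the
  second fundamental form; by \<open>nab_w\<close> all its entries vanish except possibly the one at
  (\<open>e1\<close>, \<open>e1\<close>).\<close>

lemma D2_geodesic_iff:
  assumes p: "p \<in> U"
  shows "D2_geodesic \<psi> \<Gamma> p \<longleftrightarrow> \<phi> (\<psi> p) (w2 p) * q p = d2 q p"
proof -
  define N where "N a b = nab a (\<lambda>q. FD \<psi> q b) p" for a b
  have N: "D2_geodesic \<psi> \<Gamma> p \<longleftrightarrow>
      (\<forall>a\<in>span {e2, e1}. \<forall>b\<in>span {e2, e1}. met h (\<psi> p) (N a b) (w2 p) = 0)"
    unfolding D2_geodesic_def image_D2[OF p] N_def nab_def ..
  have Nw: "N e1 e1 = nab e1 w1 p" "N e1 e2 = nab e1 w2 p" "N e2 e1 = nab e2 w1 p" "N e2 e2 = nab e2 w2 p"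
    unfolding N_def w1_def[abs_def] w2_def[abs_def] by auto
  show ?thesis
  proof
    assume "D2_geodesic \<psi> \<Gamma> p"
    then have "met h (\<psi> p) (N e1 e1) (w2 p) = 0" unfolding N by (simp add: span_base)
    then show "\<phi> (\<psi> p) (w2 p) * q p = d2 q p" using nab_w[OF p] by (simp add: Nw)
  next
    assume "\<phi> (\<psi> p) (w2 p) * q p = d2 q p"
    then have 0: "met h (\<psi> p) (N a b) (w2 p) = 0" if "a \<in> {e2, e1}" "b \<in> {e2, e1}" for a b
      using nab_w[OF p] that by (auto simp: Nw)
    have Nsym: "N a b = N b a" for a b unfolding N_def by (rule nab_commute[OF p])
    have Nlin: "linear (\<lambda>a. met h (\<psi> p) (N a b) (w2 p))" for b
      by (auto simp: linear_iff N_def nab_def H_lin[OF p] FD_lincomb[OF p] sm_\<psi> smooth_on_FD_const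
          \<Gamma>_lin[OF \<psi>_in_M[OF p]] algebra_simps)
    have 1: "met h (\<psi> p) (N a b) (w2 p) = 0" if "a \<in> span {e2, e1}" "b \<in> {e2, e1}" for a b
      using linear_eq_0_on_span[OF Nlin 0, of "{e2, e1}" b a] that by auto
    have "met h (\<psi> p) (N a b) (w2 p) = 0" if "a \<in> span {e2, e1}" "b \<in> span {e2, e1}" for a b
      using linear_eq_0_on_span[OF Nlin, of "{e2, e1}" b a] 1[OF that(2)] that by (simp add: Nsym)
    then show "D2_geodesic \<psi> \<Gamma> p" unfolding N by blast
  qed
qed

end

lemma matrix_inv_mult:
  fixes A :: "real^'n^'n"
  assumes "invertible A"
  shows "matrix_inv A ** A = mat 1" "A ** matrix_inv A = mat 1"
  using someI_ex[OF assms[unfolded invertible_def]] by (simp_all add: matrix_inv_def)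

lemma met_axis: "met h y (axis i 1) (axis j 1) = h y $ i $ j"
  unfolding met_def matrix_vector_mult_basis by (simp add: inner_axis' column_def)

text \<open>The inverse metric is symmetric and therefore sees only the symmetric part of the Ricci
  tensor; the trace of the metric itself is 3.\<close>

lemma scalar_curvature_eq:
  assumes inv: "invertible (h y)" and sym: "transpose (h y) = h y"
    and ric: "\<And>v w. ricci_sym \<Gamma> y v w = k * met h y v w"
  shows "scalar_curvature h \<Gamma> y = 3 * k"
proof -
  define g where "g = matrix_inv (h y)"
  have gh: "g ** h y = mat 1" "h y ** g = mat 1" 
    by (simp_all add: g_def matrix_inv_mult[OF inv])
  have "transpose g = transpose g ** (h y ** g)" by (simp add: gh)
  also have "\<dots> = transpose (h y ** g) ** g"
    by (simp add: matrix_transpose_mul sym matrix_mul_assoc)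
  also have "\<dots> = g" by (simp add: gh)
  finally have "transpose g $ i $ j = g $ i $ j" for i j by simp
  then have gs: "g $ i $ j = g $ j $ i" for i j
    by (simp add: transpose_def)
  let ?r = "\<lambda>i j. ricci \<Gamma> y (axis i 1) (axis j 1)"
  have "scalar_curvature h \<Gamma> y = (\<Sum>i\<in>UNIV. \<Sum>j\<in>UNIV. g $ i $ j * ?r i j)"
    by (simp add: scalar_curvature_def g_def)
  moreover have "(\<Sum>i\<in>UNIV. \<Sum>j\<in>UNIV. g $ i $ j * ?r i j) = (\<Sum>i\<in>UNIV. \<Sum>j\<in>UNIV. g $ i $ j * ?r j i)"
    by (subst sum.swap) (simp add: gs)
  ultimately have "2 * scalar_curvature h \<Gamma> y = (\<Sum>i\<in>UNIV. \<Sum>j\<in>UNIV. g $ i $ j * (?r i j + ?r j i))"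
    by (simp add: sum.distrib distrib_left)
  also have "\<dots> = (\<Sum>i\<in>UNIV. \<Sum>j\<in>UNIV. g $ i $ j * (2 * k * h y $ j $ i))"
  proof (intro sum.cong refl)
    fix i j :: 3
    have "?r i j + ?r j i = 2 * ricci_sym \<Gamma> y (axis j 1) (axis i 1)"
      by (simp add: ricci_sym_def)
    then show "g $ i $ j * (?r i j + ?r j i) = g $ i $ j * (2 * k * h y $ j $ i)"
      by (simp add: ric met_axis)
  qed
  also have "\<dots> = 2 * k * (\<Sum>i\<in>UNIV. (g ** h y) $ i $ i)"
    by (simp add: matrix_matrix_mult_def sum_distrib_left mult_ac)
  also have "\<dots> = 2 * k * 3" by (simp add: gh mat_def)
  finally show ?thesis by simp
qed

context ode begin

lemma d_cong:
  assumes "p \<in> U" "\<And>q. q \<in> U \<Longrightarrow> f q = g q"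
  shows "d0 f p = d0 g p" "d1 f p = d1 g p" "d2 f p = d2 g p"
  unfolding d0_def d1_def d2_def by (rule deriv_along_cong[OF open_U assms]; assumption)+

end

section \<open>The Cartan invariant and the Ricci tensor of a Weyl connection\<close>

context weyl_chart begin

lemma \<phi>_lin_M: "y \<in> M \<Longrightarrow> linear (\<phi> y)"
  by (rule bspec[OF conjunct1[OF \<phi>_form[unfolded one_form_on_def]]])

lemma sm_\<phi>: "smooth_on M (\<lambda>y. \<phi> y u)"
  by (rule spec[OF conjunct2[OF \<phi>_form[unfolded one_form_on_def]]])

lemmas \<phi>_lin = \<phi>_lin_M[OF \<psi>_in_M]

lemma sm_\<phi>_field: "sm a \<Longrightarrow> sm (\<lambda>p. \<phi> (\<psi> p) (a p))"
  by (rule smooth_on_linear_field[where L = \<phi>, OF open_U subset_refl open_M \<phi>_lin_M sm_\<phi> sm_\<psi>])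

lemma XF_\<phi>:
  assumes p: "p \<in> U" and a: "sm a"
  shows "XF F (\<lambda>p. \<phi> (\<psi> p) (a p)) p = \<phi> (\<psi> p) (FD a p (total_field F p))"
proof -
  have "FD (\<lambda>p. \<phi> (\<psi> p) (a p)) p v = FD (\<lambda>y. \<phi> y (a p)) (\<psi> p) (FD \<psi> p v) + \<phi> (\<psi> p) (FD a p v)" for v
    by (rule FD_linear_field[where L = \<phi>, OF open_U subset_refl open_M \<phi>_lin_M sm_\<phi> p
        smooth_on_differentiable[OF sm_\<psi> p] smooth_on_differentiable[OF a p]])
  moreover have "linear (FD (\<lambda>y. \<phi> y (a p)) (\<psi> p))"
    by (rule smooth_on_linear_FD[OF sm_\<phi> \<psi>_in_M[OF p]])
  ultimately show ?thesis
    by (simp add: XF_def deriv_along_def kernel_\<psi>[OF p] linear_0)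
qed

text \<open>With \<open>\<alpha>\<^sub>i = \<phi>(w\<^sub>i)\<close>, differentiating \<open>\<partial>\<^sub>2 q = \<alpha>\<^sub>2 q\<close> along \<open>X\<^sub>F\<close> gives \<open>\<partial>\<^sub>1 q\<close>, then \<open>\<partial>\<^sub>0 q\<close>, and
  the third derivative is a compatibility condition in which only the Cartan invariant is left.\<close>

lemma Cartan_zero:
  assumes geo: "\<And>p. p \<in> U \<Longrightarrow> D2_geodesic \<psi> \<Gamma> p" and p: "p \<in> U"
  shows "Cartan F p = 0"
proof -
  define \<alpha>0 where "\<alpha>0 = (\<lambda>p. \<phi> (\<psi> p) (w0 p))"
  define \<alpha>1 where "\<alpha>1 = (\<lambda>p. \<phi> (\<psi> p) (w1 p))"
  define \<alpha>2 where "\<alpha>2 = (\<lambda>p. \<phi> (\<psi> p) (w2 p))"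
  have sm_\<alpha>: "sm \<alpha>0" "sm \<alpha>1" "sm \<alpha>2"
    unfolding \<alpha>0_def \<alpha>1_def \<alpha>2_def by (intro sm_\<phi>_field sm_w)+
  have X\<alpha>: "XF F \<alpha>2 p = - \<alpha>1 p - d2 F p * \<alpha>2 p" "XF F \<alpha>1 p = - \<alpha>0 p - d1 F p * \<alpha>2 p"
    "XF F \<alpha>0 p = - d0 F p * \<alpha>2 p" if "p \<in> U" for p
    unfolding \<alpha>0_def \<alpha>1_def \<alpha>2_def
    using \<phi>_lin[OF that]
    by (simp_all add: XF_\<phi>[OF that] sm_w X_w[OF that] linear_diff linear_neg linear_cmul)
  note sms = sm_all sm_\<alpha> sm_q
  have Xq: "XF F q p = - 2/3 * (d2 F p * q p)" if "p \<in> U" for p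
    using null_form_H(5)[OF that] unfolding q_def[abs_def] by simp
  have dX: "d0 (XF F q) p = - 2/3 * (d2 F p * d0 q p + d0 (d2 F) p * q p)"
    "d1 (XF F q) p = - 2/3 * (d2 F p * d1 q p + d1 (d2 F) p * q p)"
    "d2 (XF F q) p = - 2/3 * (d2 F p * d2 q p + d2 (d2 F) p * q p)" if "p \<in> U" for p
    using d_cong[OF that, of "XF F q" "\<lambda>p. - 2/3 * (d2 F p * q p)"] Xq
    by (simp_all add: d0_rules[OF that] d1_rules[OF that] d2_rules[OF that] sms)
  have q2: "d2 q p = \<alpha>2 p * q p" if "p \<in> U" for p
    using D2_geodesic_iff[OF that] geo[OF that] by (simp add: \<alpha>2_def)
  have q1: "d1 q p = (\<alpha>1 p - 2/3 * d2 (d2 F) p) * q p" if "p \<in> U" for p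
  proof -
    have "XF F (d2 q) p = \<alpha>2 p * XF F q p + XF F \<alpha>2 p * q p"
      using XF_cong[OF that q2] by (simp add: XF_rules[OF that] sms)
    then show ?thesis
      using d_XF(3)[OF that sm_q] unfolding dX(3)[OF that] Xq[OF that] X\<alpha>(1)[OF that] q2[OF that]
      by (simp add: algebra_simps)
  qed
  have q0: "d0 q p = (\<alpha>0 p + 2/3 * XF F (d2 (d2 F)) p - 2/3 * d1 (d2 F) p) * q p" if "p \<in> U" for p
  proof -
    have "XF F (d1 q) p = (\<alpha>1 p - 2/3 * d2 (d2 F) p) * XF F q p
        + (XF F \<alpha>1 p - 2/3 * XF F (d2 (d2 F)) p) * q p"
      using XF_cong[OF that q1] by (simp add: XF_rules[OF that] sms)
    \<comment> \<open>The derivative \<partial>_0 is recovered from the bracket of \<partial>_1 with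
      X_F.\<close>
    moreover have "d0 q p = d1 (XF F q) p - XF F (d1 q) p - d1 F p * d2 q p"
      using d_XF(2)[OF that sm_q] by simp
    ultimately show ?thesis
      unfolding dX(2)[OF that] Xq[OF that] X\<alpha>(2)[OF that] q2[OF that] q1[OF that]
      by (simp add: field_simps)
  qed
  have Xd0: "XF F (d0 q) p = (\<alpha>0 p + 2/3 * XF F (d2 (d2 F)) p - 2/3 * d1 (d2 F) p) * XF F q p
      + (XF F \<alpha>0 p + 2/3 * XF F (XF F (d2 (d2 F))) p - 2/3 * XF F (d1 (d2 F)) p) * q p"
    using XF_cong[OF p q0] by (simp add: XF_rules[OF p] sms)
  \<comment> \<open>The bracket of \<partial>_0 with X_F brings no new derivative of
    \<open>q\<close>, so it is a condition on the data already found.\<close>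
  have "d0 (XF F q) p - XF F (d0 q) p - d0 F p * d2 q p = 0"
    using d_XF(1)[OF p sm_q] by simp
  then have "Cartan F p * q p = 0"
    unfolding dX(1)[OF p] Xd0 Xq[OF p] X\<alpha>(3)[OF p] q2[OF p] q0[OF p] Cartan_def
    by (simp add: field_simps)
  then show ?thesis using q_nonzero[OF p] by simp
qed

text \<open>The surfaces tangent to \<open>span {\<partial>\<^sub>1, \<partial>\<^sub>2}\<close> are null and totally geodesic, so the curvature
  operator \<open>R(w\<^sub>1, w\<^sub>2)\<close> preserves their tangent planes.\<close>

lemma curv_tangent:
  assumes geo: "\<And>p. p \<in> U \<Longrightarrow> D2_geodesic \<psi> \<Gamma> p" and p: "p \<in> U"
  shows "met h (\<psi> p) (curv (\<psi> p) (w1 p) (w2 p) (w1 p)) (w2 p) = 0"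
proof -
  have n12: "H (nab e1 w2) w1 p = 0" and n11: "H (nab e1 w1) w2 p = 0" if "p \<in> U" for p
    using nab_w[OF that] D2_geodesic_iff[OF that] geo[OF that] by auto
  have n21: "H (nab e2 w1) w2 p = 0" if "p \<in> U" for p
    using nab_w[OF that] by simp
  \<comment> \<open>Such a vector is a multiple of the null direction and hence orthogonal to the
    whole tangent plane; this removes the products of first covariant derivatives below.\<close>
  have multiple: "z = \<theta>2 p z *\<^sub>R w2 p" if "met h (\<psi> p) z (w2 p) = 0" "met h (\<psi> p) z (w1 p) = 0" for z
    using frame_expansion[OF p, of z] \<theta>_from_H[OF p, of z] that q_nonzero[OF p] by simp
  have "H (nab e1 (nab e2 w1)) w2 p + H (nab e2 w1) (nab e1 w2) p = 0"
    by (rule FD_H_orthogonal[OF p sm_nab[OF sm_w(2)] sm_w(3) n21])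
  moreover have "H (nab e2 w1) (nab e1 w2) p = 0"
    using multiple[of "nab e1 w2 p"] nab_w(1,2)[OF p] n12[OF p] H_lin(8)[OF p] by (metis mult_zero_right)
  moreover have "H (nab e2 (nab e1 w1)) w2 p + H (nab e1 w1) (nab e2 w2) p = 0"
    by (rule FD_H_orthogonal[OF p sm_nab[OF sm_w(2)] sm_w(3) n11])
  moreover have "H (nab e1 w1) (nab e2 w2) p = 0"
    using multiple[of "nab e2 w2 p"] nab_w(3,5)[OF p] n11[OF p] H_lin(8)[OF p] by (metis mult_zero_right)
  ultimately have "met h (\<psi> p) (nab e1 (nab e2 w1) p - nab e2 (nab e1 w1) p) (w2 p) = 0"
    by (simp add: H_lin[OF p])
  then show ?thesis
    unfolding nab_curv[OF p sm_w(2)] by (simp add: w1_def w2_def)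
qed

lemma trace_frame:
  assumes p: "p \<in> U" and A: "linear A"
  shows "(\<Sum>b\<in>Basis. A b \<bullet> b) = \<theta>0 p (A (w0 p)) + \<theta>1 p (A (w1 p)) + \<theta>2 p (A (w2 p))"
proof -
  have *: "(\<Sum>b\<in>Basis. \<theta> b * (z \<bullet> b)) = \<theta> z" if "linear \<theta>" for \<theta> :: "real^3 \<Rightarrow> real" and z
    using linear_basis_expansion[OF that, of z] by (simp add: mult.commute)
  have "A b \<bullet> b = \<theta>0 p b * (A (w0 p) \<bullet> b) + \<theta>1 p b * (A (w1 p) \<bullet> b) + \<theta>2 p b * (A (w2 p) \<bullet> b)" for b
    using arg_cong[OF frame_expansion[OF p, of b], of "\<lambda>u. A u \<bullet> b"]
    by (simp add: linear_add[OF A] linear_cmul[OF A] inner_add_left)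
  then show ?thesis
    by (simp add: sum.distrib *[OF linear_\<theta>(1)] *[OF linear_\<theta>(2)] *[OF linear_\<theta>(3)])
qed

lemma frame_eqI:
  assumes p: "p \<in> U" and f: "linear f" and g: "linear g"
    and "f (w0 p) = g (w0 p)" "f (w1 p) = g (w1 p)" "f (w2 p) = g (w2 p)"
  shows "f u = g u"
proof -
  have "f u = \<theta>0 p u *\<^sub>R f (w0 p) + \<theta>1 p u *\<^sub>R f (w1 p) + \<theta>2 p u *\<^sub>R f (w2 p)" if "linear f" for f
    by (subst frame_expansion[OF p, of u]) (simp only: linear_add[OF that] linear_cmul[OF that])
  then show ?thesis using assms by metis
qed

text \<open>In the trace of R(., w_2) w_2 the w_2 term vanishes because R(w_2, w_2) = 0, the w_0
  term because the curvature maps w_2 into its orthogonal complement, and the w_1 term because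
  R(w_1, w_2) preserves the tangent plane and is skew on the orthogonal pair w_1, w_2.\<close>

lemma ricci_null:
  assumes geo: "\<And>p. p \<in> U \<Longrightarrow> D2_geodesic \<psi> \<Gamma> p" and p: "p \<in> U"
  shows "ricci \<Gamma> (\<psi> p) (w2 p) (w2 p) = 0"
proof -
  have k2: "met h (\<psi> p) (curv (\<psi> p) (FD \<psi> p u) (FD \<psi> p v) (w2 p)) (w2 p) = 0" for u v
    using curv_skew[OF p sm_w(3) sm_w(3) null, of u v] by (simp add: met_commute[OF p, of "w2 p"])
  have \<theta>0: "\<theta>0 p (curv (\<psi> p) (FD \<psi> p u) (FD \<psi> p v) (w2 p)) = 0" for u v
    using \<theta>_from_H(1)[OF p] k2[of u v] q_nonzero[OF p] by simp
  have "met h (\<psi> p) (curv (\<psi> p) (w1 p) (w2 p) (w2 p)) (w1 p) = 0"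
    using curv_skew[OF p sm_w(3) sm_w(2) H_frame(3), of e1 e2, folded w1_def w2_def] curv_tangent[OF geo p]
    by (simp add: met_commute[OF p, of "w2 p"])
  then have "\<theta>1 p (curv (\<psi> p) (w1 p) (w2 p) (w2 p)) = 0"
    using \<theta>_from_H(2)[OF p k2[of e1 e2]] q_nonzero[OF p] by (simp add: w1_def w2_def)
  then show ?thesis
    using \<theta>0[of e0 e2] linear_0[OF linear_\<theta>(3)]
    by (simp add: ricci_eq[OF \<psi>_in_M[OF p]] trace_frame[OF p linear_curv(1)[OF \<psi>_in_M[OF p]]]
        curv_self w0_def w2_def)
qed

text \<open>By \<open>null_form\<close> every frame component is the (w_1, w_1) component times a
  factor that depends on \<open>F\<close> alone. Two such forms are proportional, with the ratio of
  these components as the factor \<open>k\<close>.\<close>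

lemma ricci_sym_proportional:
  assumes geo: "\<And>p. p \<in> U \<Longrightarrow> D2_geodesic \<psi> \<Gamma> p" and p: "p \<in> U"
  shows "\<exists>k. \<forall>u v. ricci_sym \<Gamma> (\<psi> p) u v = k * met h (\<psi> p) u v"
proof -
  let ?R = "ricci_sym \<Gamma>"
  have bil: "\<forall>y\<in>M. bilinear (?R y)" using bilinear_ricci_sym by blast
  have sym: "\<forall>y\<in>M. \<forall>u v. ?R y u v = ?R y v u" using ricci_sym_commute by blast
  have null_R: "\<forall>p\<in>U. ?R (\<psi> p) (w2 p) (w2 p) = 0"
    using ricci_null[OF geo] by (simp add: ricci_sym_def)
  have p': "\<psi> p \<in> M" by (rule \<psi>_in_M[OF p])
  note R = null_form(1-4)[of ?R, OF bil smooth_on_ricci_sym sym null_R p]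
  define k where "k = ?R (\<psi> p) (w1 p) (w1 p) / q p"
  have c11: "?R (\<psi> p) (w1 p) (w1 p) = k * met h (\<psi> p) (w1 p) (w1 p)"
    using q_nonzero[OF p] by (simp add: k_def q_def)
  note HR = null_form_H(1-4)[OF p]
  have c22: "?R (\<psi> p) (w2 p) (w2 p) = k * met h (\<psi> p) (w2 p) (w2 p)"
    using bspec[OF null_R p] null[OF p] by simp
  have c12: "?R (\<psi> p) (w1 p) (w2 p) = k * met h (\<psi> p) (w1 p) (w2 p)"
    unfolding R(1) HR(1) by simp
  have c02: "?R (\<psi> p) (w0 p) (w2 p) = k * met h (\<psi> p) (w0 p) (w2 p)"
    unfolding R(2) HR(2) c11 by simp
  have c01: "?R (\<psi> p) (w0 p) (w1 p) = k * met h (\<psi> p) (w0 p) (w1 p)"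
    unfolding R(3) HR(3) c11 by simp
  have c00: "?R (\<psi> p) (w0 p) (w0 p) = k * met h (\<psi> p) (w0 p) (w0 p)"
    unfolding R(4) HR(4) c11 by simp
  have c10: "?R (\<psi> p) (w1 p) (w0 p) = k * met h (\<psi> p) (w1 p) (w0 p)"
    by (subst ricci_sym_commute, subst met_commute[OF p]) (rule c01)
  have c20: "?R (\<psi> p) (w2 p) (w0 p) = k * met h (\<psi> p) (w2 p) (w0 p)"
    by (subst ricci_sym_commute, subst met_commute[OF p]) (rule c02)
  have c21: "?R (\<psi> p) (w2 p) (w1 p) = k * met h (\<psi> p) (w2 p) (w1 p)"
    by (subst ricci_sym_commute, subst met_commute[OF p]) (rule c12)
  have 1: "?R (\<psi> p) u v = k * met h (\<psi> p) u v" if "u \<in> {w0 p, w1 p, w2 p}" "v \<in> {w0 p, w1 p, w2 p}" for u v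
    using that c00 c01 c02 c10 c11 c12 c20 c21 c22 by blast
  have lR: "linear (?R (\<psi> p) u)" "linear (\<lambda>u. ?R (\<psi> p) u v)" for u v
    using bspec[OF bil p'] unfolding bilinear_def by blast+
  have "linear (met h (\<psi> p) u)" "linear (\<lambda>u. met h (\<psi> p) u v)" for u v
    using bilinear_met[of h "\<psi> p"] unfolding bilinear_def by blast+
  from this[THEN linear_compose_scale_right, of k]
  have lH: "linear (\<lambda>v. k * met h (\<psi> p) u v)" "linear (\<lambda>u. k * met h (\<psi> p) u v)" for u v
    by simp_all
  note l = lR lH
  have 2: "?R (\<psi> p) u v = k * met h (\<psi> p) u v" if "u \<in> {w0 p, w1 p, w2 p}" for u v
    using frame_eqI[OF p l(1,3), of u u v] 1[OF that] by simp
  have "?R (\<psi> p) u v = k * met h (\<psi> p) u v" for u v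
    using frame_eqI[OF p l(2,4), of v v u] 2 by simp
  then show ?thesis by blast
qed

end

section \<open>Construction of the Einstein-Weyl structure\<close>

text \<open>Cramer's rule expresses the solution of the linear system as a quotient of polynomials
  in smooth entries.\<close>

lemma smooth_on_matrix_inv_mult:
  fixes A :: "'a::real_normed_vector \<Rightarrow> real^3^3"
  assumes S: "open S" and A: "smooth_on S A" "\<And>x. x \<in> S \<Longrightarrow> invertible (A x)" and b: "smooth_on S b"
  shows "smooth_on S (\<lambda>x. matrix_inv (A x) *v b x)"
proof (subst smooth_on_cong[OF S])
  show "matrix_inv (A x) *v b x = (\<chi> k. det (\<chi> i j. if j = k then b x $ i else A x $ i $ j) / det (A x))"
    if "x \<in> S" for x
  proof -
    have "det (A x) \<noteq> 0" using A(2)[OF that] by (simp add: invertible_det_nz)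
    moreover have "A x *v (matrix_inv (A x) *v b x) = b x"
      by (simp add: matrix_vector_mul_assoc matrix_inv_mult[OF A(2)[OF that]])
    ultimately show ?thesis using cramer by blast
  qed
  have sA: "smooth_on S (\<lambda>x. A x $ i $ j)" for i j
    by (intro smooth_on_vec_nth S A)
  have sb: "smooth_on S (\<lambda>x. b x $ i)" for i
    by (intro smooth_on_vec_nth S b)
  have "smooth_on S (\<lambda>x. if j = k then b x $ i else A x $ i $ j)" for i j k
    using sA sb by (cases "j = k") simp_all
  then have 1: "smooth_on S (\<lambda>x. det (\<chi> i j. if j = k then b x $ i else A x $ i $ j))" for k
    unfolding det_3 vec_lambda_beta by (intro smooth_on_add smooth_on_diff smooth_on_mult S)
  have 2: "smooth_on S (\<lambda>x. det (A x))"
    unfolding det_3 by (intro smooth_on_add smooth_on_diff smooth_on_mult S sA)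
  show "smooth_on S (\<lambda>x. \<chi> k. det (\<chi> i j. if j = k then b x $ i else A x $ i $ j) / det (A x))"
    using A(2) by (intro smooth_on_vec_lambda smooth_on_divide S 1 2) (simp add: invertible_det_nz)
qed

lemma met_lin:
  "met h y (u + v) w = met h y u w + met h y v w" "met h y (c *\<^sub>R u) w = c * met h y u w"
  "met h y w (u + v) = met h y w u + met h y w v" "met h y w (c *\<^sub>R u) = c * met h y w u"
  "met h y (u - v) w = met h y u w - met h y v w" "met h y w (u - v) = met h y w u - met h y w v"
  using bilinear_ladd[OF bilinear_met] bilinear_lmul[OF bilinear_met] bilinear_radd[OF bilinear_met]
    bilinear_rmul[OF bilinear_met] bilinear_lsub[OF bilinear_met] bilinear_rsub[OF bilinear_met]
  by auto

lemma met_nondegenerate: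
  assumes inv: "invertible (h y)" and u: "\<And>v. met h y u v = 0"
  shows "u = 0"
proof -
  have "h y *v (matrix_inv (h y) *v u) = u"
    by (simp add: matrix_vector_mul_assoc matrix_inv_mult[OF inv])
  then have "u \<bullet> u = met h y u (matrix_inv (h y) *v u)" by (simp add: met_def)
  then show ?thesis using u by simp
qed

text \<open>The Christoffel symbols of the Levi-Civita connection, corrected by \<open>\<phi>\<close>.\<close>

lemma weyl_connection_exists:
  fixes M :: "(real^3) set" and h :: metric
  assumes M: "open M" and h: "smooth_on M h"
    and sym: "\<And>y. y \<in> M \<Longrightarrow> transpose (h y) = h y" and inv: "\<And>y. y \<in> M \<Longrightarrow> invertible (h y)"
    and \<phi>: "one_form_on M \<phi>"
  obtains \<Gamma> where "connection_on M \<Gamma>" "\<And>y u v. y \<in> M \<Longrightarrow> \<Gamma> y u v = \<Gamma> y v u"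
    "\<And>y u v w. y \<in> M \<Longrightarrow> FD (\<lambda>z. met h z v w) y u
        = met h y (\<Gamma> y u v) w + met h y v (\<Gamma> y u w) + \<phi> y u * met h y v w"
proof -
  have l\<phi>: "linear (\<phi> y)" if "y \<in> M" for y
    using \<phi> that by (simp add: one_form_on_def)
  have s\<phi>: "smooth_on M (\<lambda>y. \<phi> y u)" for u
    using \<phi> by (simp add: one_form_on_def)
  note sm = smooth_on_met[OF M h]
  have msym: "met h y u v = met h y v u" if "y \<in> M" for y u v
    by (rule met_sym[of h y, OF sym[OF that]])
  have Dsym: "FD (\<lambda>x. met h x u v) y = FD (\<lambda>x. met h x v u) y" if "y \<in> M" for y u v
    by (rule FD_cong[OF M that]) (rule msym)
  \<comment> \<open>Koszul's formula, with each derivative of the metric diminished by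
    \<open>\<phi>\<close> times the metric.\<close>
  define K where "K y u v w = (FD (\<lambda>x. met h x v w) y u + FD (\<lambda>x. met h x u w) y v
    - FD (\<lambda>x. met h x u v) y w - \<phi> y u * met h y v w - \<phi> y v * met h y u w + \<phi> y w * met h y u v) * (1/2)"
    for y u v w
  define \<Gamma> where "\<Gamma> y u v = matrix_inv (h y) *v (\<chi> i. K y u v (axis i 1))" for y u v
  have lD: "linear (FD (\<lambda>x. met h x u v) y)" if "y \<in> M" for y u v
    by (rule smooth_on_linear_FD[OF sm that])
  have lK: "linear (\<lambda>u. K y u v w)" "linear (\<lambda>v. K y u v w)" "linear (\<lambda>w. K y u v w)"
    if y: "y \<in> M" for y u v w
    unfolding K_def linear_iff
    by (simp_all add: FD_add FD_mult smooth_on_differentiable[OF sm y] met_lin linear_add[OF lD[OF y]] linear_cmul[OF lD[OF y]]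
        linear_add[OF l\<phi>[OF y]] linear_cmul[OF l\<phi>[OF y]] algebra_simps)
  have sK: "smooth_on M (\<lambda>y. K y u v w)" for u v w
    unfolding K_def by (intro smooth_on_mult smooth_on_add smooth_on_diff smooth_on_const smooth_on_FD_const
        sm s\<phi> M)
  have met\<Gamma>: "met h y w (\<Gamma> y u v) = K y u v w" if y: "y \<in> M" for y u v w
  proof -
    have "h y *v \<Gamma> y u v = (\<chi> i. K y u v (axis i 1))"
      by (simp add: \<Gamma>_def matrix_vector_mul_assoc matrix_inv_mult[OF inv[OF y]])
    then have "met h y w (\<Gamma> y u v) = (\<Sum>i\<in>UNIV. w $ i * K y u v (axis i 1))"
      by (simp add: met_def inner_vec_def)
    also have "\<dots> = (\<Sum>i\<in>UNIV. K y u v (w $ i *\<^sub>R axis i 1))"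
      by (simp add: linear_cmul[OF lK(3)[OF y]])
    also have "\<dots> = K y u v (\<Sum>i\<in>UNIV. w $ i *\<^sub>R axis i 1)"
      by (rule linear_sum[OF lK(3)[OF y], symmetric])
    also have "(\<Sum>i\<in>UNIV. w $ i *\<^sub>R axis i 1) = w"
      by (simp add: basis_expansion flip: scalar_mult_eq_scaleR)
    finally show ?thesis .
  qed
  show ?thesis
  proof (rule that[of \<Gamma>])
    have "bilinear (\<Gamma> y)" if y: "y \<in> M" for y
    proof -
      have lv: "linear (\<lambda>u. \<chi> i. K y u v (axis i 1))" "linear (\<lambda>v. \<chi> i. K y u v (axis i 1))" for u v
        using linear_add[OF lK(1)[OF y]] linear_cmul[OF lK(1)[OF y]]
          linear_add[OF lK(2)[OF y]] linear_cmul[OF lK(2)[OF y]]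
        by (simp_all add: linear_iff vec_eq_iff)
      show ?thesis
        unfolding bilinear_def \<Gamma>_def
        by (intro conjI allI linear_compose[OF lv(1) matrix_vector_mul_linear, unfolded o_def]
            linear_compose[OF lv(2) matrix_vector_mul_linear, unfolded o_def])
    qed
    moreover have "smooth_on M (\<lambda>y. \<Gamma> y u v)" for u v
      unfolding \<Gamma>_def by (intro smooth_on_matrix_inv_mult smooth_on_vec_lambda M h inv sK)
    ultimately show "connection_on M \<Gamma>" by (simp add: connection_on_def)
    have Ks: "K y u v = K y v u" if "y \<in> M" for y u v
      by (rule ext) (simp add: K_def msym[OF that, of v u] Dsym[OF that, of v u])
    show "\<Gamma> y u v = \<Gamma> y v u" if "y \<in> M" for y u v
      by (simp add: \<Gamma>_def Ks[OF that, of u v])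
    show "FD (\<lambda>z. met h z v w) y u = met h y (\<Gamma> y u v) w + met h y v (\<Gamma> y u w) + \<phi> y u * met h y v w"
      if y: "y \<in> M" for y u v w
    proof -
      have "K y u v w + K y u w v + \<phi> y u * met h y v w = FD (\<lambda>z. met h z v w) y u"
        unfolding K_def Dsym[OF y, of w v] msym[OF y, of w v]
        by (simp add: field_simps)
      then show ?thesis by (simp add: msym[OF y, of "\<Gamma> y u v"] met\<Gamma>[OF y])
    qed
  qed
qed

lemma lorentz_invertible:
  fixes P A :: "real^3^3"
  assumes "transpose P ** A ** P = lorentz_form"
  shows "invertible A" "invertible P"
proof -
  have "det P * det A * det P = det lorentz_form"
    using assms by (metis det_mul det_transpose)
  also have "\<dots> = -1"
    by (simp add: det_3 lorentz_form_def)
  finally show "invertible A" "invertible P" by (auto simp: invertible_det_nz)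
qed

lemma lorentzian_frame:
  assumes e: "\<And>i j. met h y (e i) (e j) = lorentz_form $ i $ j"
  shows "\<exists>P. invertible P \<and> transpose P ** h y ** P = lorentz_form"
proof -
  define P where "P = (\<chi> i j. e j $ i)"
  have col: "P *v axis j 1 = e j" for j
    unfolding matrix_vector_mult_basis by (simp add: P_def column_def vec_eq_iff)
  have "(transpose P ** h y ** P) $ i $ j = lorentz_form $ i $ j" for i j
  proof -
    have "(transpose P ** h y ** P) $ i $ j = axis i 1 \<bullet> ((transpose P ** h y ** P) *v axis j 1)"
      unfolding matrix_vector_mult_basis by (simp add: inner_axis' column_def)
    also have "\<dots> = axis i 1 \<bullet> (transpose P *v (h y *v e j))"
      by (simp add: matrix_vector_mul_assoc[symmetric] col)
    also have "\<dots> = (P *v axis i 1) \<bullet> (h y *v e j)"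
      by (metis dot_lmul_matrix transpose_matrix_vector transpose_transpose)
    also have "\<dots> = lorentz_form $ i $ j" using e by (simp add: col met_def)
    finally show ?thesis .
  qed
  then have "transpose P ** h y ** P = lorentz_form" by (simp add: vec_eq_iff)
  then show ?thesis using lorentz_invertible(2) by blast
qed

section \<open>Determinant and coframe along the fibres\<close>

context chart begin

text \<open>The logarithmic derivative of the determinant is the trace of the frame system, in which
  only w_2 has a diagonal entry.\<close>

lemma XF_volume:
  assumes p: "p \<in> U"
  shows "XF F volume p = - d2 F p * volume p"
proof -
  note d = smooth_on_differentiable[OF sm_w(1) p] smooth_on_differentiable[OF sm_w(2) p]
    smooth_on_differentiable[OF sm_w(3) p] smooth_on_differentiable[OF sm_cross[OF sm_w(2,3)] p]
  show ?thesis
    unfolding XF_def deriv_along_def volume_def[abs_def]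
    by (simp add: FD_inner d FD_bilinear[OF bounded_bilinear_cross3] X_w[OF p] cross_add_left cross_add_right
        cross_mult_left cross_mult_right left_diff_distrib Cross3.left_diff_distrib
        Cross3.right_diff_distrib inner_add_left inner_diff_left inner_diff_right dot_cross_self)
qed

text \<open>The dual of the frame system. The numerator of each coframe element is differentiated
  once directly and once as the element times \<open>volume\<close>, which avoids the quotient
  rule.\<close>

lemma XF_\<theta>:
  assumes p: "p \<in> U"
  shows "XF F (\<lambda>p. \<theta>0 p v) p = \<theta>1 p v" "XF F (\<lambda>p. \<theta>1 p v) p = \<theta>2 p v"
    "XF F (\<lambda>p. \<theta>2 p v) p = d0 F p * \<theta>0 p v + d1 F p * \<theta>1 p v + d2 F p * \<theta>2 p v"
proof -
  have N: "XF F (\<lambda>p. v \<bullet> cross3 (a p) (b p)) p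
     = v \<bullet> cross3 (a p) (FD b p (total_field F p)) + v \<bullet> cross3 (FD a p (total_field F p)) (b p)"
    if s: "sm a" "sm b" for a b
  proof -
    note d = smooth_on_differentiable[OF s(1) p] smooth_on_differentiable[OF s(2) p]
      smooth_on_differentiable[OF sm_cross[OF s] p]
    show ?thesis
      unfolding XF_def deriv_along_def by (simp add: FD_inner d FD_bilinear[OF bounded_bilinear_cross3] inner_add_right)
  qed
  have D: "XF F (\<lambda>p. v \<bullet> cross3 (a p) (b p)) p = (XF F (\<lambda>p. f p v) p - d2 F p * f p v) * volume p"
    if "\<And>p u. f p u = u \<bullet> cross3 (a p) (b p) / volume p" "sm (\<lambda>p. f p v)"
    for a b and f :: "jet \<Rightarrow> real^3 \<Rightarrow> real"
  proof -
    have "XF F (\<lambda>p. v \<bullet> cross3 (a p) (b p)) p = XF F (\<lambda>p. f p v * volume p) p"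
      by (rule XF_cong[OF p]) (simp add: that(1) volume_nonzero)
    then show ?thesis
      by (simp add: XF_rules[OF p] that(2) sm_volume XF_volume[OF p] algebra_simps)
  qed
  note n = volume_nonzero[OF p]
  have v: "v \<bullet> cross3 (w1 p) (w2 p) = \<theta>0 p v * volume p" "v \<bullet> cross3 (w2 p) (w0 p) = \<theta>1 p v * volume p"
    "v \<bullet> cross3 (w0 p) (w1 p) = \<theta>2 p v * volume p"
    using n by (simp_all add: \<theta>0_def \<theta>1_def \<theta>2_def)
  have v': "v \<bullet> cross3 (w2 p) (w1 p) = - \<theta>0 p v * volume p" "v \<bullet> cross3 (w0 p) (w2 p) = - \<theta>1 p v * volume p"
    "v \<bullet> cross3 (w1 p) (w0 p) = - \<theta>2 p v * volume p"
    using v cross_skew[of "w2 p" "w1 p"] cross_skew[of "w0 p" "w2 p"] cross_skew[of "w1 p" "w0 p"] by simp_all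
  note simps = N sm_w X_w[OF p] cross_add_left cross_add_right cross_mult_left cross_mult_right
     Cross3.left_diff_distrib Cross3.right_diff_distrib inner_add_right inner_diff_right v v'
  have "(XF F (\<lambda>p. \<theta>0 p v) p - d2 F p * \<theta>0 p v) * volume p = (\<theta>1 p v - d2 F p * \<theta>0 p v) * volume p"
    unfolding D[of \<theta>0, OF \<theta>0_def sm_\<theta>(1), symmetric] by (simp add: simps algebra_simps)
  then show "XF F (\<lambda>p. \<theta>0 p v) p = \<theta>1 p v" using n by simp
  have "(XF F (\<lambda>p. \<theta>1 p v) p - d2 F p * \<theta>1 p v) * volume p = (\<theta>2 p v - d2 F p * \<theta>1 p v) * volume p"
    unfolding D[of \<theta>1, OF \<theta>1_def sm_\<theta>(2), symmetric] by (simp add: simps algebra_simps)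
  then show "XF F (\<lambda>p. \<theta>1 p v) p = \<theta>2 p v" using n by simp
  have "(XF F (\<lambda>p. \<theta>2 p v) p - d2 F p * \<theta>2 p v) * volume p = (d0 F p * \<theta>0 p v + d1 F p * \<theta>1 p v) * volume p"
    unfolding D[of \<theta>2, OF \<theta>2_def sm_\<theta>(3), symmetric] by (simp add: simps algebra_simps)
  then show "XF F (\<lambda>p. \<theta>2 p v) p = d0 F p * \<theta>0 p v + d1 F p * \<theta>1 p v + d2 F p * \<theta>2 p v"
    using n by simp
qed

end

lemma met_conformal:
  "h' y = c *\<^sub>R h y \<Longrightarrow> met h' y u v = c * met h y u v"
  by (simp add: met_def scaleR_matrix_vector_assoc[symmetric])

text \<open>Multiplying the metric by \<open>f\<close> adds the differential of log \<open>f\<close>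
  to the one-form.\<close>

lemma weyl_conformal_class:
  fixes M :: "(real^3) set" and h :: metric
  assumes M: "open M" and h: "smooth_on M h" and \<phi>: "one_form_on M \<phi>"
    and weyl: "\<And>y u v w. y \<in> M \<Longrightarrow> cov_metric \<Gamma> h (\<lambda>_. u) (\<lambda>_. v) (\<lambda>_. w) y = \<phi> y u * met h y v w"
    and h': "h' \<in> conformal_class M h"
  shows "\<exists>\<phi>. one_form_on M \<phi> \<and>
    (\<forall>y\<in>M. \<forall>u v w. cov_metric \<Gamma> h' (\<lambda>_. u) (\<lambda>_. v) (\<lambda>_. w) y = \<phi> y u * met h' y v w)"
proof -
  obtain f where f: "smooth_on M f" and pos: "\<And>y. y \<in> M \<Longrightarrow> f y > 0"
    and h'f: "\<And>y. y \<in> M \<Longrightarrow> h' y = f y *\<^sub>R h y"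
    using h' by (auto simp: conformal_class_def)
  have met': "met h' y u v = f y * met h y u v" if "y \<in> M" for y u v
    by (rule met_conformal[of h' y "f y" h, OF h'f[OF that]])
  define \<phi>' where "\<phi>' y u = \<phi> y u + FD f y u / f y" for y u
  have l: "linear (FD f y)" if "y \<in> M" for y
    by (rule smooth_on_linear_FD[OF f that])
  have "one_form_on M \<phi>'"
    unfolding one_form_on_def
  proof (intro conjI ballI allI)
    fix y assume y: "y \<in> M"
    have "linear (\<phi> y)" using \<phi> y by (simp add: one_form_on_def)
    then show "linear (\<phi>' y)"
      unfolding \<phi>'_def linear_iff
      by (simp add: linear_add[OF l[OF y]] linear_cmul[OF l[OF y]] add_divide_distrib algebra_simps)
  next
    fix v
    have "smooth_on M (\<lambda>y. \<phi> y v)" using \<phi> by (simp add: one_form_on_def)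
    then show "smooth_on M (\<lambda>y. \<phi>' y v)"
      unfolding \<phi>'_def
      by (intro smooth_on_add smooth_on_divide smooth_on_FD_const f M) (auto dest: pos)
  qed
  moreover have "cov_metric \<Gamma> h' (\<lambda>_. u) (\<lambda>_. v) (\<lambda>_. w) y = \<phi>' y u * met h' y v w"
    if y: "y \<in> M" for y u v w
  proof -
    have "FD (\<lambda>z. met h' z v w) y u = FD (\<lambda>z. f z * met h z v w) y u"
      by (subst FD_cong[OF M y met']) auto
    also have "\<dots> = f y * FD (\<lambda>z. met h z v w) y u + FD f y u * met h y v w"
      by (intro FD_mult smooth_on_differentiable[OF f y] smooth_on_differentiable[OF smooth_on_met[OF M h] y])
    finally show ?thesis
      using weyl[OF y, of u v w] pos[OF y]
      by (simp add: cov_metric_const met'[OF y] \<phi>'_def field_simps)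
  qed
  ultimately show ?thesis by blast
qed

text \<open>For a rescaled metric the proportionality factor of the Ricci tensor is divided by the
  conformal factor; tracing identifies it with a third of the scalar curvature.\<close>

lemma (in weyl_chart) einstein_weyl_if_geodesic:
  assumes lor: "lorentzian_metric M h" and geo: "\<And>p. p \<in> U \<Longrightarrow> D2_geodesic \<psi> \<Gamma> p"
  shows "einstein_weyl M (conformal_class M h) \<Gamma>"
  unfolding einstein_weyl_def
proof (intro conjI ballI allI)
  show "lorentzian_conformal_structure M (conformal_class M h)"
    using lor by (auto simp: lorentzian_conformal_structure_def)
  have "cov_metric \<Gamma> h (\<lambda>_. u) (\<lambda>_. v) (\<lambda>_. w) y = \<phi> y u * met h y v w" if "y \<in> M" for y u v w
    using weyl[OF that, of v w u] by (simp add: cov_metric_const)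
  from weyl_conformal_class[OF open_M h_smooth \<phi>_form this]
  show "weyl_connection M (conformal_class M h) \<Gamma>"
    unfolding weyl_connection_def torsion_const using con_\<Gamma> \<Gamma>_sym by simp
next
  fix h' y v w
  assume h': "h' \<in> conformal_class M h" and y: "y \<in> M"
  obtain c where c: "c > 0" "h' y = c *\<^sub>R h y"
    using h' y by (auto simp: conformal_class_def)
  obtain p where p: "p \<in> U" "y = \<psi> p" using y by auto
  obtain k where k: "\<And>u v. ricci_sym \<Gamma> y u v = k * met h y u v"
    using ricci_sym_proportional[OF geo p(1)] p(2) by auto
  have k': "ricci_sym \<Gamma> y u v = (k / c) * met h' y u v" for u v
    using k c(1) by (simp add: met_conformal[of h' y c h, OF c(2)])
  have "invertible (h y)"
    using lor y lorentz_invertible(1) unfolding lorentzian_metric_def by blast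
  then have "det (h y) \<noteq> 0" by (simp add: invertible_det_nz)
  moreover have det_scaleR: "det (c *\<^sub>R A) = c ^ 3 * det A" for A :: "real^3^3"
    by (simp add: det_3 power3_eq_cube algebra_simps)
  ultimately have inv: "invertible (h' y)"
    unfolding c(2) invertible_det_nz using c(1) det_scaleR by simp
  have sym: "transpose (h' y) = h' y"
    using h_sym[OF y] c(2) by (simp add: transpose_def vec_eq_iff)
  show "ricci_sym \<Gamma> y v w = 1/3 * scalar_curvature h' \<Gamma> y * met h' y v w"
    unfolding scalar_curvature_eq[OF inv sym k'] using k' by simp
qed

context ode begin

lemma XF_ln:
  assumes "p \<in> U" "sm f" "f p > 0"
  shows "XF F (\<lambda>p. ln (f p)) p = XF F f p / f p"
  unfolding XF_def deriv_along_def
  by (simp add: FD_real_compose[OF smooth_on_differentiable[OF assms(2,1)] DERIV_ln_divide[OF assms(3)]])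

lemma der_exp:
  fixes f :: "jet \<Rightarrow> real"
  assumes "p \<in> U" "sm f"
  shows "deriv_along Y (\<lambda>p. exp (f p)) p = exp (f p) * deriv_along Y f p"
  unfolding deriv_along_def
  by (simp add: FD_real_compose[OF smooth_on_differentiable[OF assms(2,1)] DERIV_exp[of "f p"]])

end

section \<open>The invariant metric and one-form\<close>

context chart begin

text \<open>Null forms satisfy X_F q = -2/3 F_2 q, while X_F \<open>volume\<close> = -F_2
  \<open>volume\<close>. So the absolute value of \<open>volume\<close> to the power 2/3 is a
  positive solution, and this is its logarithm; the square takes care of the sign.\<close>

definition log_q :: "jet \<Rightarrow> real" where "log_q p = ln ((volume p)\<^sup>2) / 3"

lemma sm_log_q: "sm log_q"
  unfolding log_q_def[abs_def]
  by (intro sm_divide_const smooth_on_ln sm_intros sm_volume open_U) (simp add: volume_nonzero)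

lemma XF_log_q:
  assumes p: "p \<in> U"
  shows "XF F log_q p = - 2/3 * d2 F p"
proof -
  have pos: "(volume p)\<^sup>2 > 0" if "p \<in> U" for p
    using volume_nonzero[OF that] by simp
  have s: "sm (\<lambda>p. (volume p)\<^sup>2)" by (intro sm_intros sm_volume)
  have sl: "sm (\<lambda>p. ln ((volume p)\<^sup>2))" by (rule smooth_on_ln[OF open_U s pos])
  have "XF F log_q p = XF F (\<lambda>p. ln ((volume p)\<^sup>2)) p / 3"
    unfolding log_q_def[abs_def] by (rule XF_rules(1)[OF p sl])
  also have "XF F (\<lambda>p. ln ((volume p)\<^sup>2)) p = 2 * volume p * (- d2 F p * volume p) / (volume p)\<^sup>2"
    unfolding XF_ln[OF p s pos[OF p]] XF_rules(7)[OF p sm_volume] XF_volume[OF p] ..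
  finally show ?thesis using volume_nonzero[OF p] by (simp add: power2_eq_square)
qed

text \<open>The values of the one-form on w_0 and w_1, to go with \<partial>_2 \<open>log_q\<close>
  on w_2: exactly what the necessary conditions in \<open>Cartan_zero\<close> give for q = exp
  \<open>log_q\<close>.\<close>

definition beta0 :: "jet \<Rightarrow> real" where
  "beta0 p = d0 log_q p + 2/3 * d1 (d2 F) p - 2/3 * XF F (d2 (d2 F)) p"
definition beta1 :: "jet \<Rightarrow> real" where
  "beta1 p = d1 log_q p + 2/3 * d2 (d2 F) p"

lemma sm_beta: "sm beta0" "sm beta1"
  unfolding beta0_def[abs_def] beta1_def[abs_def] by (intro sm_all sm_log_q)+

text \<open>The three brackets applied to \<open>log_q\<close>. Up to the Cartan term these are the
  equations for the values on the frame of a one-form that is constant along the fibres.\<close>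

lemma XF_beta:
  assumes p: "p \<in> U"
  shows "XF F (d2 log_q) p = - beta1 p - d2 F p * d2 log_q p"
    and "XF F beta1 p = - beta0 p - d1 F p * d2 log_q p"
    and "XF F beta0 p = - d0 F p * d2 log_q p - 2/3 * Cartan F p"
proof -
  have "XF F log_q q = (\<lambda>q. - 2/3 * d2 F q) q" if "q \<in> U" for q
    by (simp add: XF_log_q[OF that])
  from d_cong[OF p this]
  have d: "d0 (XF F log_q) p = - 2/3 * d0 (d2 F) p" "d1 (XF F log_q) p = - 2/3 * d1 (d2 F) p"
    "d2 (XF F log_q) p = - 2/3 * d2 (d2 F) p"
    by (simp_all add: d0_rules[OF p] d1_rules[OF p] d2_rules[OF p] sm_all)
  note X = d_XF[OF p sm_log_q, unfolded d]
  show "XF F (d2 log_q) p = - beta1 p - d2 F p * d2 log_q p"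
    using X(3) by (simp add: beta1_def)
  show "XF F beta1 p = - beta0 p - d1 F p * d2 log_q p"
    unfolding beta1_def[abs_def]
    using X(2) by (simp add: XF_rules[OF p] sm_all sm_log_q beta0_def)
  show "XF F beta0 p = - d0 F p * d2 log_q p - 2/3 * Cartan F p"
    unfolding beta0_def[abs_def]
    using X(1) by (simp add: XF_rules[OF p] sm_all sm_log_q Cartan_def algebra_simps)
qed

text \<open>The Gram matrix from \<open>null_form\<close> written in the coframe, with exp
  \<open>log_q\<close> for B(w_1, w_1).\<close>

definition metric_form :: "jet \<Rightarrow> real^3 \<Rightarrow> real^3 \<Rightarrow> real" where
  "metric_form p u v = exp (log_q p) *
    (\<theta>1 p u * \<theta>1 p v - \<theta>0 p u * \<theta>2 p v - \<theta>2 p u * \<theta>0 p v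
     + 1/3 * d2 F p * (\<theta>0 p u * \<theta>1 p v + \<theta>1 p u * \<theta>0 p v) + gram00 p * (\<theta>0 p u * \<theta>0 p v))"

definition weyl_form :: "jet \<Rightarrow> real^3 \<Rightarrow> real" where
  "weyl_form p u = beta0 p * \<theta>0 p u + beta1 p * \<theta>1 p u + d2 log_q p * \<theta>2 p u"

lemma sm_metric_form: "sm (\<lambda>p. metric_form p u v)"
  unfolding metric_form_def by (intro sm_all sm_\<theta> sm_log_q sm_gram00)

lemma sm_weyl_form: "sm (\<lambda>p. weyl_form p u)"
  unfolding weyl_form_def by (intro sm_all sm_\<theta> sm_log_q sm_beta)

text \<open>By the coframe system every component of the derivative cancels except that of
  \<open>\<theta>0\<close> with itself, which is -2 W_0 exp \<open>log_q\<close>.\<close>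

lemma XF_metric_form:
  assumes p: "p \<in> U" and W0: "W0 F p = 0"
  shows "XF F (\<lambda>p. metric_form p u v) p = 0"
proof -
  have X1: "XF F gram00 p = 2 * d0 F p + 2/3 * d2 F p * gram00 p"
    using two_W0_eq[OF p] W0 by simp
  \<comment> \<open>The definition of \<open>gram00\<close> solved for X_F(F_2), so that this
    derivative can be eliminated.\<close>
  have X2: "XF F (d2 F) p = 3 * (d1 F p - gram00 p) + 2/3 * (d2 F p)\<^sup>2"
    by (simp add: gram00_def)
  have X3: "XF F (\<lambda>p. exp (log_q p)) p = exp (log_q p) * (- 2/3 * d2 F p)"
    using der_exp[OF p sm_log_q, of "total_field F"] XF_log_q[OF p] by (simp add: XF_def)
  show ?thesis
    unfolding metric_form_def
    by (simp add: XF_rules[OF p] sm_all sm_\<theta> sm_log_q sm_gram00 XF_\<theta>[OF p] X1 X2 X3)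
       (simp add: field_simps power2_eq_square)
qed

text \<open>By \<open>XF_beta\<close> and \<open>XF_\<theta>\<close> the derivative is -2/3 C
  \<open>\<theta>0\<close>.\<close>

lemma XF_weyl_form:
  assumes p: "p \<in> U" and C: "Cartan F p = 0"
  shows "XF F (\<lambda>p. weyl_form p u) p = 0"
  unfolding weyl_form_def
  by (simp add: XF_rules[OF p] sm_all sm_\<theta> sm_log_q sm_beta XF_\<theta>[OF p] XF_beta[OF p] C algebra_simps)

lemma bilinear_metric_form: "bilinear (metric_form p)"
  unfolding bilinear_def metric_form_def linear_iff
  by (simp add: linear_add[OF linear_\<theta>(1)] linear_add[OF linear_\<theta>(2)] linear_add[OF linear_\<theta>(3)]
      linear_cmul[OF linear_\<theta>(1)] linear_cmul[OF linear_\<theta>(2)] linear_cmul[OF linear_\<theta>(3)] algebra_simps)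

lemma linear_weyl_form: "linear (weyl_form p)"
  unfolding weyl_form_def linear_iff
  by (simp add: linear_add[OF linear_\<theta>(1)] linear_add[OF linear_\<theta>(2)] linear_add[OF linear_\<theta>(3)]
      linear_cmul[OF linear_\<theta>(1)] linear_cmul[OF linear_\<theta>(2)] linear_cmul[OF linear_\<theta>(3)] algebra_simps)

text \<open>The orthonormal frame is made of \<open>w\<^sub>1\<close> and of \<open>w\<^sub>2 \<mp> n\<close>, where \<open>n\<close> is a null vector
  orthogonal to \<open>w\<^sub>1\<close>.\<close>

lemma metric_form_lorentzian:
  assumes p: "p \<in> U" and h: "\<And>u v. met h y u v = metric_form p u v"
  shows "\<exists>P. invertible P \<and> transpose P ** h y ** P = lorentz_form"
proof -
  define q where "q = exp (log_q p)"
  have q: "q > 0" by (simp add: q_def)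
  define f where "f = 1/3 * d2 F p"
  define g where "g = gram00 p"
  have gram: "met h y (w0 p) (w0 p) = q * g" "met h y (w0 p) (w1 p) = q * f" "met h y (w1 p) (w0 p) = q * f"
    "met h y (w0 p) (w2 p) = - q" "met h y (w2 p) (w0 p) = - q" "met h y (w1 p) (w1 p) = q"
    "met h y (w1 p) (w2 p) = 0" "met h y (w2 p) (w1 p) = 0" "met h y (w2 p) (w2 p) = 0"
    unfolding h metric_form_def q_def f_def g_def by (simp_all add: \<theta>_w[OF p])
  \<comment> \<open>The w_1 coefficient makes \<open>n\<close> orthogonal to w_1, and the w_2
    coefficient then makes it null.\<close>
  define n where "n = w0 p - f *\<^sub>R w1 p + ((g - f\<^sup>2) / 2) *\<^sub>R w2 p"
  have n: "met h y n (w1 p) = 0" "met h y (w1 p) n = 0" "met h y n (w2 p) = - q" "met h y (w2 p) n = - q"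
    "met h y n n = 0"
    unfolding n_def by (simp_all add: met_lin gram field_simps power2_eq_square)
  define a where "a = 1 / sqrt q"
  \<comment> \<open>The vectors w_2 - n and w_2 + n have squared lengths 2q and -2q.\<close>
  define b where "b = 1 / sqrt (2 * q)"
  have ab: "a * (a * q) = 1" "b * (b * q) = 1/2"
    using q by (simp_all add: a_def b_def real_sqrt_mult field_simps)
  define e :: "3 \<Rightarrow> real^3" where
    "e i = (if i = 1 then a *\<^sub>R w1 p else if i = 2 then b *\<^sub>R (w2 p - n) else b *\<^sub>R (w2 p + n))" for i
  have "met h y (e i) (e j) = lorentz_form $ i $ j" for i j
    using exhaust_3[of i] exhaust_3[of j] ab
    by (auto simp: e_def lorentz_form_def met_lin gram n algebra_simps)
  then show ?thesis by (rule lorentzian_frame)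
qed

end

context fibred_chart begin

theorem einstein_weyl_exists:
  assumes W0: "\<And>p. p \<in> U \<Longrightarrow> W0 F p = 0" and C: "\<And>p. p \<in> U \<Longrightarrow> Cartan F p = 0"
  shows "\<exists>c \<Gamma>. einstein_weyl M c \<Gamma> \<and> (\<forall>h\<in>c. \<forall>p\<in>U. met h (\<psi> p) (w2 p) (w2 p) = 0)
    \<and> (\<forall>p\<in>U. D2_geodesic \<psi> \<Gamma> p)"
proof -
  \<comment> \<open>On fixed basis vectors of R^3 the form is a function on the jets killed by X_F,
    so the metric descends entry by entry.\<close>
  have "\<exists>g. smooth_on M g \<and> (\<forall>p\<in>U. g (\<psi> p) = metric_form p (axis i 1) (axis j 1))" for i j
    using descend[OF sm_metric_form XF_metric_form[OF _ W0]] by metis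
  then obtain G where G: "\<And>i j. smooth_on M (G i j)"
    "\<And>i j p. p \<in> U \<Longrightarrow> G i j (\<psi> p) = metric_form p (axis i 1) (axis j 1)"
    by metis
  have "\<exists>g. smooth_on M g \<and> (\<forall>p\<in>U. g (\<psi> p) = weyl_form p (axis i 1))" for i
    using descend[OF sm_weyl_form XF_weyl_form[OF _ C]] by metis
  then obtain A where A: "\<And>i. smooth_on M (A i)"
    "\<And>i p. p \<in> U \<Longrightarrow> A i (\<psi> p) = weyl_form p (axis i 1)"
    by metis
  define h :: metric where "h y = (\<chi> i j. G i j y)" for y
  define \<phi> where "\<phi> y u = (\<Sum>i\<in>UNIV. u $ i * A i y)" for y and u :: "real^3"
  have h_smooth: "smooth_on M h"
    unfolding h_def by (intro smooth_on_vec_lambda open_M G)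
  have met: "met h (\<psi> p) u v = metric_form p u v" if "p \<in> U" for p u v
  proof -
    have "met h (\<psi> p) = metric_form p"
    proof (rule bilinear_eq_stdbasis[OF bilinear_met bilinear_metric_form])
      fix i j :: "real^3" assume "i \<in> Basis" "j \<in> Basis"
      then obtain k l where "i = axis k 1" "j = axis l 1" by (auto simp: Basis_vec_def)
      then show "met h (\<psi> p) i j = metric_form p i j"
        by (simp add: met_axis h_def G(2)[OF that])
    qed
    then show ?thesis by simp
  qed
  have \<phi>: "\<phi> (\<psi> p) u = weyl_form p u" if "p \<in> U" for p u
  proof -
    have "weyl_form p (\<Sum>i\<in>UNIV. u $ i *\<^sub>R axis i 1) = \<phi> (\<psi> p) u"
      unfolding linear_sum[OF linear_weyl_form] linear_cmul[OF linear_weyl_form]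
      by (simp add: \<phi>_def A(2)[OF that])
    then show ?thesis by (simp add: basis_expansion flip: scalar_mult_eq_scaleR)
  qed
  have \<phi>_form: "one_form_on M \<phi>"
    unfolding one_form_on_def
  proof (intro conjI ballI allI)
    show "linear (\<phi> y)" for y
      by (simp add: \<phi>_def linear_iff sum.distrib sum_distrib_left algebra_simps)
    show "smooth_on M (\<lambda>y. \<phi> y v)" for v
      unfolding \<phi>_def by (intro smooth_on_sum smooth_on_mult smooth_on_const open_M A)
  qed
  have h_sym: "transpose (h y) = h y" if y: "y \<in> M" for y
  proof -
    obtain p where p: "p \<in> U" "y = \<psi> p" using y by auto
    have "G i j y = G j i y" for i j
      unfolding p(2) G(2)[OF p(1)] metric_form_def by simp
    then show ?thesis by (simp add: h_def transpose_def vec_eq_iff)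
  qed
  have frame: "\<exists>P. invertible P \<and> transpose P ** h y ** P = lorentz_form" if y: "y \<in> M" for y
  proof -
    obtain p where p: "p \<in> U" "y = \<psi> p" using y by auto
    show ?thesis unfolding p(2) by (rule metric_form_lorentzian[OF p(1) met[OF p(1)]])
  qed
  have lor: "lorentzian_metric M h"
    unfolding lorentzian_metric_def using h_smooth h_sym frame by blast
  have inv: "invertible (h y)" if "y \<in> M" for y
    using frame[OF that] lorentz_invertible(1) by blast
  obtain \<Gamma> where \<Gamma>: "connection_on M \<Gamma>" "\<And>y u v. y \<in> M \<Longrightarrow> \<Gamma> y u v = \<Gamma> y v u"
    "\<And>y u v w. y \<in> M \<Longrightarrow> FD (\<lambda>z. met h z v w) y u
        = met h y (\<Gamma> y u v) w + met h y v (\<Gamma> y u w) + \<phi> y u * met h y v w"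
    using weyl_connection_exists[OF open_M h_smooth h_sym inv \<phi>_form] by metis
  have null: "met h (\<psi> p) (w2 p) (w2 p) = 0" if "p \<in> U" for p
    unfolding met[OF that] by (simp add: metric_form_def \<theta>_w[OF that])
  interpret weyl_chart U F \<psi> h \<Gamma> \<phi>
    by unfold_locales (fact \<Gamma> h_smooth h_sym \<phi>_form null met_nondegenerate[OF inv])+
  \<comment> \<open>By construction \<open>\<phi>\<close>(w_2) = \<partial>_2 \<open>log_q\<close>,
    the logarithmic derivative of \<open>q\<close>.\<close>
  have geo: "D2_geodesic \<psi> \<Gamma> p" if p: "p \<in> U" for p
  proof -
    have q: "q p = exp (log_q p)" if "p \<in> U" for p
      unfolding q_def met[OF that] by (simp add: metric_form_def \<theta>_w[OF that])
    have "d2 q p = d2 (\<lambda>p. exp (log_q p)) p"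
      by (rule d_cong(3)[OF p q])
    also have "\<dots> = exp (log_q p) * d2 log_q p"
      unfolding d2_def by (rule der_exp[OF p sm_log_q])
    finally show ?thesis
      unfolding D2_geodesic_iff[OF p] \<phi>[OF p] q[OF p] by (simp add: weyl_form_def \<theta>_w[OF p])
  qed
  show ?thesis
  proof (intro exI conjI ballI)
    show "einstein_weyl M (conformal_class M h) \<Gamma>"
      by (rule einstein_weyl_if_geodesic[OF lor geo])
    show "met h' (\<psi> p) (w2 p) (w2 p) = 0" if h': "h' \<in> conformal_class M h" and p: "p \<in> U" for h' p
    proof -
      obtain c where c: "h' (\<psi> p) = c *\<^sub>R h (\<psi> p)"
        using h' p by (auto simp: conformal_class_def)
      show ?thesis using met_conformal[of h' "\<psi> p" c h, OF c] null[OF p] by simp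
    qed
  qed (rule geo)
qed

end

section \<open>Totally geodesic surfaces and changes of coordinates\<close>

lemma span_D2: "v \<in> span {e2, e1} \<longleftrightarrow> fst v = 0 \<and> fst (snd v) = 0"
proof
  assume "v \<in> span {e2, e1}"
  then show "fst v = 0 \<and> fst (snd v) = 0"
    by (induction rule: span_induct_alt) (auto simp: e1_def e2_def)
next
  assume v: "fst v = 0 \<and> fst (snd v) = 0"
  have "v = snd (snd (snd v)) *\<^sub>R e2 + fst (snd (snd v)) *\<^sub>R e1"
    using v by (simp add: e1_def e2_def prod_eq_iff)
  moreover have "snd (snd (snd v)) *\<^sub>R e2 + fst (snd (snd v)) *\<^sub>R e1 \<in> span {e2, e1}"
    by (intro span_add span_scale span_base) simp_all
  ultimately show "v \<in> span {e2, e1}" by (rule ssubst)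
qed

lemma FD_in_span_D2:
  fixes c :: "'a::real_normed_vector \<Rightarrow> jet"
  assumes N: "open N" "s \<in> N" and c: "c differentiable (at s)" "\<And>s. s \<in> N \<Longrightarrow> c s \<in> span {e2, e1}"
  shows "FD c s a \<in> span {e2, e1}"
proof -
  have 1: "FD (\<lambda>s. fst (c s)) s a = 0"
    by (subst FD_cong[OF N, where g = "\<lambda>_. 0"]) (use c(2) in \<open>auto simp: span_D2\<close>)
  have 2: "FD (\<lambda>s. fst (snd (c s))) s a = 0"
    by (subst FD_cong[OF N, where g = "\<lambda>_. 0"]) (use c(2) in \<open>auto simp: span_D2\<close>)
  have "bounded_linear (\<lambda>v::jet. fst (snd v))"
    by (intro bounded_linear_intros)
  from FD_bounded_linear[OF this c(1)] 2 have "fst (snd (FD c s a)) = 0" by simp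
  moreover have "fst (FD c s a) = 0"
    using FD_bounded_linear[OF bounded_linear_fst c(1)] 1 by simp
  ultimately show ?thesis by (simp add: span_D2)
qed

lemma FD_FD_along:
  fixes \<pi> :: "'a::euclidean_space \<Rightarrow> 'b::real_normed_vector" and \<iota> :: "'c::real_normed_vector \<Rightarrow> 'a"
  assumes U: "open U" "smooth_on U \<pi>" and N: "open N" "\<iota> ` N \<subseteq> U" "s \<in> N"
    and d: "\<iota> differentiable (at s)" "c differentiable (at s)"
  shows "FD (\<lambda>s. FD \<pi> (\<iota> s) (c s)) s a
    = FD (\<lambda>q. FD \<pi> q (c s)) (\<iota> s) (FD \<iota> s a) + FD \<pi> (\<iota> s) (FD c s a)"
  by (rule FD_linear_field[where L = "\<lambda>y. FD \<pi> y", OF N(1,2) U(1) smooth_on_linear_FD[OF U(2)]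
        smooth_on_FD_const[OF U(2)] N(3) d])

lemma totally_geodesic_if_D2_geodesic:
  assumes U: "open U" "smooth_on U \<pi>" and geo: "\<And>p. p \<in> U \<Longrightarrow> D2_geodesic \<pi> \<Gamma> p"
    and \<iota>: "integral_manifold_D2 U N \<iota>"
  shows "totally_geodesic \<Gamma> N (\<pi> \<circ> \<iota>)"
  unfolding totally_geodesic_def Let_def
proof (intro allI impI ballI)
  fix b :: "real \<times> real \<Rightarrow> real \<times> real" and s a
  assume b: "smooth_on N b" and s: "s \<in> N"
  have N: "open N" "smooth_on N \<iota>" "\<iota> ` N \<subseteq> U"
    and rng: "\<And>s. s \<in> N \<Longrightarrow> range (FD \<iota> s) = span {e2, e1}"
    using \<iota> by (auto simp: integral_manifold_D2_def)
  have \<iota>s: "\<iota> s \<in> U" if "s \<in> N" for s using N(3) that by auto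
  \<comment> \<open>The lift of the tangent field to the jets. Its derivative stays in the fixed
    plane, so the extra term of the product rule is tangent.\<close>
  define c where "c s = FD \<iota> s (b s)" for s
  have c: "smooth_on N c" unfolding c_def[abs_def] by (intro smooth_on_FD N b)
  have c_span: "c s \<in> span {e2, e1}" if "s \<in> N" for s
    using rng[OF that] unfolding c_def by blast
  have T: "FD (\<pi> \<circ> \<iota>) s v = FD \<pi> (\<iota> s) (FD \<iota> s v)" if "s \<in> N" for s v
    using FD_compose[OF smooth_on_differentiable[OF N(2) that] smooth_on_differentiable[OF U(2) \<iota>s[OF that]]]
    by (simp add: o_def)
  have rT: "range (FD (\<pi> \<circ> \<iota>) s) = FD \<pi> (\<iota> s) ` span {e2, e1}"
    using rng[OF s] T[OF s] by (metis (no_types, lifting) image_image image_cong)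
  have "FD (\<lambda>s. FD (\<pi> \<circ> \<iota>) s (b s)) s a = FD (\<lambda>s. FD \<pi> (\<iota> s) (c s)) s a"
    by (subst FD_cong[OF N(1) s, where g = "\<lambda>s. FD \<pi> (\<iota> s) (c s)"]) (simp_all add: T c_def)
  also have "\<dots> = FD (\<lambda>q. FD \<pi> q (c s)) (\<iota> s) (FD \<iota> s a) + FD \<pi> (\<iota> s) (FD c s a)"
    by (rule FD_FD_along[OF U N(1,3) s smooth_on_differentiable[OF N(2) s] smooth_on_differentiable[OF c s]])
  finally have Y: "FD (\<lambda>s. FD (\<pi> \<circ> \<iota>) s (b s)) s a
    = FD (\<lambda>q. FD \<pi> q (c s)) (\<iota> s) (FD \<iota> s a) + FD \<pi> (\<iota> s) (FD c s a)" .
  have "FD \<iota> s a \<in> span {e2, e1}" using rng[OF s] by blast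
  then have 1: "FD (\<lambda>q. FD \<pi> q (c s)) (\<iota> s) (FD \<iota> s a)
      + \<Gamma> (\<pi> (\<iota> s)) (FD \<pi> (\<iota> s) (FD \<iota> s a)) (FD \<pi> (\<iota> s) (c s)) \<in> FD \<pi> (\<iota> s) ` span {e2, e1}"
    using geo[OF \<iota>s[OF s]] c_span[OF s] unfolding D2_geodesic_def by blast
  have 2: "FD \<pi> (\<iota> s) (FD c s a) \<in> FD \<pi> (\<iota> s) ` span {e2, e1}"
    using FD_in_span_D2[OF N(1) s smooth_on_differentiable[OF c s] c_span] by blast
  have "subspace (FD \<pi> (\<iota> s) ` span {e2, e1})"
    by (intro linear_subspace_image smooth_on_linear_FD[OF U(2)] \<iota>s[OF s] subspace_span)
  from subspace_add[OF this 1 2]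
  show "FD (\<lambda>s. FD (\<pi> \<circ> \<iota>) s (b s)) s a
      + \<Gamma> ((\<pi> \<circ> \<iota>) s) (FD (\<pi> \<circ> \<iota>) s a) (FD (\<pi> \<circ> \<iota>) s (b s)) \<in> range (FD (\<pi> \<circ> \<iota>) s)"
    unfolding rT Y T[OF s] by (simp add: c_def algebra_simps)
qed

text \<open>The affine plane through \<open>p\<close> spanned by \<open>e1\<close> and
  \<open>e2\<close>, cut down to \<open>U\<close>, is an integral manifold on which constant test
  fields recover the pointwise condition.\<close>

lemma D2_geodesic_if_totally_geodesic:
  assumes U: "open U" "smooth_on U \<pi>"
    and tg: "\<And>N \<iota>. integral_manifold_D2 U N \<iota> \<Longrightarrow> totally_geodesic \<Gamma> N (\<pi> \<circ> \<iota>)"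
    and p: "p \<in> U"
  shows "D2_geodesic \<pi> \<Gamma> p"
  unfolding D2_geodesic_def
proof (intro ballI)
  fix a b assume a: "a \<in> span {e2, e1}" and b: "b \<in> span {e2, e1}"
  define j :: "real \<times> real \<Rightarrow> jet" where "j s = fst s *\<^sub>R e2 + snd s *\<^sub>R e1" for s
  have j: "bounded_linear j" unfolding j_def by (intro bounded_linear_intros)
  have jr: "range j = span {e2, e1}"
  proof (intro equalityI subsetI)
    fix v assume v: "v \<in> span {e2, e1}"
    have "v = j (snd (snd (snd v)), fst (snd (snd v)))"
      using v[unfolded span_D2] by (simp add: j_def e1_def e2_def prod_eq_iff)
    then show "v \<in> range j" by (rule range_eqI)
  next
    fix v assume "v \<in> range j"
    then show "v \<in> span {e2, e1}" unfolding span_D2 by (auto simp: j_def e1_def e2_def)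
  qed
  define N where "N = (\<lambda>s. p + j s) -` U"
  have N: "open N"
    unfolding N_def by (intro open_vimage[OF U(1)] continuous_intros linear_continuous_on j)
  have 0: "0 \<in> N" "j 0 = 0" using p linear_0[OF bounded_linear.linear[OF j]] by (simp_all add: N_def)
  have sm: "smooth_on N (\<lambda>s. p + j s)"
    by (intro smooth_on_add smooth_on_const smooth_on_bounded_linear[OF N j] smooth_on_ident N)
  have FDj: "FD (\<lambda>s. p + j s) s = j" for s
    by (rule FD_I) (auto intro!: derivative_eq_intros bounded_linear_imp_has_derivative j)
  have \<iota>: "integral_manifold_D2 U N (\<lambda>s. p + j s)"
    unfolding integral_manifold_D2_def using N sm by (auto simp: FDj jr N_def)
  obtain \<alpha> \<beta> where ab: "a = j \<alpha>" "b = j \<beta>" using a b jr by blast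
  have T: "FD (\<pi> \<circ> (\<lambda>s. p + j s)) s v = FD \<pi> (p + j s) (j v)" if "s \<in> N" for s v
    using FD_compose[OF smooth_on_differentiable[OF sm that] smooth_on_differentiable[OF U(2), of "p + j s"]] that
    by (simp add: o_def FDj N_def)
  have "FD (\<lambda>s. FD (\<pi> \<circ> (\<lambda>s. p + j s)) s \<beta>) 0 \<alpha> = FD (\<lambda>s. FD \<pi> (p + j s) b) 0 \<alpha>"
    by (subst FD_cong[OF N 0(1), where g = "\<lambda>s. FD \<pi> (p + j s) b"]) (simp_all add: T ab)
  also have "\<dots> = FD (\<lambda>q. FD \<pi> q b) (p + j 0) (FD (\<lambda>s. p + j s) 0 \<alpha>)"
    using smooth_on_differentiable[OF smooth_on_FD_const[OF U(2)] p] smooth_on_differentiable[OF sm 0(1)]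
    by (intro FD_compose) (simp_all add: 0)
  finally have Y: "FD (\<lambda>s. FD (\<pi> \<circ> (\<lambda>s. p + j s)) s \<beta>) 0 \<alpha> = FD (\<lambda>q. FD \<pi> q b) p a"
    by (simp add: FDj 0 ab)
  have "range (FD (\<pi> \<circ> (\<lambda>s. p + j s)) 0) = FD \<pi> p ` span {e2, e1}"
    unfolding jr[symmetric] by (auto simp: T[OF 0(1)] 0)
  moreover have "FD (\<lambda>s. FD (\<pi> \<circ> (\<lambda>s. p + j s)) s \<beta>) 0 \<alpha>
      + \<Gamma> ((\<pi> \<circ> (\<lambda>s. p + j s)) 0) (FD (\<pi> \<circ> (\<lambda>s. p + j s)) 0 \<alpha>) (FD (\<pi> \<circ> (\<lambda>s. p + j s)) 0 \<beta>)
      \<in> range (FD (\<pi> \<circ> (\<lambda>s. p + j s)) 0)"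
    using tg[OF \<iota>] smooth_on_const[OF N, of \<beta>] 0(1) unfolding totally_geodesic_def Let_def by blast
  ultimately show "FD (\<lambda>q. FD \<pi> q b) p a + \<Gamma> (\<pi> p) (FD \<pi> p a) (FD \<pi> p b) \<in> FD \<pi> p ` span {e2, e1}"
    unfolding Y by (simp add: T[OF 0(1)] 0 ab)
qed

text \<open>Stated for an arbitrary map and with the pointwise geodesic condition in place of
  surfaces, so that it can be compared under composition.\<close>

definition EW_chart :: "jet set \<Rightarrow> (jet \<Rightarrow> real^3) \<Rightarrow> bool" where
  "EW_chart U \<psi> \<longleftrightarrow> (\<exists>c \<Gamma>. einstein_weyl (\<psi> ` U) c \<Gamma> \<and>
     (\<forall>h\<in>c. \<forall>p\<in>U. met h (\<psi> p) (FD \<psi> p e2) (FD \<psi> p e2) = 0) \<and> (\<forall>p\<in>U. D2_geodesic \<psi> \<Gamma> p))"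

lemma defines_einstein_weyl_iff:
  assumes "open U" "smooth_on U \<pi>"
  shows "defines_einstein_weyl U \<pi> \<longleftrightarrow> EW_chart U \<pi>"
proof -
  have "(\<forall>N \<iota>. integral_manifold_D2 U N \<iota> \<longrightarrow> totally_geodesic \<Gamma> N (\<pi> \<circ> \<iota>))
      \<longleftrightarrow> (\<forall>p\<in>U. D2_geodesic \<pi> \<Gamma> p)" for \<Gamma>
    using totally_geodesic_if_D2_geodesic[OF assms] D2_geodesic_if_totally_geodesic[OF assms] by blast
  then show ?thesis unfolding defines_einstein_weyl_def EW_chart_def by simp
qed

lemma (in chart) invariants_zero_if_EW_chart:
  assumes "EW_chart U \<psi>" and p: "p \<in> U"
  shows "W0 F p = 0 \<and> Cartan F p = 0"
proof -
  obtain c \<Gamma> where ew: "einstein_weyl M c \<Gamma>"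
    and null_c: "\<And>h p. h \<in> c \<Longrightarrow> p \<in> U \<Longrightarrow> met h (\<psi> p) (w2 p) (w2 p) = 0"
    and geo: "\<And>p. p \<in> U \<Longrightarrow> D2_geodesic \<psi> \<Gamma> p"
    using assms(1) unfolding EW_chart_def w2_def by blast
  obtain h where lor: "lorentzian_metric M h" and c: "c = conformal_class M h"
    using ew by (auto simp: einstein_weyl_def lorentzian_conformal_structure_def)
  have hc: "h \<in> c"
    unfolding c conformal_class_def using smooth_on_const[OF open_M, of "1::real"] by force
  have wc: "weyl_connection M c \<Gamma>" using ew by (simp add: einstein_weyl_def)
  have con: "connection_on M \<Gamma>" and tors: "\<And>y u v. y \<in> M \<Longrightarrow> \<Gamma> y u v = \<Gamma> y v u"
    using wc unfolding weyl_connection_def torsion_const by auto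
  have "\<forall>h\<in>c. \<exists>\<phi>. one_form_on M \<phi> \<and>
        (\<forall>y\<in>M. \<forall>u v w. cov_metric \<Gamma> h (\<lambda>_. u) (\<lambda>_. v) (\<lambda>_. w) y = \<phi> y u * met h y v w)"
    using wc unfolding weyl_connection_def by (rule conjunct2[OF conjunct2])
  from bspec[OF this hc] obtain \<phi> where \<phi>: "one_form_on M \<phi>"
    "\<forall>y\<in>M. \<forall>u v w. cov_metric \<Gamma> h (\<lambda>_. u) (\<lambda>_. v) (\<lambda>_. w) y = \<phi> y u * met h y v w"
    by (elim exE conjE)
  have h_smooth: "smooth_on M h" and h_sym: "\<And>y. y \<in> M \<Longrightarrow> transpose (h y) = h y"
    and inv: "\<And>y. y \<in> M \<Longrightarrow> invertible (h y)"
    using lor lorentz_invertible(1) unfolding lorentzian_metric_def by blast+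
  interpret weyl_chart U F \<psi> h \<Gamma> \<phi>
  proof
    show "FD (\<lambda>z. met h z v w) y u = met h y (\<Gamma> y u v) w + met h y v (\<Gamma> y u w) + \<phi> y u * met h y v w"
      if "y \<in> M" for y u v w
      using bspec[OF \<phi>(2) that, rule_format, of u v w] by (simp add: cov_metric_const)
  qed (fact con tors h_smooth h_sym \<phi>(1) null_c[OF hc] met_nondegenerate[OF inv])+
  show ?thesis using W0_zero[OF p] Cartan_zero[OF geo p] by simp
qed

lemma (in fibred_chart) EW_chart_iff:
  "EW_chart U \<psi> \<longleftrightarrow> (\<forall>p\<in>U. W0 F p = 0 \<and> Cartan F p = 0)"
  using invariants_zero_if_EW_chart einstein_weyl_exists unfolding EW_chart_def w2_def by blast

text \<open>Both maps have the same image and use the same connections, so only the lines of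
  \<open>e2\<close> and the planes of \<open>e1\<close>, \<open>e2\<close> must correspond. The
  second derivative of \<open>\<Phi>\<close> adds a vector of the preserved plane, which does not
  affect tangency.\<close>

lemma EW_chart_compose:
  assumes U: "open U" "smooth_on U \<Phi>" and U': "open (\<Phi> ` U)" "smooth_on (\<Phi> ` U) \<pi>"
    and e2: "\<And>p. p \<in> U \<Longrightarrow> \<exists>k. k \<noteq> 0 \<and> FD \<Phi> p e2 = k *\<^sub>R e2"
    and D2: "\<And>p. p \<in> U \<Longrightarrow> FD \<Phi> p ` span {e2, e1} = span {e2, e1}"
  shows "EW_chart (\<Phi> ` U) \<pi> \<longleftrightarrow> EW_chart U (\<lambda>p. \<pi> (\<Phi> p))"
proof -
  let ?\<psi> = "\<lambda>p. \<pi> (\<Phi> p)"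
  let ?L = "span {e2, e1}"
  have d\<Phi>: "\<Phi> differentiable (at p)" and d\<pi>: "\<pi> differentiable (at (\<Phi> p))" if "p \<in> U" for p
    using that by (auto intro: smooth_on_differentiable[OF U(2)] smooth_on_differentiable[OF U'(2)])
  have F: "FD ?\<psi> p v = FD \<pi> (\<Phi> p) (FD \<Phi> p v)" if "p \<in> U" for p v
    by (rule FD_compose[OF d\<Phi>[OF that] d\<pi>[OF that]])
  have l\<pi>: "linear (FD \<pi> (\<Phi> p))" if "p \<in> U" for p
    using d\<pi>[OF that] by (rule linear_frechet_derivative)
  have null: "met h (?\<psi> p) (FD ?\<psi> p e2) (FD ?\<psi> p e2) = 0
      \<longleftrightarrow> met h (\<pi> (\<Phi> p)) (FD \<pi> (\<Phi> p) e2) (FD \<pi> (\<Phi> p) e2) = 0" if p: "p \<in> U" for p h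
  proof -
    obtain k where "k \<noteq> 0" "FD \<Phi> p e2 = k *\<^sub>R e2" using e2[OF p] by blast
    then show ?thesis by (simp add: F[OF p] linear_cmul[OF l\<pi>[OF p]] met_lin)
  qed
  have geo: "D2_geodesic ?\<psi> \<Gamma> p \<longleftrightarrow> D2_geodesic \<pi> \<Gamma> (\<Phi> p)" if p: "p \<in> U" for p \<Gamma>
  proof -
    let ?S = "FD \<pi> (\<Phi> p) ` ?L"
    define G where "G a b = FD (\<lambda>z. FD \<pi> z b) (\<Phi> p) a
      + \<Gamma> (\<pi> (\<Phi> p)) (FD \<pi> (\<Phi> p) a) (FD \<pi> (\<Phi> p) b)" for a b
    have S: "subspace ?S" by (intro linear_subspace_image l\<pi>[OF p] subspace_span)
    have S_eq: "FD ?\<psi> p ` ?L = ?S"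
      unfolding F[OF p] using D2[OF p] by (metis (no_types, lifting) image_image image_cong)
    have "FD (\<lambda>q. FD ?\<psi> q b) p a + \<Gamma> (?\<psi> p) (FD ?\<psi> p a) (FD ?\<psi> p b) \<in> ?S
        \<longleftrightarrow> G (FD \<Phi> p a) (FD \<Phi> p b) \<in> ?S" if b: "b \<in> ?L" for a b
    proof -
      have d: "(\<lambda>q. FD \<Phi> q b) differentiable (at p)"
        by (rule smooth_on_differentiable[OF smooth_on_FD_const[OF U(2)] p])
      have "FD (\<lambda>q. FD ?\<psi> q b) p a = FD (\<lambda>q. FD \<pi> (\<Phi> q) (FD \<Phi> q b)) p a"
        by (subst FD_cong[OF U(1) p F]) simp_all
      also have "\<dots> = FD (\<lambda>z. FD \<pi> z (FD \<Phi> p b)) (\<Phi> p) (FD \<Phi> p a)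
          + FD \<pi> (\<Phi> p) (FD (\<lambda>q. FD \<Phi> q b) p a)"
        by (rule FD_FD_along[OF U' U(1) subset_refl p d\<Phi>[OF p] d])
      finally have "FD (\<lambda>q. FD ?\<psi> q b) p a + \<Gamma> (?\<psi> p) (FD ?\<psi> p a) (FD ?\<psi> p b)
          = G (FD \<Phi> p a) (FD \<Phi> p b) + FD \<pi> (\<Phi> p) (FD (\<lambda>q. FD \<Phi> q b) p a)"
        by (simp add: G_def F[OF p])
      moreover have "FD (\<lambda>q. FD \<Phi> q b) p a \<in> ?L"
        using D2 b by (intro FD_in_span_D2[OF U(1) p d]) blast
      then have "FD \<pi> (\<Phi> p) (FD (\<lambda>q. FD \<Phi> q b) p a) \<in> ?S" by blast
      ultimately show ?thesis
        using subspace_add[OF S] subspace_diff[OF S] by (metis add_diff_cancel_right')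
    qed
    then have "D2_geodesic ?\<psi> \<Gamma> p \<longleftrightarrow> (\<forall>a\<in>?L. \<forall>b\<in>?L. G (FD \<Phi> p a) (FD \<Phi> p b) \<in> ?S)"
      unfolding D2_geodesic_def S_eq by blast
    also have "\<dots> \<longleftrightarrow> (\<forall>a\<in>FD \<Phi> p ` ?L. \<forall>b\<in>FD \<Phi> p ` ?L. G a b \<in> ?S)" by blast
    also have "\<dots> \<longleftrightarrow> D2_geodesic \<pi> \<Gamma> (\<Phi> p)"
      unfolding D2[OF p] D2_geodesic_def G_def ..
    finally show ?thesis .
  qed
  show ?thesis
    unfolding EW_chart_def image_image using null geo by (simp add: ball_simps(9))
qed

section \<open>Prolonged point transformations\<close>

lemma base_point_alt: "base_point p = (fst p, fst (snd p))"
  by (simp add: base_point_def split: prod.splits)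

lemma bounded_linear_base_point: "bounded_linear base_point"
  unfolding base_point_alt[abs_def] by (intro bounded_linear_intros)

locale point_change = ode U F for U F +
  fixes W :: "(real \<times> real) set" and \<tau> \<xi> :: "real \<times> real \<Rightarrow> real" and F' :: "jet \<Rightarrow> real"
  assumes pt: "point_transformation W \<tau> \<xi>" and base: "base_point ` U \<subseteq> W"
    and total_deriv_nonzero: "\<forall>p\<in>U. total_deriv (\<tau> \<circ> base_point) p \<noteq> 0"
    and F': "\<forall>p\<in>U. F' (prolong \<tau> \<xi> p) = XF F (new_x2 \<tau> \<xi>) p / total_deriv (\<tau> \<circ> base_point) p"
begin

text \<open>The total derivative in the prolongation formulas is X_F for the zero equation, so the
  bracket relations are available for it as well.\<close>

sublocale flat: ode U "\<lambda>_. 0"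
  by unfold_locales (simp add: third_order_ode_def open_U smooth_on_const)

abbreviation dbase :: "real \<times> real \<Rightarrow> real \<times> real \<Rightarrow> real \<times> real" where
  "dbase z \<equiv> FD (\<lambda>z. (\<tau> z, \<xi> z)) z"

text \<open>The pair (\<open>lam\<close>, \<open>mu\<close>) is the image of the direction (1, x1)
  under the differential of the point transformation.\<close>

definition lam :: "jet \<Rightarrow> real" where "lam = total_deriv (\<tau> \<circ> base_point)"
definition mu :: "jet \<Rightarrow> real" where "mu = total_deriv (\<xi> \<circ> base_point)"

lemma W: "open W" "smooth_on W \<tau>" "smooth_on W \<xi>" "inj_on (\<lambda>z. (\<tau> z, \<xi> z)) W"
  "\<And>z. z \<in> W \<Longrightarrow> bij (dbase z)"
  using pt by (auto simp: point_transformation_def)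

lemma base_W: "p \<in> U \<Longrightarrow> base_point p \<in> W"
  using base by auto

lemma dbase_eq: "z \<in> W \<Longrightarrow> dbase z v = (FD \<tau> z v, FD \<xi> z v)"
  using FD_I[OF has_derivative_Pair[OF smooth_on_has_derivative[OF W(2)] smooth_on_has_derivative[OF W(3)]]]
  by simp

lemma dbase_zero:
  assumes "z \<in> W" "FD \<tau> z v = 0" "FD \<xi> z v = 0"
  shows "v = 0"
proof -
  have "dbase z v = dbase z 0"
    using dbase_eq[OF assms(1)] assms linear_0[OF smooth_on_linear_FD[OF W(2) assms(1)]]
      linear_0[OF smooth_on_linear_FD[OF W(3) assms(1)]] by simp
  then show ?thesis by (rule injD[OF bij_is_inj[OF W(5)[OF assms(1)]]])
qed

context
  fixes f :: "real \<times> real \<Rightarrow> real"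
  assumes f: "smooth_on W f"
begin

lemma sm_base: "sm (f \<circ> base_point)"
  unfolding o_def
  by (rule smooth_on_compose[OF open_U W(1) base
        smooth_on_bounded_linear[OF open_U bounded_linear_base_point smooth_on_ident[OF open_U]] f])

lemma FD_base: "p \<in> U \<Longrightarrow> FD (f \<circ> base_point) p v = FD f (base_point p) (base_point v)"
  unfolding o_def
  using FD_compose[OF bounded_linear_imp_differentiable[OF bounded_linear_base_point]
      smooth_on_differentiable[OF f base_W], of p v]
    FD_I[OF bounded_linear_imp_has_derivative[OF bounded_linear_base_point]] by simp

lemma d_base:
  assumes "p \<in> U"
  shows "d2 (f \<circ> base_point) p = 0" "d1 (f \<circ> base_point) p = 0"
    "d0 (f \<circ> base_point) p = FD f (base_point p) (0, 1)"
    "total_deriv (f \<circ> base_point) p = FD f (base_point p) (1, fst (snd (snd p)))"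
  using FD_base[OF assms] linear_0[OF smooth_on_linear_FD[OF f base_W[OF assms]]]
  by (simp_all add: d0_def d1_def d2_def total_deriv_def XF_def deriv_along_def base_point_alt
      e0_def e1_def e2_def flat.total_field_alt zero_prod_def)

lemma sm_total: "sm (total_deriv (f \<circ> base_point))"
  unfolding total_deriv_def by (rule flat.sm_XF[OF sm_base])

lemma d_total:
  assumes p: "p \<in> U"
  shows "d2 (total_deriv (f \<circ> base_point)) p = 0"
    "d1 (total_deriv (f \<circ> base_point)) p = FD f (base_point p) (0, 1)"
proof -
  have "XF (\<lambda>_. 0) (d1 (f \<circ> base_point)) p = 0" "XF (\<lambda>_. 0) (d2 (f \<circ> base_point)) p = 0"
    using flat.XF_cong[OF p d_base(1)] flat.XF_cong[OF p d_base(2)] flat.XF_rules(2)[OF p] by simp_all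
  then show "d2 (total_deriv (f \<circ> base_point)) p = 0"
    "d1 (total_deriv (f \<circ> base_point)) p = FD f (base_point p) (0, 1)"
    unfolding total_deriv_def using flat.d_XF(2,3)[OF p sm_base] d_base[OF p] by simp_all
qed

text \<open>The second total derivative is affine in x2, with the x0-derivative of \<open>f\<close>
  as slope; injectivity of the prolongation in x2 rests on this.\<close>

lemma total_total:
  assumes p: "p \<in> U"
  defines "u \<equiv> (1, fst (snd (snd p)))"
  shows "total_deriv (total_deriv (f \<circ> base_point)) p
    = FD (\<lambda>z. FD f z u) (base_point p) u + FD f (base_point p) (0, snd (snd (snd p)))"
proof -
  have bl: "bounded_linear (\<lambda>p::jet. fst (snd (snd p)))"
    by (intro bounded_linear_intros)
  have c: "((\<lambda>p::jet. (1::real, fst (snd (snd p)))) has_derivative (\<lambda>v. (0, fst (snd (snd v))))) (at p)"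
    by (auto intro!: derivative_eq_intros bounded_linear_imp_has_derivative bl)
  have "FD (total_deriv (f \<circ> base_point)) p v
    = FD (\<lambda>q. FD f (base_point q) (1, fst (snd (snd q)))) p v" for v
    by (subst FD_cong[OF open_U p d_base(4)]) simp_all
  also have "\<dots> v = FD (\<lambda>z. FD f z u) (base_point p) (base_point v) + FD f (base_point p) (0, fst (snd (snd v)))" for v
    using FD_FD_along[OF W(1) f open_U base p bounded_linear_imp_differentiable[OF bounded_linear_base_point]
        differentiableI[OF c], of v]
    by (simp add: FD_I[OF c] FD_I[OF bounded_linear_imp_has_derivative[OF bounded_linear_base_point]] u_def)
  finally have *: "FD (total_deriv (f \<circ> base_point)) p v
    = FD (\<lambda>z. FD f z u) (base_point p) (base_point v) + FD f (base_point p) (0, fst (snd (snd v)))" for v .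
  have "total_deriv g p = FD g p (total_field (\<lambda>_. 0) p)" for g
    by (simp add: total_deriv_def XF_def deriv_along_def)
  then show ?thesis
    unfolding * by (simp add: flat.total_field_alt base_point_alt u_def *)
qed

end

lemmas sm_lam = sm_total[OF W(2), folded lam_def] and sm_mu = sm_total[OF W(3), folded mu_def]

lemma lam_nonzero: "p \<in> U \<Longrightarrow> lam p \<noteq> 0"
  using total_deriv_nonzero by (simp add: lam_def)

abbreviation x1' :: "jet \<Rightarrow> real" where "x1' \<equiv> new_x1 \<tau> \<xi>"
abbreviation x2' :: "jet \<Rightarrow> real" where "x2' \<equiv> new_x2 \<tau> \<xi>"

lemma x1'_alt: "x1' = (\<lambda>p. mu p / lam p)"
  by (simp add: fun_eq_iff new_x1_def mu_def lam_def)

lemma x2'_alt: "x2' = (\<lambda>p. total_deriv x1' p / lam p)"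
  by (simp add: fun_eq_iff new_x2_def lam_def)

lemma sm_x1': "sm x1'"
  unfolding x1'_alt by (intro smooth_on_divide open_U sm_lam sm_mu lam_nonzero)

lemma sm_x2': "sm x2'"
  unfolding x2'_alt
  by (intro smooth_on_divide open_U sm_lam lam_nonzero)
     (simp_all add: total_deriv_def flat.sm_XF[OF sm_x1', unfolded eta_contract_eq])

lemma mu_eq: "p \<in> U \<Longrightarrow> mu p = x1' p * lam p"
  by (simp add: x1'_alt lam_nonzero)

text \<open>Differentiating the product form of \<open>mu\<close> gives the derivatives of
  \<open>x1'\<close> without the quotient rule.\<close>

lemma der_mu:
  assumes p: "p \<in> U"
  shows "deriv_along Y mu p = x1' p * deriv_along Y lam p + deriv_along Y x1' p * lam p"
proof -
  have "deriv_along Y mu p = deriv_along Y (\<lambda>p. x1' p * lam p) p"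
    by (rule deriv_along_cong[OF open_U p mu_eq])
  then show ?thesis by (simp add: der_rules[OF p] sm_x1' sm_lam)
qed

text \<open>The Jacobian determinant of the point transformation divided by \<open>lam\<close>. It
  governs both how x1 enters \<open>x1'\<close> and how x2 enters \<open>x2'\<close>.\<close>

definition jacobian :: "jet \<Rightarrow> real" where
  "jacobian p = FD \<xi> (base_point p) (0, 1) - x1' p * FD \<tau> (base_point p) (0, 1)"

lemma lam_base: "p \<in> U \<Longrightarrow> lam p = FD \<tau> (base_point p) (1, fst (snd (snd p)))"
  and mu_base: "p \<in> U \<Longrightarrow> mu p = FD \<xi> (base_point p) (1, fst (snd (snd p)))"
  unfolding lam_def mu_def using d_base(4)[OF W(2)] d_base(4)[OF W(3)] by auto

text \<open>Otherwise the differential of the point transformation would make (0, 1) and (1, x1)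
  parallel, and their combination with coefficients \<open>lam p\<close> and \<open>-k\<close> would
  lie in its kernel.\<close>

lemma jacobian_nonzero:
  assumes p: "p \<in> U"
  shows "jacobian p \<noteq> 0"
proof
  assume j: "jacobian p = 0"
  let ?z = "base_point p" and ?u = "(1::real, fst (snd (snd p)))"
  note z = base_W[OF p]
  note l\<tau> = smooth_on_linear_FD[OF W(2) z] and l\<xi> = smooth_on_linear_FD[OF W(3) z]
  define k where "k = FD \<tau> ?z (0, 1)"
  have \<xi>: "FD \<xi> ?z (0, 1) = x1' p * k" using j by (simp add: jacobian_def k_def)
  have "lam p *\<^sub>R (0, 1) - k *\<^sub>R ?u = 0"
  proof (rule dbase_zero[OF z])
    show "FD \<tau> ?z (lam p *\<^sub>R (0, 1) - k *\<^sub>R ?u) = 0"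
      unfolding linear_diff[OF l\<tau>] linear_cmul[OF l\<tau>] lam_base[OF p, symmetric] k_def by simp
    show "FD \<xi> ?z (lam p *\<^sub>R (0, 1) - k *\<^sub>R ?u) = 0"
      unfolding linear_diff[OF l\<xi>] linear_cmul[OF l\<xi>] mu_base[OF p, symmetric] \<xi> mu_eq[OF p] by simp
  qed
  then have "k = 0" "lam p = 0" by (auto simp: zero_prod_def)
  then show False using lam_nonzero[OF p] by simp
qed

lemma d_x1':
  assumes p: "p \<in> U"
  shows "d2 x1' p = 0" "d1 x1' p = jacobian p / lam p"
proof -
  note d\<tau> = d_total[OF W(2) p, folded lam_def] and d\<xi> = d_total[OF W(3) p, folded mu_def]
  show "d2 x1' p = 0"
    using der_mu[OF p, of "\<lambda>_. e2"] d\<tau>(1) d\<xi>(1) lam_nonzero[OF p] by (simp add: d2_def)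
  show "d1 x1' p = jacobian p / lam p"
    using der_mu[OF p, of "\<lambda>_. e1"] d\<tau>(2) d\<xi>(2) lam_nonzero[OF p]
    by (simp add: d1_def jacobian_def field_simps)
qed

lemma total_x1': "p \<in> U \<Longrightarrow> total_deriv x1' p = x2' p * lam p"
  by (simp add: x2'_alt lam_nonzero)

text \<open>For the zero equation the bracket of \<partial>_2 with the total derivative is
  \<partial>_1, so the x2-dependence of \<open>x2'\<close> comes from the x1-dependence of
  \<open>x1'\<close>.\<close>

lemma d2_x2':
  assumes p: "p \<in> U"
  shows "d2 x2' p = jacobian p / (lam p)\<^sup>2"
proof -
  have "XF (\<lambda>_. 0) (d2 x1') p = 0"
    using flat.XF_cong[OF p d_x1'(1)] flat.XF_rules(2)[OF p] by simp
  then have "d2 (total_deriv x1') p = jacobian p / lam p"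
    unfolding total_deriv_def using flat.d_XF(3)[OF p sm_x1'] d_x1'[OF p] by (simp add: d2_def deriv_along_def)
  moreover have "d2 (total_deriv x1') p = d2 (\<lambda>p. x2' p * lam p) p"
    by (rule d_cong(3)[OF p total_x1'])
  moreover have "d2 (\<lambda>p. x2' p * lam p) p = d2 x2' p * lam p"
    using d_total(1)[OF W(2) p, folded lam_def] by (simp add: d2_rules[OF p] sm_x2' sm_lam)
  ultimately show ?thesis using lam_nonzero[OF p] by (simp add: field_simps power2_eq_square)
qed

lemma XF_total: "p \<in> U \<Longrightarrow> sm f \<Longrightarrow> XF F f p = total_deriv f p + F p * d2 f p"
proof -
  assume p: "p \<in> U" and f: "sm f"
  have "total_field F p = total_field (\<lambda>_. 0) p + F p *\<^sub>R e2"
    by (simp add: total_field_alt flat.total_field_alt e2_def)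
  then show ?thesis
    by (simp add: XF_def total_deriv_def deriv_along_def FD_lincomb[OF p f] d2_def)
qed

abbreviation \<Phi> :: "jet \<Rightarrow> jet" where "\<Phi> \<equiv> prolong \<tau> \<xi>"

lemma \<Phi>_alt: "\<Phi> = (\<lambda>p. ((\<tau> \<circ> base_point) p, (\<xi> \<circ> base_point) p, x1' p, x2' p))"
  by (simp add: fun_eq_iff prolong_def)

lemma sm_\<Phi>: "sm \<Phi>"
  unfolding \<Phi>_alt by (intro smooth_on_Pair open_U sm_base W sm_x1' sm_x2')

lemma FD_\<Phi>:
  assumes p: "p \<in> U"
  shows "FD \<Phi> p v = (FD \<tau> (base_point p) (base_point v), FD \<xi> (base_point p) (base_point v), FD x1' p v, FD x2' p v)"
proof -
  have "FD \<Phi> p = (\<lambda>v. (FD (\<tau> \<circ> base_point) p v, FD (\<xi> \<circ> base_point) p v, FD x1' p v, FD x2' p v))"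
    unfolding \<Phi>_alt
    by (intro FD_I has_derivative_Pair smooth_on_has_derivative[OF _ p] sm_base W sm_x1' sm_x2')
  then show ?thesis by (simp add: FD_base[OF _ p] W)
qed

text \<open>Solutions go to solutions with the parameter speed changed by \<open>lam\<close>. The
  first three new coordinates do not depend on x2, so X_F acts on them as the total derivative; on
  \<open>x2'\<close> the equation for \<open>F'\<close> enters.\<close>

lemma FD_\<Phi>_total:
  assumes p: "p \<in> U"
  shows "FD \<Phi> p (total_field F p) = lam p *\<^sub>R total_field F' (\<Phi> p)"
proof -
  have t: "FD f (base_point p) (base_point (total_field F p)) = total_deriv (f \<circ> base_point) p"
    if "smooth_on W f" for f
    using d_base(4)[OF that p] by (simp add: base_point_alt total_field_alt)
  have "XF F x1' p = x2' p * lam p"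
    using XF_total[OF p sm_x1'] d_x1'(1)[OF p] total_x1'[OF p] by simp
  moreover have "XF F x2' p = F' (\<Phi> p) * lam p"
    using F' p lam_nonzero[OF p] by (simp add: lam_def)
  ultimately show ?thesis
    unfolding FD_\<Phi>[OF p] t[OF W(2)] t[OF W(3)] FD_d(4)
    using mu_eq[OF p] by (simp add: \<Phi>_alt total_field_def lam_def mu_def)
qed

lemma FD_\<Phi>_e2:
  assumes p: "p \<in> U"
  shows "FD \<Phi> p e2 = (jacobian p / (lam p)\<^sup>2) *\<^sub>R e2"
proof -
  have "base_point e2 = 0" by (simp add: base_point_alt e2_def zero_prod_def)
  then show ?thesis
    using linear_0[OF smooth_on_linear_FD[OF W(2) base_W[OF p]]]
      linear_0[OF smooth_on_linear_FD[OF W(3) base_W[OF p]]]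
    by (simp add: FD_\<Phi>[OF p] FD_d d_x1'(1)[OF p] d2_x2'[OF p]) (simp add: e2_def)
qed

lemma linear_FD_\<Phi>: "p \<in> U \<Longrightarrow> linear (FD \<Phi> p)"
  by (rule smooth_on_linear_FD[OF sm_\<Phi>])

text \<open>The differential is block triangular in the base directions, x1 and x2, with invertible
  diagonal blocks.\<close>

lemma inj_FD_\<Phi>:
  assumes p: "p \<in> U"
  shows "inj (FD \<Phi> p)"
proof -
  have "v = 0" if v: "FD \<Phi> p v = 0" for v
  proof -
    have "base_point v = 0"
      by (rule dbase_zero[OF base_W[OF p]]) (use v in \<open>simp_all add: FD_\<Phi>[OF p] zero_prod_def\<close>)
    then obtain b c where vv: "v = b *\<^sub>R e1 + c *\<^sub>R e2"
      by (cases v) (auto simp: base_point_alt zero_prod_def e1_def e2_def)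
    have "FD x1' p v = 0" using v by (simp add: FD_\<Phi>[OF p] zero_prod_def)
    then have b: "b = 0"
      using jacobian_nonzero[OF p] lam_nonzero[OF p]
      by (simp add: vv FD_lincomb[OF p sm_x1'] FD_d d_x1'[OF p])
    have "FD x2' p v = 0" using v by (simp add: FD_\<Phi>[OF p] zero_prod_def)
    then have "c = 0"
      using jacobian_nonzero[OF p] lam_nonzero[OF p]
      by (simp add: vv b FD_lincomb[OF p sm_x2'] FD_d d2_x2'[OF p])
    then show ?thesis using vv b by simp
  qed
  then show ?thesis using linear_injective_0[OF linear_FD_\<Phi>[OF p]] by blast
qed

lemma surj_FD_\<Phi>: "p \<in> U \<Longrightarrow> surj (FD \<Phi> p)"
  using linear_injective_imp_surjective[OF linear_FD_\<Phi> inj_FD_\<Phi>] by blast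

text \<open>The base components of the image vanish, which gives one inclusion; injectivity and
  dimension give equality.\<close>

lemma FD_\<Phi>_D2:
  assumes p: "p \<in> U"
  shows "FD \<Phi> p ` span {e2, e1} = span {e2, e1}"
proof -
  have 1: "FD \<Phi> p ` span {e2, e1} \<subseteq> span {e2, e1}"
  proof (rule image_subsetI)
    fix v :: jet assume "v \<in> span {e2, e1}"
    then have "base_point v = 0" by (simp add: span_D2 base_point_alt zero_prod_def)
    then show "FD \<Phi> p v \<in> span {e2, e1}"
      using linear_0[OF smooth_on_linear_FD[OF W(2) base_W[OF p]]]
        linear_0[OF smooth_on_linear_FD[OF W(3) base_W[OF p]]]
      by (simp add: span_D2 FD_\<Phi>[OF p])
  qed
  have 2: "dim (FD \<Phi> p ` span {e2, e1}) = dim (span {e2, e1})"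
    by (rule dim_image_eq[OF linear_FD_\<Phi>[OF p] inj_on_subset[OF inj_FD_\<Phi>[OF p] subset_UNIV]])
  show ?thesis
    by (rule subspace_dim_equal[OF linear_subspace_image[OF linear_FD_\<Phi>[OF p] subspace_span]
          subspace_span 1]) (simp only: 2)
qed

text \<open>The base point is recovered by injectivity of the point transformation, x1 from the
  slope by injectivity of its differential, and x2 because it enters \<open>x2'\<close> affinely
  with a non-zero factor.\<close>

lemma inj_on_\<Phi>: "inj_on \<Phi> U"
proof (rule inj_onI)
  fix p q assume p: "p \<in> U" and q: "q \<in> U" and eq: "\<Phi> p = \<Phi> q"
  let ?z = "base_point p"
  have "(\<lambda>z. (\<tau> z, \<xi> z)) (base_point p) = (\<lambda>z. (\<tau> z, \<xi> z)) (base_point q)"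
    using eq by (simp add: \<Phi>_alt)
  then have zq: "base_point q = ?z"
    using inj_onD[OF W(4)] base_W p q by metis
  have x1': "x1' q = x1' p" and x2': "x2' q = x2' p" using eq by (simp_all add: \<Phi>_alt)
  note z = base_W[OF p]
  note l\<tau> = smooth_on_linear_FD[OF W(2) z] and l\<xi> = smooth_on_linear_FD[OF W(3) z]
  let ?u = "\<lambda>p::jet. (1::real, fst (snd (snd p)))"
  \<comment> \<open>Both images are multiples of (1, \<open>x1' p\<close>), with factors
    \<open>lam p\<close> and \<open>lam q\<close>.\<close>
  have "lam q *\<^sub>R ?u p - lam p *\<^sub>R ?u q = 0"
  proof (rule dbase_zero[OF z])
    show "FD \<tau> ?z (lam q *\<^sub>R ?u p - lam p *\<^sub>R ?u q) = 0"
      unfolding linear_diff[OF l\<tau>] linear_cmul[OF l\<tau>]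
      using lam_base[OF p] lam_base[OF q] by (simp add: zq)
    show "FD \<xi> ?z (lam q *\<^sub>R ?u p - lam p *\<^sub>R ?u q) = 0"
      unfolding linear_diff[OF l\<xi>] linear_cmul[OF l\<xi>]
      unfolding mu_base[OF p, symmetric] mu_base[OF q, unfolded zq, symmetric] mu_eq[OF p] mu_eq[OF q] x1'
      by simp
  qed
  then have lam: "lam q = lam p" and "lam q * fst (snd (snd p)) = lam p * fst (snd (snd q))"
    by (auto simp: zero_prod_def)
  then have u: "fst (snd (snd q)) = fst (snd (snd p))" using lam_nonzero[OF p] by simp
  define a where "a = snd (snd (snd q)) - snd (snd (snd p))"
  have tt: "total_deriv (total_deriv (f \<circ> base_point)) q - total_deriv (total_deriv (f \<circ> base_point)) p
      = a * FD f ?z (0, 1)" if f: "smooth_on W f" for f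
  proof -
    have l: "linear (FD f ?z)" by (rule smooth_on_linear_FD[OF f z])
    have c: "FD f ?z (0, c) = c * FD f ?z (0, 1)" for c
      using linear_cmul[OF l, of c "(0, 1)"] by simp
    show ?thesis
      unfolding total_total[OF f p] total_total[OF f q] zq u a_def
        c[of "snd (snd (snd p))"] c[of "snd (snd (snd q))"]
      by (simp add: algebra_simps)
  qed
  have x: "total_deriv mu p = x1' p * total_deriv lam p + x2' p * lam p * lam p" if "p \<in> U" for p
    using der_mu[OF that, of "total_field (\<lambda>_. 0)"] total_x1'[OF that]
    by (simp add: total_deriv_def XF_def)
  \<comment> \<open>In the difference of the identity for \<open>mu\<close> at \<open>q\<close> and
    at \<open>p\<close> the terms with \<open>x2'\<close> cancel, which leaves the parts linear in
    \<open>a\<close>.\<close>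
  have "a * FD \<xi> ?z (0, 1) = x1' p * (a * FD \<tau> ?z (0, 1))"
    unfolding tt[OF W(2), folded lam_def, symmetric] tt[OF W(3), folded mu_def, symmetric]
    unfolding x[OF p] x[OF q] x1' x2' lam by (simp add: algebra_simps)
  then have "a * jacobian p = 0" by (simp add: jacobian_def algebra_simps)
  then have "a = 0" using jacobian_nonzero[OF p] by simp
  then show "p = q" using zq u by (simp add: a_def base_point_alt prod_eq_iff)
qed

text \<open>An integral curve of the new equation, pulled back by the inverse of
  \<open>\<Phi>\<close>, is a reparametrised integral curve of X_F. Along it a function killed by
  X_F has derivative zero.\<close>

lemma fibred_chart_compose:
  assumes \<pi>: "local_solution_space (\<Phi> ` U) F' \<pi>"
  shows "fibred_chart U F (\<lambda>p. \<pi> (\<Phi> p))"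
proof -
  have U': "open (\<Phi> ` U)" and s\<pi>: "smooth_on (\<Phi> ` U) \<pi>"
    and surj: "\<And>p. p \<in> U \<Longrightarrow> surj (FD \<pi> (\<Phi> p))"
    and ker: "\<And>p. p \<in> U \<Longrightarrow> FD \<pi> (\<Phi> p) (total_field F' (\<Phi> p)) = 0"
    and curve: "\<And>p q. p \<in> U \<Longrightarrow> q \<in> U \<Longrightarrow> \<pi> (\<Phi> p) = \<pi> (\<Phi> q) \<Longrightarrow> same_integral_curve (\<Phi> ` U) F' (\<Phi> p) (\<Phi> q)"
    using \<pi> by (auto simp: local_solution_space_def third_order_ode_def)
  have F: "FD (\<lambda>p. \<pi> (\<Phi> p)) p v = FD \<pi> (\<Phi> p) (FD \<Phi> p v)" if "p \<in> U" for p v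
    by (rule FD_compose[OF smooth_on_differentiable[OF sm_\<Phi> that]]) (simp add: smooth_on_differentiable[OF s\<pi>] that)
  show ?thesis
  proof
    show "sm (\<lambda>p. \<pi> (\<Phi> p))"
      by (rule smooth_on_compose[OF open_U U' subset_refl sm_\<Phi> s\<pi>])
    show "surj (FD (\<lambda>p. \<pi> (\<Phi> p)) p)" if p: "p \<in> U" for p
      using comp_surj[OF surj_FD_\<Phi>[OF p] surj[OF p]] F[OF p] by (simp add: o_def)
    show "FD (\<lambda>p. \<pi> (\<Phi> p)) p (total_field F p) = 0" if p: "p \<in> U" for p
      unfolding F[OF p] FD_\<Phi>_total[OF p]
      using ker[OF p] smooth_on_linear_FD[OF s\<pi>, of "\<Phi> p"] p by (simp add: linear_cmul)
  next
    fix f :: "jet \<Rightarrow> real" and p q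
    assume f: "sm f" and Xf: "\<And>p. p \<in> U \<Longrightarrow> XF F f p = 0" and p: "p \<in> U" and q: "q \<in> U"
      and eq: "\<pi> (\<Phi> p) = \<pi> (\<Phi> q)"
    obtain \<gamma> :: "real \<Rightarrow> jet" and a b where \<gamma>: "\<gamma> a = \<Phi> p" "\<gamma> b = \<Phi> q"
      "\<And>s. s \<in> closed_segment a b \<Longrightarrow> \<gamma> s \<in> \<Phi> ` U"
      "\<And>s. s \<in> closed_segment a b \<Longrightarrow>
        (\<gamma> has_vector_derivative total_field F' (\<gamma> s)) (at s within closed_segment a b)"
      using curve[OF p q eq] unfolding same_integral_curve_def by blast
    define \<Psi> where "\<Psi> = inv_into U \<Phi>"
    have \<Psi>: "\<Psi> (\<Phi> x) = x" if "x \<in> U" for x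
      unfolding \<Psi>_def by (rule inv_into_f_f[OF inj_on_\<Phi> that])
    have der: "((\<lambda>s. f (\<Psi> (\<gamma> s))) has_derivative (\<lambda>h. 0)) (at s within closed_segment a b)"
      if s: "s \<in> closed_segment a b" for s
    proof -
      obtain x where x: "x \<in> U" "\<gamma> s = \<Phi> x" using \<gamma>(3)[OF s] by auto
      define g' where "g' = inv (FD \<Phi> x)"
      have g': "FD \<Phi> x \<circ> g' = id" "g' \<circ> FD \<Phi> x = id"
        unfolding g'_def using surj_FD_\<Phi>[OF x(1)] inj_FD_\<Phi>[OF x(1)]
        by (simp_all add: surj_iff[symmetric] inj_iff[symmetric])
      have d\<Psi>: "(\<Psi> has_derivative g') (at (\<gamma> s))"
        unfolding x(2)
        by (rule has_derivative_inverse_on[OF open_U smooth_on_has_derivative[OF sm_\<Phi>] \<Psi>, where g' = "\<lambda>_. g'"])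
           (use g' x in auto)
      have "(f has_derivative FD f x) (at (\<Psi> (\<gamma> s)))"
        using smooth_on_has_derivative[OF f x(1)] by (simp add: x(2) \<Psi>[OF x(1)])
      from has_derivative_compose[OF d\<Psi> this]
      have "((\<lambda>z. f (\<Psi> z)) has_derivative (\<lambda>v. FD f x (g' v))) (at (\<gamma> s))" .
      from has_derivative_compose[OF \<gamma>(4)[OF s, unfolded has_vector_derivative_def] this]
      have "((\<lambda>s. f (\<Psi> (\<gamma> s))) has_derivative (\<lambda>h. FD f x (g' (h *\<^sub>R total_field F' (\<gamma> s)))))
          (at s within closed_segment a b)" .
      moreover have "FD f x (g' (h *\<^sub>R total_field F' (\<gamma> s))) = 0" for h
      proof -
        \<comment> \<open>The new total field is the image of X_F divided by
          \<open>lam\<close>.\<close>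
        have "h *\<^sub>R total_field F' (\<gamma> s) = FD \<Phi> x ((h / lam x) *\<^sub>R total_field F x)"
          unfolding linear_cmul[OF linear_FD_\<Phi>[OF x(1)]] FD_\<Phi>_total[OF x(1)] x(2)
          using lam_nonzero[OF x(1)] by simp
        then have "g' (h *\<^sub>R total_field F' (\<gamma> s)) = (h / lam x) *\<^sub>R total_field F x"
          using fun_cong[OF g'(2)] by (simp add: o_def)
        then show ?thesis
          using Xf[OF x(1)] by (simp add: FD_lincomb[OF x(1) f] FD_d)
      qed
      ultimately show ?thesis by simp
    qed
    have "f (\<Psi> (\<gamma> a)) = f (\<Psi> (\<gamma> b))"
      using has_derivative_zero_unique[OF convex_closed_segment der] by (metis ends_in_segment)
    then show "f p = f q" by (simp add: \<gamma>(1,2) \<Psi>[OF p] \<Psi>[OF q])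
  qed
qed

text \<open>Pulling \<open>\<pi>\<close> back by \<open>\<Phi>\<close> turns the new solution space
  into a fibred chart of the old equation, so only the invariants of \<open>F\<close> occur.\<close>

theorem defines_einstein_weyl_iff_invariants:
  assumes \<pi>: "local_solution_space (\<Phi> ` U) F' \<pi>"
  shows "defines_einstein_weyl (\<Phi> ` U) \<pi> \<longleftrightarrow> (\<forall>p\<in>U. W0 F p = 0 \<and> Cartan F p = 0)"
proof -
  have U': "open (\<Phi> ` U)" "smooth_on (\<Phi> ` U) \<pi>"
    using \<pi> by (auto simp: local_solution_space_def third_order_ode_def)
  have e2: "\<exists>k. k \<noteq> 0 \<and> FD \<Phi> p e2 = k *\<^sub>R e2" if "p \<in> U" for p
    using FD_\<Phi>_e2[OF that] jacobian_nonzero[OF that] lam_nonzero[OF that]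
    by (intro exI[of _ "jacobian p / (lam p)\<^sup>2"]) simp
  have "EW_chart (\<Phi> ` U) \<pi> \<longleftrightarrow> EW_chart U (\<lambda>p. \<pi> (\<Phi> p))"
    by (rule EW_chart_compose[OF open_U sm_\<Phi> U' e2 FD_\<Phi>_D2])
  then show ?thesis
    unfolding defines_einstein_weyl_iff[OF U']
    using fibred_chart.EW_chart_iff[OF fibred_chart_compose[OF \<pi>]] by simp
qed

end

theorem theorem7p1:
  fixes U :: "jet set" and F :: "jet \<Rightarrow> real"
  assumes "third_order_ode U F"
  shows "(\<forall>(U', F') \<in> point_class U F. \<forall>\<pi>. local_solution_space U' F' \<pi> \<longrightarrow>
            (defines_einstein_weyl U' \<pi> \<longleftrightarrow>
               (\<forall>p\<in>U. W0 F p = 0 \<and>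
                  2 * deriv_along (V'field F) (K1 F) p + deriv_along Vfield (XF F (K1 F)) p = 0)))
       \<and> (\<forall>p\<in>U. Cartan F p =
            - 3/2 * (deriv_along (V'field F) (K1 F) p - deriv_along Vfield (K0 F) p))
       \<and> ((\<forall>p\<in>U. W0 F p = 0) \<longrightarrow>
            (\<forall>p\<in>U. 2 * deriv_along (V'field F) (K1 F) p + deriv_along Vfield (XF F (K1 F)) p
                 = 2 * (deriv_along (V'field F) (K1 F) p - deriv_along Vfield (K0 F) p)
               \<and> 2 * (deriv_along (V'field F) (K1 F) p - deriv_along Vfield (K0 F) p)
                 = - 4/3 * Cartan F p))"
proof -
  interpret ode U F by unfold_locales (rule assms)
  have K: "2 * deriv_along (V'field F) (K1 F) p + deriv_along Vfield (XF F (K1 F)) p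
      = 2 * (deriv_along (V'field F) (K1 F) p - deriv_along Vfield (K0 F) p)
    \<and> 2 * (deriv_along (V'field F) (K1 F) p - deriv_along Vfield (K0 F) p) = - 4/3 * Cartan F p"
    if "\<forall>p\<in>U. W0 F p = 0" "p \<in> U" for p
    using Wunschmann_K[of p] Cartan_eq_K[of p] that by simp
  have conditions: "(\<forall>p\<in>U. W0 F p = 0 \<and>
        2 * deriv_along (V'field F) (K1 F) p + deriv_along Vfield (XF F (K1 F)) p = 0)
      \<longleftrightarrow> (\<forall>p\<in>U. W0 F p = 0 \<and> Cartan F p = 0)"
  \<comment> \<open>The identity between the second condition and C is available under W_0 = 0;
    otherwise both sides are false.\<close>
  proof (cases "\<forall>p\<in>U. W0 F p = 0")
    case True
    have "2 * deriv_along (V'field F) (K1 F) p + deriv_along Vfield (XF F (K1 F)) p = 0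
        \<longleftrightarrow> Cartan F p = 0" if "p \<in> U" for p
      using K[OF True that] by (auto simp del: mult_eq_0_iff)
    then show ?thesis by blast
  qed blast
  have "defines_einstein_weyl U' \<pi> \<longleftrightarrow> (\<forall>p\<in>U. W0 F p = 0 \<and> Cartan F p = 0)"
    if UF': "(U', F') \<in> point_class U F" and \<pi>: "local_solution_space U' F' \<pi>" for U' F' \<pi>
  proof -
    obtain W \<tau> \<xi> where pc: "point_change U F W \<tau> \<xi> F'" and U': "U' = prolong \<tau> \<xi> ` U"
      using UF' unfolding point_class_def point_equivalent_def
      by (auto simp: point_change_def point_change_axioms_def ode_axioms)
    show ?thesis
      using point_change.defines_einstein_weyl_iff_invariants[OF pc] \<pi> unfolding U' by blast
  qed
  then show ?thesis
    unfolding conditions using K Cartan_eq_K by blast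
qed

end
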